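(* Let $d\ge2$, let $B_1\subset\mathbb{R}^d$ be the unit ball, $B_1^+=B_1\cap\{x_d>0\}$, $B_1'=B_1\cap\{x_d=0\}$, and let $g\in H^1(B_1^+)$ be such that $g\ge0$ on $B_1'$. Let $\varphi\in\mathcal K_{th}$ be the unique solution of the thin-obstacle problem $\min_{u\in\mathcal K_{th}}\mathcal F_{th}(u)$. There is a dimensional constant $C_d$ such that $$\big(\mathcal F_{th}(u)-\mathcal F_{th}(\varphi)\big)^{1/2}\le C_d\,\|\nabla\mathcal F_{th}(u)\|_{\mathcal K_{th}}$$ for every $u\in H^2(B_1^+)\cap\mathcal K_{th}$ such that $$\frac{\partial u}{\partial x_d}\le0\quad\text{on }B_1'\qquad\text{and}\qquad u\,\frac{\partial u}{\partial x_d}=0\quad\text{on }B_1'.$$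
   Context: $\mathcal K_{th}=\{u\in H^1(B_1^+):u\ge0\text{ on }B_1',\ u=g\text{ on }\partial B_1\cap\{x_d>0\}\}$ (in the sense of traces). Functions in $\mathcal K_{th}$ are extended to $B_1$ evenly with respect to $\{x_d=0\}$, and $\mathcal F_{th}(u)=\frac12\int_{B_1}|\nabla u|^2\,dx$. On $B_1'$, $\frac{\partial u}{\partial x_d}$ is the trace from $B_1^+$. For $u\in H^2(B_1^+)$, $\nabla\mathcal F_{th}(u)=-\Delta u\in L^2(B_1^+)$, and for $u\in H^2(B_1^+)\cap\mathcal K_{th}$ $$\|\nabla\mathcal F_{th}(u)\|_{\mathcal K_{th}}:=\sup\Big\{0,\ \sup_{v\in\mathcal K_{th}\setminus\{u\}}\frac{\int_{B_1^+}(v-u)\,\Delta u\,dx}{\|v-u\|_{L^2(B_1^+)}}\Big\}.$$ "Dimensional" means depending only on $d$ (not on $g$). *)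

theory Defs
  imports "HOL-Analysis.Analysis"
begin

section \<open>Sobolev spaces on an open set\<close>

definition square_integrable :: "'a measure \<Rightarrow> ('a \<Rightarrow> real) \<Rightarrow> bool" where
  "square_integrable M f \<longleftrightarrow> f \<in> borel_measurable M \<and> integrable M (\<lambda>x. (f x)\<^sup>2)"

definition L2_norm :: "'a measure \<Rightarrow> ('a \<Rightarrow> real) \<Rightarrow> real" where
  "L2_norm M f = sqrt (LINT x|M. (f x)\<^sup>2)"

definition C1 :: "('a::euclidean_space \<Rightarrow> real) \<Rightarrow> bool" where
  "C1 f \<longleftrightarrow> (\<forall>x. f differentiable at x) \<and>
     (\<forall>e\<in>Basis. continuous_on UNIV (\<lambda>x. frechet_derivative f (at x) e))"

definition test_function :: "'a::euclidean_space set \<Rightarrow> ('a \<Rightarrow> real) \<Rightarrow> bool" where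
  "test_function \<Omega> \<eta> \<longleftrightarrow> C1 \<eta> \<and>
     compact (closure {x. \<eta> x \<noteq> 0}) \<and> closure {x. \<eta> x \<noteq> 0} \<subseteq> \<Omega>"

text \<open>First-order weak derivatives are tested against compactly supported functions of class
  \<open>C\<^sup>1\<close>, as in Gilbarg--Trudinger, Section 7.3; by mollification this is the same notion as with
  \<open>C\<^sup>\<infinity>\<close> test functions.\<close>

definition has_weak_partial ::
  "'a::euclidean_space set \<Rightarrow> 'a \<Rightarrow> ('a \<Rightarrow> real) \<Rightarrow> ('a \<Rightarrow> real) \<Rightarrow> bool" where
  "has_weak_partial \<Omega> e u w \<longleftrightarrow> square_integrable (lebesgue_on \<Omega>) w \<and>
     (\<forall>\<eta>. test_function \<Omega> \<eta> \<longrightarrow>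
        (LINT x|lebesgue_on \<Omega>. u x * frechet_derivative \<eta> (at x) e)
          = - (LINT x|lebesgue_on \<Omega>. w x * \<eta> x))"

text \<open>The weak partial derivative is determined up to a null set only; an arbitrary
  representative is chosen.\<close>

definition weak_partial ::
  "'a::euclidean_space set \<Rightarrow> 'a \<Rightarrow> ('a \<Rightarrow> real) \<Rightarrow> 'a \<Rightarrow> real" where
  "weak_partial \<Omega> e u = (SOME w. has_weak_partial \<Omega> e u w)"

definition weak_grad :: "'a::euclidean_space set \<Rightarrow> ('a \<Rightarrow> real) \<Rightarrow> 'a \<Rightarrow> 'a" where
  "weak_grad \<Omega> u x = (\<Sum>e\<in>Basis. weak_partial \<Omega> e u x *\<^sub>R e)"

definition weak_laplacian :: "'a::euclidean_space set \<Rightarrow> ('a \<Rightarrow> real) \<Rightarrow> 'a \<Rightarrow> real" where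
  "weak_laplacian \<Omega> u x = (\<Sum>e\<in>Basis. weak_partial \<Omega> e (weak_partial \<Omega> e u) x)"

definition H1 :: "'a::euclidean_space set \<Rightarrow> ('a \<Rightarrow> real) set" where
  "H1 \<Omega> = {u. square_integrable (lebesgue_on \<Omega>) u \<and> (\<forall>e\<in>Basis. \<exists>w. has_weak_partial \<Omega> e u w)}"

definition H2 :: "'a::euclidean_space set \<Rightarrow> ('a \<Rightarrow> real) set" where
  "H2 \<Omega> = {u \<in> H1 \<Omega>. \<forall>e\<in>Basis. weak_partial \<Omega> e u \<in> H1 \<Omega>}"

definition H1_norm :: "'a::euclidean_space set \<Rightarrow> ('a \<Rightarrow> real) \<Rightarrow> real" where
  "H1_norm \<Omega> u =
     sqrt ((LINT x|lebesgue_on \<Omega>. (u x)\<^sup>2) + (LINT x|lebesgue_on \<Omega>. (norm (weak_grad \<Omega> u x))\<^sup>2))"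

text \<open>\<open>has_trace \<Omega> M u T\<close>: the function \<open>T\<close> is the trace of \<open>u \<in> H\<^sup>1(\<Omega>)\<close> on the part of the boundary
  carrying the surface measure \<open>M\<close>. As usual, the trace is the continuous extension, from the
  \<open>H\<^sup>1\<close> norm to the \<open>L\<^sup>2\<close> norm on the boundary, of the restriction of functions that are
  \<open>C\<^sup>1\<close> up to the boundary.\<close>

definition has_trace ::
  "'a::euclidean_space set \<Rightarrow> 'a measure \<Rightarrow> ('a \<Rightarrow> real) \<Rightarrow> ('a \<Rightarrow> real) \<Rightarrow> bool" where
  "has_trace \<Omega> M u T \<longleftrightarrow> u \<in> H1 \<Omega> \<and> square_integrable M T \<and>
     (\<exists>w :: nat \<Rightarrow> 'a \<Rightarrow> real. (\<forall>n. C1 (w n)) \<and>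
        (\<lambda>n. H1_norm \<Omega> (\<lambda>x. w n x - u x)) \<longlonglongrightarrow> 0 \<and>
        (\<lambda>n. L2_norm M (\<lambda>x. w n x - T x)) \<longlonglongrightarrow> 0)"

section \<open>The half ball\<close>

text \<open>The space \<open>\<real>\<^sup>d\<close>, \<open>d \<ge> 2\<close>, is \<open>\<real>\<^sup>d\<^sup>-\<^sup>1 \<times> \<real>\<close> with \<open>d = CARD('n) + 1\<close>. A point is
  \<open>(x', x\<^sub>d)\<close>, so that \<open>x\<^sub>d\<close> is \<open>snd x\<close> and the last unit vector is \<open>(0, 1)\<close>; the product norm is
  the Euclidean one.\<close>

type_synonym 'n space = "(real ^ 'n) \<times> real"

definition half_ball :: "'n::finite space set" where
  "half_ball = {x \<in> ball 0 1. 0 < snd x}"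

text \<open>Lebesgue measure of dimension \<open>d - 1\<close> on \<open>B\<^sub>1 \<inter> {x\<^sub>d = 0}\<close>.\<close>

definition flat_measure :: "'n::finite space measure" where
  "flat_measure = distr (restrict_space lborel (ball (0 :: real ^ 'n) 1)) borel (\<lambda>x'. (x', 0))"

text \<open>Surface measure of the unit sphere, through polar coordinates:
  \<open>\<sigma>(A) = d |{r \<theta> | 0 < r < 1, \<theta> \<in> A}|\<close>. Here \<open>sgn x = x / |x|\<close>.\<close>

definition sphere_measure :: "'a::euclidean_space measure" where
  "sphere_measure =
     scale_measure (of_nat DIM('a)) (distr (restrict_space lborel (ball 0 1)) borel sgn)"

definition hemisphere_measure :: "'n::finite space measure" where
  "hemisphere_measure = restrict_space sphere_measure {x \<in> sphere 0 1. 0 < snd x}"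

section \<open>The thin-obstacle problem\<close>

definition nonneg_on_flat :: "('n::finite space \<Rightarrow> real) \<Rightarrow> bool" where
  "nonneg_on_flat u \<longleftrightarrow>
     (\<exists>T. has_trace half_ball flat_measure u T \<and> (AE x in flat_measure. 0 \<le> T x))"

definition K_th :: "('n::finite space \<Rightarrow> real) \<Rightarrow> ('n space \<Rightarrow> real) set" where
  "K_th g = {u \<in> H1 half_ball. nonneg_on_flat u \<and>
     (\<exists>T. has_trace half_ball hemisphere_measure u T \<and> has_trace half_ball hemisphere_measure g T)}"

definition even_ext :: "('n::finite space \<Rightarrow> real) \<Rightarrow> 'n space \<Rightarrow> real" where
  "even_ext u = (\<lambda>(x', t). u (x', \<bar>t\<bar>))"

definition F_th :: "('n::finite space \<Rightarrow> real) \<Rightarrow> real" where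
  "F_th u = 1 / 2 * (LINT x|lebesgue_on (ball 0 1). (norm (weak_grad (ball 0 1) (even_ext u) x))\<^sup>2)"

definition thin_obstacle_solution ::
  "('n::finite space \<Rightarrow> real) \<Rightarrow> ('n space \<Rightarrow> real) \<Rightarrow> bool" where
  "thin_obstacle_solution g \<phi> \<longleftrightarrow> \<phi> \<in> K_th g \<and> (\<forall>v\<in>K_th g. F_th \<phi> \<le> F_th v)"

text \<open>The norm \<open>\<parallel>\<nabla>F\<^sub>t\<^sub>h(u)\<parallel>\<close> relative to \<open>K\<^sub>t\<^sub>h\<close>. Functions are identified when they agree almost
  everywhere, which is what \<open>v \<noteq> u\<close> refers to; a supremum over the empty set is \<open>-\<infinity>\<close>.\<close>

definition grad_F_norm :: "('n::finite space \<Rightarrow> real) \<Rightarrow> ('n space \<Rightarrow> real) \<Rightarrow> ereal" where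
  "grad_F_norm g u =
     max 0 (SUP v \<in> {v \<in> K_th g. \<not> (AE x in lebesgue_on half_ball. v x = u x)}.
       ereal ((LINT x|lebesgue_on half_ball. (v x - u x) * weak_laplacian half_ball u x)
              / L2_norm (lebesgue_on half_ball) (\<lambda>x. v x - u x)))"

end

theory Submission
  imports Defs
begin

text \<open>
  Write \<open>z = u - \<phi>\<close>. Even reflection doubles the Dirichlet integral of the half ball, so \<open>F_th\<close> is the
  Dirichlet integral over the half ball (\<open>F_th_eq_sum_half_ball\<close>), and expanding the square gives
  \<open>F_th u - F_th \<phi> = 2 \<integral> \<nabla>u \<bullet> \<nabla>z - \<integral> |\<nabla>z|\<^sup>2\<close>. In the integration by parts
  of the first term the hemisphere contributes nothing, since \<open>z\<close> has zero trace there. The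
  flat boundary contributes \<open>- 2 \<integral> N (T - S)\<close>, where \<open>T\<close> and \<open>S\<close> are the traces of \<open>u\<close> and \<open>\<phi>\<close>
  and \<open>N\<close> is the trace of the last partial derivative of \<open>u\<close>. As \<open>T N = 0\<close>, \<open>N \<le> 0\<close> and \<open>S \<ge> 0\<close>, this
  contribution is nonpositive. Hence
  \<open>F_th u - F_th \<phi> \<le> 2 \<integral> (\<phi> - u) \<Delta>u - \<integral> |\<nabla>z|\<^sup>2\<close>.
  If \<open>G\<close> denotes the norm of the gradient of \<open>F_th\<close> relative to \<open>K_th g\<close>, the first term is at most
  \<open>2 G\<close> times the \<open>L\<^sup>2\<close> norm of \<open>z\<close>, and the Poincare inequality bounds that norm by \<open>sqrt 2\<close> times the
  \<open>L\<^sup>2\<close> norm of \<open>\<nabla>z\<close>. Completing the square yields \<open>F_th u - F_th \<phi> \<le> 2 G\<^sup>2\<close>, so \<open>C = sqrt 2\<close> works.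

  Most of the work justifies the integration by parts for functions that are known only through
  weak derivatives and traces. Two cutoffs do this. Near the flat boundary
  (\<open>weak_partial_test_up_to_flat\<close>) a cutoff in the last coordinate is harmless for tangential
  derivatives; for the normal derivative the \<open>C\<^sup>1\<close> approximations that define the trace \<open>N\<close> are
  used (\<open>normal_integration_by_parts\<close>). Near the sphere, the cutoff is removed by means of a
  Hardy-type estimate (\<open>shell_estimate\<close>): if \<open>z\<close> has zero trace on the hemisphere, then
  \<open>\<integral> z\<^sup>2 \<le> 2 (1 - \<rho>)\<^sup>2 \<integral> |\<nabla>z|\<^sup>2\<close> over the shell \<open>\<rho> < |x| < 1\<close>. The Poincare inequality is its limit
  \<open>\<rho> \<rightarrow> 0\<close>. The estimate follows from the one-dimensional Cauchy--Schwarz inequality on rays and from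
  the scaling of Lebesgue measure.
\<close>

section \<open>Square integrable functions\<close>

lemma square_integrable_mult:
  assumes "square_integrable M f" "square_integrable M g"
  shows "integrable M (\<lambda>x. f x * g x)"
proof (rule Bochner_Integration.integrable_bound)
  show "integrable M (\<lambda>x. (f x)\<^sup>2 + (g x)\<^sup>2)"
    using assms by (auto simp: square_integrable_def)
  show "(\<lambda>x. f x * g x) \<in> borel_measurable M"
    using assms by (auto simp: square_integrable_def)
  have "\<bar>a * b\<bar> \<le> a\<^sup>2 + b\<^sup>2" for a b :: real
  proof -
    have "2 * \<bar>a * b\<bar> \<le> a\<^sup>2 + b\<^sup>2"
      using sum_squares_bound[of "\<bar>a\<bar>" "\<bar>b\<bar>"] by (simp add: abs_mult)
    moreover have "0 \<le> \<bar>a * b\<bar>" by simp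
    ultimately show ?thesis by linarith
  qed
  then show "AE x in M. norm (f x * g x) \<le> norm ((f x)\<^sup>2 + (g x)\<^sup>2)"
    by (auto intro!: AE_I2)
qed

lemma square_integrable_add:
  assumes "square_integrable M f" "square_integrable M g"
  shows "square_integrable M (\<lambda>x. f x + g x)"
  using assms square_integrable_mult[OF assms]
  by (auto simp: square_integrable_def power2_sum mult.assoc)

lemma square_integrable_cmult:
  assumes "square_integrable M f"
  shows "square_integrable M (\<lambda>x. c * f x)"
  using assms by (auto simp: square_integrable_def power_mult_distrib)

lemma square_integrable_diff:
  assumes "square_integrable M f" "square_integrable M g"
  shows "square_integrable M (\<lambda>x. f x - g x)"
  using square_integrable_add[OF assms(1) square_integrable_cmult[OF assms(2), of "-1"]] by simp

lemma square_integrable_sum: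
  assumes "\<And>i. i \<in> I \<Longrightarrow> square_integrable M (f i)"
  shows "square_integrable M (\<lambda>x. \<Sum>i\<in>I. f i x)"
  using assms
proof (induction I rule: infinite_finite_induct)
  case (insert i I)
  then show ?case by (simp add: square_integrable_add)
qed (simp_all add: square_integrable_def)

lemma square_integrable_bounded_mult:
  assumes f: "square_integrable M f" and c: "c \<in> borel_measurable M"
    and B: "\<And>x. x \<in> space M \<Longrightarrow> \<bar>c x\<bar> \<le> B"
  shows "square_integrable M (\<lambda>x. c x * f x)"
  unfolding square_integrable_def
proof (intro conjI)
  show "(\<lambda>x. c x * f x) \<in> borel_measurable M"
    using f c by (auto simp: square_integrable_def)
  show "integrable M (\<lambda>x. (c x * f x)\<^sup>2)"
  proof (rule Bochner_Integration.integrable_bound)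
    show "integrable M (\<lambda>x. B\<^sup>2 * (f x)\<^sup>2)"
      using f by (auto simp: square_integrable_def)
    show "(\<lambda>x. (c x * f x)\<^sup>2) \<in> borel_measurable M"
      using f c by (auto simp: square_integrable_def)
    have "(c x * f x)\<^sup>2 \<le> B\<^sup>2 * (f x)\<^sup>2" if "x \<in> space M" for x
      using power_mono[OF B[OF that], of 2] by (simp add: power_mult_distrib mult_right_mono)
    then show "AE x in M. norm ((c x * f x)\<^sup>2) \<le> norm (B\<^sup>2 * (f x)\<^sup>2)"
      by (intro AE_I2) simp
  qed
qed

lemma L2_norm_nonneg [simp]: "0 \<le> L2_norm M f"
  by (simp add: L2_norm_def)

lemma L2_norm_power2: "(L2_norm M f)\<^sup>2 = (LINT x|M. (f x)\<^sup>2)"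
  by (simp add: L2_norm_def)

lemma L2_norm_cmult: "L2_norm M (\<lambda>x. c * f x) = \<bar>c\<bar> * L2_norm M f"
  by (simp add: L2_norm_def power_mult_distrib real_sqrt_mult)

lemma Cauchy_Schwarz_L2:
  assumes f: "square_integrable M f" and g: "square_integrable M g"
  shows "\<bar>LINT x|M. f x * g x\<bar> \<le> L2_norm M f * L2_norm M g"
proof -
  define A B C where "A = (LINT x|M. (f x)\<^sup>2)" and "B = (LINT x|M. (g x)\<^sup>2)"
    and "C = (LINT x|M. f x * g x)"
  have q: "0 \<le> A + 2 * t * C + t\<^sup>2 * B" for t
  proof -
    have "0 \<le> (LINT x|M. (f x + t * g x)\<^sup>2)" by simp
    also have "(LINT x|M. (f x + t * g x)\<^sup>2)
        = (LINT x|M. (f x)\<^sup>2 + (2 * t) * (f x * g x) + t\<^sup>2 * (g x)\<^sup>2)"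
      by (intro Bochner_Integration.integral_cong) (auto simp: power2_eq_square algebra_simps)
    also have "\<dots> = A + 2 * t * C + t\<^sup>2 * B"
      using f g square_integrable_mult[OF f g] by (simp add: A_def B_def C_def square_integrable_def)
    finally show ?thesis .
  qed
  have AB: "A \<ge> 0" "B \<ge> 0" by (auto simp: A_def B_def)
  have "C\<^sup>2 \<le> A * B"
  proof (cases "B = 0")
    case True
    have "C = 0"
    proof (rule ccontr)
      assume "C \<noteq> 0"
      then show False using q[of "- (A + 1) / (2 * C)"] True AB by (simp add: field_simps)
    qed
    then show ?thesis using True by simp
  next
    case False
    then have "B > 0" using AB by simp
    then show ?thesis using q[of "- C / B"] by (simp add: field_simps power2_eq_square)
  qed
  then have "sqrt (C\<^sup>2) \<le> sqrt (A * B)" by (rule real_sqrt_le_mono)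
  then have "\<bar>C\<bar> \<le> sqrt A * sqrt B" by (simp only: real_sqrt_abs real_sqrt_mult)
  then show ?thesis by (simp only: A_def B_def C_def L2_norm_def)
qed

lemma L2_norm_triangle:
  assumes f: "square_integrable M f" and g: "square_integrable M g"
  shows "L2_norm M (\<lambda>x. f x + g x) \<le> L2_norm M f + L2_norm M g"
proof (rule power2_le_imp_le)
  have "(L2_norm M (\<lambda>x. f x + g x))\<^sup>2 = (LINT x|M. (f x)\<^sup>2 + 2 * (f x * g x) + (g x)\<^sup>2)"
    unfolding L2_norm_power2
    by (intro Bochner_Integration.integral_cong) (auto simp: power2_eq_square algebra_simps)
  also have "\<dots> = (L2_norm M f)\<^sup>2 + 2 * (LINT x|M. f x * g x) + (L2_norm M g)\<^sup>2"
    using f g square_integrable_mult[OF f g] by (simp add: L2_norm_power2 square_integrable_def)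
  also have "\<dots> \<le> (L2_norm M f + L2_norm M g)\<^sup>2"
    using Cauchy_Schwarz_L2[OF f g] by (simp add: power2_sum)
  finally show "(L2_norm M (\<lambda>x. f x + g x))\<^sup>2 \<le> (L2_norm M f + L2_norm M g)\<^sup>2" .
qed simp

lemma L2_norm_triangle_diff:
  assumes f: "square_integrable M f" and g: "square_integrable M g"
  shows "L2_norm M (\<lambda>x. f x - g x) \<le> L2_norm M f + L2_norm M g"
  using L2_norm_triangle[OF f square_integrable_cmult[OF g, of "-1"]]
  using L2_norm_cmult[of M "-1" g] by simp

text \<open>Both the sequence and the limit are required to be square integrable: \<open>L2_norm\<close> is built from a
Bochner integral, which is \<open>0\<close> for functions that are not integrable.\<close>

definition L2_tendsto :: "'a measure \<Rightarrow> (nat \<Rightarrow> 'a \<Rightarrow> real) \<Rightarrow> ('a \<Rightarrow> real) \<Rightarrow> bool" where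
  "L2_tendsto M f F \<longleftrightarrow> (\<forall>n. square_integrable M (f n)) \<and> square_integrable M F \<and>
     (\<lambda>n. L2_norm M (\<lambda>x. f n x - F x)) \<longlonglongrightarrow> 0"

lemma L2_tendsto_const: "square_integrable M F \<Longrightarrow> L2_tendsto M (\<lambda>_. F) F"
  by (simp add: L2_tendsto_def L2_norm_def)

lemma L2_tendsto_diff:
  assumes f: "L2_tendsto M f F" and g: "L2_tendsto M g G"
  shows "L2_tendsto M (\<lambda>n x. f n x - g n x) (\<lambda>x. F x - G x)"
  unfolding L2_tendsto_def
proof (intro conjI allI)
  have lim: "(\<lambda>n. L2_norm M (\<lambda>x. f n x - F x) + L2_norm M (\<lambda>x. g n x - G x)) \<longlonglongrightarrow> 0"
    using f g tendsto_add[of _ 0 sequentially _ 0] by (auto simp: L2_tendsto_def)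
  show "(\<lambda>n. L2_norm M (\<lambda>x. f n x - g n x - (F x - G x))) \<longlonglongrightarrow> 0"
  proof (rule tendsto_sandwich[OF _ _ tendsto_const lim])
    have "L2_norm M (\<lambda>x. f n x - g n x - (F x - G x))
        \<le> L2_norm M (\<lambda>x. f n x - F x) + L2_norm M (\<lambda>x. g n x - G x)" for n
      using L2_norm_triangle_diff[of M "\<lambda>x. f n x - F x" "\<lambda>x. g n x - G x"] f g
      by (simp add: L2_tendsto_def square_integrable_diff algebra_simps)
    then show "\<forall>\<^sub>F n in sequentially. L2_norm M (\<lambda>x. f n x - g n x - (F x - G x))
        \<le> L2_norm M (\<lambda>x. f n x - F x) + L2_norm M (\<lambda>x. g n x - G x)" by simp
  qed simp
qed (use f g in \<open>auto simp: L2_tendsto_def square_integrable_diff\<close>)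

lemma L2_tendsto_bounded_mult:
  assumes f: "L2_tendsto M f F" and c: "c \<in> borel_measurable M"
    and B: "\<And>x. x \<in> space M \<Longrightarrow> \<bar>c x\<bar> \<le> B"
  shows "L2_tendsto M (\<lambda>n x. c x * f n x) (\<lambda>x. c x * F x)"
  unfolding L2_tendsto_def
proof (intro conjI allI)
  have lim: "(\<lambda>n. \<bar>B\<bar> * L2_norm M (\<lambda>x. f n x - F x)) \<longlonglongrightarrow> 0"
    using f tendsto_mult_right_zero by (auto simp: L2_tendsto_def)
  show "(\<lambda>n. L2_norm M (\<lambda>x. c x * f n x - c x * F x)) \<longlonglongrightarrow> 0"
  proof (rule tendsto_sandwich[OF _ _ tendsto_const lim])
    have "L2_norm M (\<lambda>x. c x * f n x - c x * F x) \<le> \<bar>B\<bar> * L2_norm M (\<lambda>x. f n x - F x)" for n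
    proof -
      have sq: "square_integrable M (\<lambda>x. f n x - F x)"
        using f by (simp add: L2_tendsto_def square_integrable_diff)
      have "(LINT x|M. (c x * (f n x - F x))\<^sup>2) \<le> (LINT x|M. (B * (f n x - F x))\<^sup>2)"
      proof (rule integral_mono)
        show "integrable M (\<lambda>x. (c x * (f n x - F x))\<^sup>2)"
          using square_integrable_bounded_mult[OF sq c B] by (simp add: square_integrable_def)
        show "integrable M (\<lambda>x. (B * (f n x - F x))\<^sup>2)"
          using square_integrable_cmult[OF sq, of B] by (simp add: square_integrable_def)
        show "(c x * (f n x - F x))\<^sup>2 \<le> (B * (f n x - F x))\<^sup>2" if "x \<in> space M" for x
          using power_mono[OF B[OF that], of 2] by (simp add: power_mult_distrib mult_right_mono)
      qed
      then have "L2_norm M (\<lambda>x. c x * (f n x - F x)) \<le> L2_norm M (\<lambda>x. B * (f n x - F x))"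
        by (simp add: L2_norm_def)
      then show ?thesis unfolding L2_norm_cmult by (simp add: right_diff_distrib)
    qed
    then show "\<forall>\<^sub>F n in sequentially. L2_norm M (\<lambda>x. c x * f n x - c x * F x) \<le> \<bar>B\<bar> * L2_norm M (\<lambda>x. f n x - F x)"
      by simp
  qed simp
qed (use f in \<open>auto simp: L2_tendsto_def intro: square_integrable_bounded_mult[OF _ c B]\<close>)

text \<open>Every passage to the limit in an integration by parts formula below is an instance of this
continuity of the inner product.\<close>

lemma L2_tendsto_inner:
  assumes f: "L2_tendsto M f F" and g: "L2_tendsto M g G"
  shows "(\<lambda>n. LINT x|M. f n x * g n x) \<longlonglongrightarrow> (LINT x|M. F x * G x)"
proof -
  define a where "a n = L2_norm M (\<lambda>x. f n x - F x)" for n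
  define b where "b n = L2_norm M (\<lambda>x. g n x - G x)" for n
  have sq: "square_integrable M (f n)" "square_integrable M (g n)"
    "square_integrable M (\<lambda>x. f n x - F x)" "square_integrable M (\<lambda>x. g n x - G x)" for n
    using f g by (auto simp: L2_tendsto_def square_integrable_diff)
  have sq': "square_integrable M F" "square_integrable M G"
    using f g by (auto simp: L2_tendsto_def square_integrable_diff)
  have a: "a \<longlonglongrightarrow> 0" and b: "b \<longlonglongrightarrow> 0"
    using f g by (auto simp: L2_tendsto_def a_def[abs_def] b_def[abs_def])
  have bd: "\<bar>(LINT x|M. f n x * g n x) - (LINT x|M. F x * G x)\<bar>
      \<le> a n * b n + a n * L2_norm M G + L2_norm M F * b n" for n
  proof -
    have "(LINT x|M. f n x * g n x) - (LINT x|M. F x * G x)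
        = (LINT x|M. (f n x - F x) * (g n x - G x) + (f n x - F x) * G x + F x * (g n x - G x))"
      using sq[of n] sq' by (subst Bochner_Integration.integral_diff[symmetric])
        (auto intro!: square_integrable_mult Bochner_Integration.integral_cong simp: algebra_simps)
    also have "\<dots> = (LINT x|M. (f n x - F x) * (g n x - G x)) + (LINT x|M. (f n x - F x) * G x)
        + (LINT x|M. F x * (g n x - G x))"
      using sq[of n] sq' by (simp add: square_integrable_mult)
    finally show ?thesis
      using Cauchy_Schwarz_L2[OF sq(3)[of n] sq(4)[of n]] Cauchy_Schwarz_L2[OF sq(3)[of n] sq'(2)]
        Cauchy_Schwarz_L2[OF sq'(1) sq(4)[of n]]
      unfolding a_def b_def by linarith
  qed
  have "(\<lambda>n. a n * b n + a n * L2_norm M G + L2_norm M F * b n) \<longlonglongrightarrow> 0"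
    using tendsto_add[OF tendsto_add[OF tendsto_mult[OF a b] tendsto_mult[OF a tendsto_const]]
        tendsto_mult[OF tendsto_const b]] by simp
  then have "(\<lambda>n. (LINT x|M. f n x * g n x) - (LINT x|M. F x * G x)) \<longlonglongrightarrow> 0"
    by (rule Lim_null_comparison[rotated]) (use bd in auto)
  then show ?thesis by (simp add: LIM_zero_iff)
qed

section \<open>Functions of class \<open>C\<^sup>1\<close>\<close>

lemma C1_D:
  assumes "C1 f"
  shows "f differentiable (at x)" "(f has_derivative frechet_derivative f (at x)) (at x)"
    "continuous_on A f" "f \<in> borel_measurable borel"
    "linear (frechet_derivative f (at x))"
proof -
  show d: "f differentiable (at x)" for x using assms by (simp add: C1_def)
  show "(f has_derivative frechet_derivative f (at x)) (at x)"
    using d frechet_derivative_works by blast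
  show c: "continuous_on A f" for A
    using d by (meson continuous_at_imp_continuous_on differentiable_imp_continuous_within)
  show "f \<in> borel_measurable borel" using c by (rule borel_measurable_continuous_onI)
  show "linear (frechet_derivative f (at x))" using d by (rule linear_frechet_derivative)
qed

lemma C1_I:
  assumes "\<And>x. (f has_derivative D x) (at x)"
    and "\<And>e. e \<in> Basis \<Longrightarrow> continuous_on UNIV (\<lambda>x. D x e)"
  shows "C1 f" "frechet_derivative f (at x) = D x"
proof -
  have D: "frechet_derivative f (at x) = D x" for x
    using assms(1) frechet_derivative_at by metis
  show "C1 f" using assms D unfolding C1_def differentiable_def by auto
  show "frechet_derivative f (at x) = D x" by (rule D)
qed

lemma C1_continuous_partial:
  assumes "C1 (f :: 'a::euclidean_space \<Rightarrow> real)"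
  shows "continuous_on A (\<lambda>x. frechet_derivative f (at x) e)"
proof -
  have "frechet_derivative f (at x) e = (\<Sum>b\<in>Basis. (e \<bullet> b) * frechet_derivative f (at x) b)" for x
  proof -
    have lin: "linear (frechet_derivative f (at x))" using C1_D(5)[OF assms] .
    have "frechet_derivative f (at x) e = frechet_derivative f (at x) (\<Sum>b\<in>Basis. (e \<bullet> b) *\<^sub>R b)"
      by (simp add: euclidean_representation)
    then show ?thesis by (simp add: linear_sum[OF lin] linear_cmul[OF lin])
  qed
  moreover have "continuous_on UNIV (\<lambda>x. \<Sum>b\<in>Basis. (e \<bullet> b) * frechet_derivative f (at x) b)"
    using assms by (intro continuous_intros) (auto simp: C1_def)
  ultimately show ?thesis by (auto intro: continuous_on_subset)
qed

lemma C1_const: "C1 (\<lambda>x. c)"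
  by (rule C1_I(1)[where D = "\<lambda>_ _. 0"]) auto

lemma C1_add:
  assumes "C1 f" "C1 g"
  shows "C1 (\<lambda>x. f x + g x)"
    "frechet_derivative (\<lambda>x. f x + g x) (at x) e = frechet_derivative f (at x) e + frechet_derivative g (at x) e"
proof -
  have d: "((\<lambda>x. f x + g x) has_derivative
      (\<lambda>h. frechet_derivative f (at x) h + frechet_derivative g (at x) h)) (at x)" for x
    using assms by (intro has_derivative_add C1_D)
  show "C1 (\<lambda>x. f x + g x)"
    using assms by (intro C1_I(1)[OF d]) (intro continuous_intros C1_continuous_partial)
  show "frechet_derivative (\<lambda>x. f x + g x) (at x) e = frechet_derivative f (at x) e + frechet_derivative g (at x) e"
    using frechet_derivative_at[OF d, symmetric] by metis
qed

lemma C1_mult: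
  assumes "C1 f" "C1 g"
  shows "C1 (\<lambda>x. f x * g x)"
    "frechet_derivative (\<lambda>x. f x * g x) (at x) e
      = f x * frechet_derivative g (at x) e + frechet_derivative f (at x) e * g x"
proof -
  have d: "((\<lambda>x. f x * g x) has_derivative
      (\<lambda>h. f x * frechet_derivative g (at x) h + frechet_derivative f (at x) h * g x)) (at x)" for x
    using assms by (intro has_derivative_mult C1_D)
  show "C1 (\<lambda>x. f x * g x)"
    using assms by (intro C1_I(1)[OF d]) (intro continuous_intros C1_continuous_partial C1_D)
  show "frechet_derivative (\<lambda>x. f x * g x) (at x) e
      = f x * frechet_derivative g (at x) e + frechet_derivative f (at x) e * g x"
    using frechet_derivative_at[OF d, symmetric] by metis
qed

lemma C1_cmult:
  assumes "C1 f"
  shows "C1 (\<lambda>x. c * f x)"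
    "frechet_derivative (\<lambda>x. c * f x) (at x) e = c * frechet_derivative f (at x) e"
  using C1_mult[OF C1_const assms, of c] by (simp_all)

lemma C1_diff:
  assumes "C1 f" "C1 g"
  shows "C1 (\<lambda>x. f x - g x)"
    "frechet_derivative (\<lambda>x. f x - g x) (at x) e = frechet_derivative f (at x) e - frechet_derivative g (at x) e"
  using C1_add[OF assms(1) C1_cmult(1)[OF assms(2), of "-1"]] C1_cmult(2)[OF assms(2), of "-1"] by simp_all

lemma C1_prod:
  assumes "\<And>i. i \<in> I \<Longrightarrow> C1 (f i)"
  shows "C1 (\<lambda>x. \<Prod>i\<in>I. f i x)"
  using assms by (induction I rule: infinite_finite_induct) (auto simp: C1_const C1_mult)

lemma C1_compose_real:
  fixes k :: "real \<Rightarrow> real"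
  assumes k: "\<And>s. (k has_real_derivative k' s) (at s)" "continuous_on UNIV k'" and f: "C1 f"
  shows "C1 (\<lambda>x. k (f x))"
    "frechet_derivative (\<lambda>x. k (f x)) (at x) e = k' (f x) * frechet_derivative f (at x) e"
proof -
  have d: "((\<lambda>x. k (f x)) has_derivative (\<lambda>h. k' (f x) * frechet_derivative f (at x) h)) (at x)" for x
    using has_derivative_compose[OF C1_D(2)[OF f] k(1)[unfolded has_field_derivative_def]] .
  have c: "continuous_on UNIV (\<lambda>x. k' (f x))"
    using continuous_on_compose2[OF k(2) C1_D(3)[OF f]] by auto
  show "C1 (\<lambda>x. k (f x))"
    using assms c by (intro C1_I(1)[OF d]) (intro continuous_intros C1_continuous_partial)
  show "frechet_derivative (\<lambda>x. k (f x)) (at x) e = k' (f x) * frechet_derivative f (at x) e"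
    using frechet_derivative_at[OF d, symmetric] by metis
qed

lemma C1_linear_compose:
  fixes L :: "'a::euclidean_space \<Rightarrow> 'b::euclidean_space"
  assumes L: "bounded_linear L" and f: "C1 f"
  shows "C1 (\<lambda>x. f (L x))"
    "frechet_derivative (\<lambda>x. f (L x)) (at x) e = frechet_derivative f (at (L x)) (L e)"
proof -
  have d: "((\<lambda>x. f (L x)) has_derivative (\<lambda>h. frechet_derivative f (at (L x)) (L h))) (at x)" for x
    using has_derivative_compose[OF bounded_linear_imp_has_derivative[OF L] C1_D(2)[OF f]] .
  have c: "continuous_on UNIV (\<lambda>x. frechet_derivative f (at (L x)) (L e))" for e
    using continuous_on_compose2[OF C1_continuous_partial[OF f] linear_continuous_on[OF L]] by auto
  show "C1 (\<lambda>x. f (L x))"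
    by (intro C1_I(1)[OF d] c)
  show "frechet_derivative (\<lambda>x. f (L x)) (at x) e = frechet_derivative f (at (L x)) (L e)"
    using frechet_derivative_at[OF d, symmetric] by metis
qed

lemma C1_inner:
  "C1 (\<lambda>x. x \<bullet> a)" "frechet_derivative (\<lambda>x. x \<bullet> a) (at x) e = e \<bullet> a"
proof -
  have d: "((\<lambda>x. x \<bullet> a) has_derivative (\<lambda>h. h \<bullet> a)) (at x)" for x
    by (rule bounded_linear_imp_has_derivative) (rule bounded_linear_inner_left)
  show "C1 (\<lambda>x. x \<bullet> a)" by (rule C1_I(1)[OF d]) (rule continuous_on_const)
  show "frechet_derivative (\<lambda>x. x \<bullet> a) (at x) e = e \<bullet> a"
    using frechet_derivative_at[OF d, symmetric] by metis
qed

lemma C1_norm_power2: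
  fixes x :: "'a::euclidean_space"
  shows "C1 (\<lambda>x::'a. (norm x)\<^sup>2)" "frechet_derivative (\<lambda>x. (norm x)\<^sup>2) (at x) e = 2 * (x \<bullet> e)"
proof -
  have d: "((\<lambda>x. (norm x)\<^sup>2) has_derivative (\<lambda>h. 2 * (x \<bullet> h))) (at x)" for x :: 'a
    unfolding power2_norm_eq_inner
    by (rule has_derivative_eq_rhs) (auto intro!: derivative_eq_intros simp: inner_commute)
  show "C1 (\<lambda>x::'a. (norm x)\<^sup>2)" by (rule C1_I(1)[OF d]) (intro continuous_intros)
  show "frechet_derivative (\<lambda>x. (norm x)\<^sup>2) (at x) e = 2 * (x \<bullet> e)"
    using frechet_derivative_at[OF d, symmetric] by metis
qed

lemma C1_snd:
  fixes x :: "'n::finite space"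
  shows "C1 (snd :: 'n space \<Rightarrow> real)" "frechet_derivative snd (at x) e = snd e"
proof -
  have d: "((snd :: 'n space \<Rightarrow> real) has_derivative snd) (at x)" for x
    by (rule bounded_linear_imp_has_derivative) (rule bounded_linear_snd)
  show "C1 (snd :: 'n space \<Rightarrow> real)" by (rule C1_I(1)[OF d]) (rule continuous_on_const)
  show "frechet_derivative snd (at x) e = snd e"
    using frechet_derivative_at[OF d, symmetric] by metis
qed

subsection \<open>A transition function\<close>

lemma max0_square_derivative:
  "((\<lambda>s::real. (max 0 s)\<^sup>2) has_real_derivative 2 * max 0 s) (at s)"
proof (cases "s = 0")
  case True
  have "((\<lambda>h::real. (max 0 h)\<^sup>2 / h) \<longlongrightarrow> 0) (at 0)"
  proof (rule Lim_null_comparison)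
    show "\<forall>\<^sub>F h in at 0. norm ((max 0 h)\<^sup>2 / h) \<le> \<bar>h::real\<bar>"
      by (auto simp: max_def power2_eq_square intro!: always_eventually)
    show "((\<lambda>h::real. \<bar>h\<bar>) \<longlongrightarrow> 0) (at 0)" by (auto intro!: tendsto_eq_intros)
  qed
  then show ?thesis using True by (simp add: DERIV_def)
next
  case False
  show ?thesis
  proof (cases "s > 0")
    case True
    have "((\<lambda>s::real. s\<^sup>2) has_real_derivative 2 * s) (at s)" by (auto intro!: derivative_eq_intros)
    then show ?thesis using True
      by (subst DERIV_cong_ev[where g = "\<lambda>s. s\<^sup>2" and y = s])
         (auto simp: eventually_nhds max_def intro!: exI[of _ "{0<..}"])
  next
    case s: False
    have "((\<lambda>s::real. 0) has_real_derivative 0) (at s)" by simp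
    then show ?thesis using s \<open>s \<noteq> 0\<close>
      by (subst DERIV_cong_ev[where g = "\<lambda>s. 0" and y = s])
         (auto simp: eventually_nhds max_def intro!: exI[of _ "{..<0}"])
  qed
qed

text \<open>Iterating \<open>s \<mapsto> (max 0 s)\<^sup>2\<close> gives a step from \<open>0\<close> (for \<open>s \<le> 0\<close>) to \<open>1\<close> (for \<open>s \<ge> 1\<close>) of class
\<open>C\<^sup>1\<close>. This is all the regularity that a test function needs, and all cutoff functions below are
compositions with this step.\<close>

definition transition :: "real \<Rightarrow> real" where
  "transition s = 1 - (max 0 (1 - (max 0 s)\<^sup>2))\<^sup>2"

definition transition' :: "real \<Rightarrow> real" where
  "transition' s = 4 * max 0 s * max 0 (1 - (max 0 s)\<^sup>2)"

lemma transition_derivative: "(transition has_real_derivative transition' s) (at s)"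
proof -
  have "((\<lambda>s. 1 - (max 0 s)\<^sup>2) has_real_derivative - (2 * max 0 s)) (at s)"
    by (rule derivative_eq_intros max0_square_derivative refl | simp)+
  from DERIV_chain2[OF max0_square_derivative this]
  have "((\<lambda>s. 1 - (max 0 (1 - (max 0 s)\<^sup>2))\<^sup>2) has_real_derivative
      0 - 2 * max 0 (1 - (max 0 s)\<^sup>2) * - (2 * max 0 s)) (at s)"
    by (intro DERIV_diff DERIV_const)
  moreover have "(\<lambda>s. 1 - (max 0 (1 - (max 0 s)\<^sup>2))\<^sup>2) = transition"
    by (auto simp: transition_def)
  ultimately show ?thesis by (simp add: transition'_def algebra_simps)
qed

lemma continuous_on_transition' [continuous_intros]:
  "continuous_on A f \<Longrightarrow> continuous_on A (\<lambda>x. transition' (f x))"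
  unfolding transition'_def by (intro continuous_intros)

lemma transition_0: "s \<le> 0 \<Longrightarrow> transition s = 0"
  by (simp add: transition_def max_def)

lemma transition_1:
  assumes "1 \<le> s"
  shows "transition s = 1"
proof -
  have "1 \<le> s\<^sup>2" using assms by (rule one_le_power)
  moreover have "max 0 s = s" using assms by simp
  ultimately have "max 0 (1 - (max 0 s)\<^sup>2) = 0" by (simp only: max_absorb1 diff_le_0_iff_le)
  then show ?thesis by (simp add: transition_def)
qed

lemma transition_bounds: "0 \<le> transition s" "transition s \<le> 1"
proof -
  have "0 \<le> max 0 (1 - (max 0 s)\<^sup>2)" "max 0 (1 - (max 0 s)\<^sup>2) \<le> 1" by auto
  then have "(max 0 (1 - (max 0 s)\<^sup>2))\<^sup>2 \<le> 1" by (simp add: power_le_one)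
  then show "0 \<le> transition s" "transition s \<le> 1" by (auto simp: transition_def)
qed

lemma transition'_outside: "s \<le> 0 \<or> 1 \<le> s \<Longrightarrow> transition' s = 0"
proof (cases "s \<le> 0")
  case False
  moreover assume "s \<le> 0 \<or> 1 \<le> s"
  ultimately have "1 \<le> s\<^sup>2" by (simp add: one_le_power)
  moreover have "max 0 s = s" using False by simp
  ultimately have "max 0 (1 - (max 0 s)\<^sup>2) = 0" by (simp only: max_absorb1 diff_le_0_iff_le)
  then show ?thesis by (simp add: transition'_def)
qed (simp add: transition'_def max_def)

lemma transition'_bound: "\<bar>transition' s\<bar> \<le> 4"
proof (cases "s \<le> 0 \<or> 1 \<le> s")
  case False
  then have "s * (1 - s\<^sup>2) \<le> 1 * 1" by (intro mult_mono) (auto simp: power_le_one)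
  moreover have "0 \<le> s * (1 - s\<^sup>2)" using False by (simp add: power_le_one)
  ultimately show ?thesis using False by (simp add: transition'_def max_def power_le_one abs_mult)
qed (simp add: transition'_outside)

lemma C1_transition:
  assumes "C1 f"
  shows "C1 (\<lambda>x. transition (f x))"
    "frechet_derivative (\<lambda>x. transition (f x)) (at x) e = transition' (f x) * frechet_derivative f (at x) e"
  using C1_compose_real[OF transition_derivative continuous_on_transition'[OF continuous_on_id] assms] by auto

section \<open>Integration by parts for \<open>C\<^sup>1\<close> functions\<close>

lemma integral_lebesgue_on_borel:
  fixes f :: "'a::euclidean_space \<Rightarrow> real"
  assumes "S \<in> sets borel" "f \<in> borel_measurable borel"
  shows "(LINT x|lebesgue_on S. f x) = (LINT x|lborel. indicator S x * f x)"
proof -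
  have "(LINT x|lebesgue_on S. f x) = (LINT x|completion lborel. indicator S x *\<^sub>R f x)"
    using assms by (intro integral_restrict_space) auto
  also have "\<dots> = (LINT x|lborel. indicator S x *\<^sub>R f x)"
    using assms by (intro integral_completion) auto
  finally show ?thesis by simp
qed

lemma C1_partial_measurable:
  "C1 f \<Longrightarrow> (\<lambda>x. frechet_derivative f (at x) e) \<in> borel_measurable borel"
  by (intro borel_measurable_continuous_onI C1_continuous_partial)

lemma eq_0_outside_support: "x \<notin> closure {x. f x \<noteq> 0} \<Longrightarrow> f x = 0"
  using closure_subset[of "{x. f x \<noteq> 0}"] by blast

lemma frechet_derivative_0_outside_support:
  assumes "x \<notin> closure {x. f x \<noteq> (0::real)}"
  shows "frechet_derivative f (at x) = (\<lambda>_. 0)"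
proof -
  have "(f has_derivative (\<lambda>_. 0)) (at x)"
  proof (rule has_derivative_transform_within_open)
    show "((\<lambda>_. 0) has_derivative (\<lambda>_. 0)) (at x)" by simp
    show "open (- closure {x. f x \<noteq> 0})" by (rule open_Compl) simp
    show "x \<in> - closure {x. f x \<noteq> 0}" using assms by simp
    show "0 = f y" if "y \<in> - closure {x. f x \<noteq> 0}" for y using that eq_0_outside_support[of y f] by simp
  qed
  then show ?thesis by (metis frechet_derivative_at)
qed

lemma integrable_continuous_compact_support:
  fixes f :: "'a::euclidean_space \<Rightarrow> real"
  assumes "continuous_on UNIV f" "compact K" "\<And>x. x \<notin> K \<Longrightarrow> f x = 0"
  shows "integrable lborel f"
proof -
  have "integrable lborel (\<lambda>x. indicator K x *\<^sub>R f x)"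
    using assms by (intro borel_integrable_compact) (auto intro: continuous_on_subset)
  moreover have "(\<lambda>x. indicator K x *\<^sub>R f x) = f"
    using assms(3) by (auto simp: fun_eq_iff indicator_def)
  ultimately show ?thesis by simp
qed

lemma integrable_indicator_continuous:
  fixes h :: "'a::euclidean_space \<Rightarrow> real"
  assumes S: "S \<in> sets borel" "bounded S" and h: "continuous_on UNIV h"
  shows "integrable lborel (\<lambda>x. indicator S x * h x)"
proof -
  obtain R where R: "S \<subseteq> ball 0 R" using bounded_subset_ballD[OF S(2), of 0] by blast
  have hm: "h \<in> borel_measurable borel" using h by (rule borel_measurable_continuous_onI)
  show ?thesis
  proof (rule Bochner_Integration.integrable_bound)
    show "integrable lborel (\<lambda>x. indicator (cball 0 R) x *\<^sub>R h x)"
      by (rule borel_integrable_compact) (auto intro: continuous_on_subset[OF h])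
    show "(\<lambda>x. indicator S x * h x) \<in> borel_measurable lborel"
      using hm S(1) by (intro borel_measurable_times borel_measurable_indicator) simp_all
    show "AE x in lborel. norm (indicator S x * h x) \<le> norm (indicator (cball 0 R) x *\<^sub>R h x)"
      using R by (intro AE_I2) (auto simp: indicator_def)
  qed
qed

lemma C1_line_derivative:
  assumes "C1 f"
  shows "((\<lambda>t. f (x + t *\<^sub>R e)) has_real_derivative frechet_derivative f (at (x + t *\<^sub>R e)) e) (at t)"
proof -
  have "((\<lambda>t. x + t *\<^sub>R e) has_derivative (\<lambda>h. h *\<^sub>R e)) (at t)"
    by (rule has_derivative_eq_rhs) (auto intro!: derivative_eq_intros)
  from has_derivative_compose[OF this C1_D(2)[OF assms]]
  have "((\<lambda>t. f (x + t *\<^sub>R e)) has_derivative (\<lambda>h. frechet_derivative f (at (x + t *\<^sub>R e)) (h *\<^sub>R e))) (at t)" .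
  moreover have "(\<lambda>h. frechet_derivative f (at (x + t *\<^sub>R e)) (h *\<^sub>R e))
      = (*) (frechet_derivative f (at (x + t *\<^sub>R e)) e)"
    using linear_cmul[OF C1_D(5)[OF assms]] by (auto simp: mult.commute)
  ultimately show ?thesis unfolding has_field_derivative_def by simp
qed

lemma C1_mean_value:
  assumes "C1 f" "0 < h"
  shows "\<exists>s. 0 < s \<and> s < h \<and> f (x + h *\<^sub>R e) - f x = h * frechet_derivative f (at (x + s *\<^sub>R e)) e"
  using MVT2[of 0 h "\<lambda>t. f (x + t *\<^sub>R e)" "\<lambda>t. frechet_derivative f (at (x + t *\<^sub>R e)) e"]
    C1_line_derivative[OF assms(1)] assms(2) by auto

text \<open>The difference quotients of \<open>\<psi>\<close> have integral \<open>0\<close> because Lebesgue measure is translation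
invariant. They converge to the partial derivative and are dominated by a multiple of the indicator
of a ball.\<close>

lemma integral_partial_eq_0:
  fixes \<psi> :: "'a::euclidean_space \<Rightarrow> real"
  assumes C1: "C1 \<psi>" and supp: "compact (closure {x. \<psi> x \<noteq> 0})"
  shows "(LINT x|lborel. frechet_derivative \<psi> (at x) e) = 0"
proof -
  let ?S = "closure {x. \<psi> x \<noteq> 0}"
  let ?d = "\<lambda>x. frechet_derivative \<psi> (at x) e"
  have cont: "continuous_on A \<psi>" "continuous_on A ?d" for A
    using C1 by (auto intro: C1_D C1_continuous_partial)
  have zero: "x \<notin> ?S \<Longrightarrow> \<psi> x = 0" "x \<notin> ?S \<Longrightarrow> ?d x = 0" for x
    using eq_0_outside_support[of x \<psi>] frechet_derivative_0_outside_support[of x \<psi>] by auto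
  have int: "integrable lborel \<psi>"
    by (rule integrable_continuous_compact_support[OF cont(1) supp zero(1)])
  obtain R where R: "0 < R" "?S \<subseteq> ball 0 R"
    using compact_imp_bounded[OF supp] bounded_subset_ballD by blast
  have "bounded (?d ` ?S)"
    using compact_continuous_image[OF cont(2) supp] by (rule compact_imp_bounded)
  then obtain B0 where B0: "\<And>x. x \<in> ?S \<Longrightarrow> \<bar>?d x\<bar> \<le> B0" by (auto simp: bounded_iff)
  define B where "B = max 0 B0"
  have B: "\<bar>?d x\<bar> \<le> B" for x
    using B0[of x] zero(2)[of x] by (cases "x \<in> ?S") (auto simp: B_def)
  let ?K = "cball (0::'a) (R + norm e)"
  define h :: "nat \<Rightarrow> real" where "h n = inverse (real (Suc n))" for n
  have h: "0 < h n" "h n \<le> 1" for n by (auto simp: h_def inverse_le_1_iff)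
  define q where "q n x = (\<psi> (x + h n *\<^sub>R e) - \<psi> x) / h n" for n x
  have h0: "h \<longlonglongrightarrow> 0" unfolding h_def by (rule LIMSEQ_inverse_real_of_nat)
  have "(\<lambda>n. LINT x|lborel. q n x) \<longlonglongrightarrow> (LINT x|lborel. ?d x)"
  proof (rule integral_dominated_convergence)
    show "integrable lborel (\<lambda>x. indicator ?K x *\<^sub>R B)"
      by (rule borel_integrable_compact) auto
    show "AE x in lborel. (\<lambda>n. q n x) \<longlonglongrightarrow> ?d x"
    proof (rule AE_I2)
      fix x
      have "((\<lambda>t. \<psi> (x + t *\<^sub>R e)) has_real_derivative ?d x) (at 0)"
        using C1_line_derivative[OF C1, of x e 0] by simp
      then have "((\<lambda>t. (\<psi> (x + t *\<^sub>R e) - \<psi> x) / t) \<longlongrightarrow> ?d x) (at 0)"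
        by (simp add: DERIV_def)
      moreover have "filterlim h (at 0) sequentially"
        using h0 h by (auto simp: filterlim_at intro!: always_eventually) (metis less_irrefl)
      ultimately show "(\<lambda>n. q n x) \<longlonglongrightarrow> ?d x"
        unfolding q_def by (rule filterlim_compose)
    qed
    show "AE x in lborel. norm (q n x) \<le> indicator ?K x *\<^sub>R B" for n
    proof (rule AE_I2)
      fix x
      obtain s where s: "0 < s" "s < h n" "\<psi> (x + h n *\<^sub>R e) - \<psi> x = h n * ?d (x + s *\<^sub>R e)"
        using C1_mean_value[OF C1 h(1)] by blast
      have q: "q n x = ?d (x + s *\<^sub>R e)" using s h(1)[of n] by (simp add: q_def)
      show "norm (q n x) \<le> indicator ?K x *\<^sub>R B"
      proof (cases "x \<in> ?K")
        case False
        have "norm x \<le> norm (x + s *\<^sub>R e) + norm (s *\<^sub>R e)"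
          by (metis add_diff_cancel_right' norm_triangle_ineq4)
        moreover have "norm (s *\<^sub>R e) \<le> norm e"
          using s h(2)[of n] mult_right_mono[of s 1 "norm e"] by auto
        ultimately have "R \<le> norm (x + s *\<^sub>R e)" using False by auto
        then have "x + s *\<^sub>R e \<notin> ?S" using R by auto
        then have "q n x = 0" using zero(2) q by simp
        then show ?thesis using False by simp
      qed (use B q in simp)
    qed
    show "?d \<in> borel_measurable lborel" using C1_partial_measurable[OF C1] by simp
    show "q n \<in> borel_measurable lborel" for n
      using C1_D(4)[OF C1] unfolding q_def by measurable
  qed
  moreover have "(LINT x|lborel. q n x) = 0" for n
  proof -
    have meas: "\<psi> \<in> borel_measurable borel" using C1_D(4)[OF C1] .
    have eq: "integrable lborel (\<lambda>x. \<psi> (h n *\<^sub>R e + x))"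
        "(LINT x|lborel. \<psi> (h n *\<^sub>R e + x)) = (LINT x|lborel. \<psi> x)"
      using int integrable_distr_eq[of "(+) (h n *\<^sub>R e)" lborel borel \<psi>]
        integral_distr[of "(+) (h n *\<^sub>R e)" lborel borel \<psi>] meas
      by (auto simp: lborel_distr_plus)
    have "(LINT x|lborel. q n x) = ((LINT x|lborel. \<psi> (h n *\<^sub>R e + x)) - (LINT x|lborel. \<psi> x)) / h n"
      unfolding q_def using eq(1) int by (simp add: add.commute)
    then show ?thesis using eq by simp
  qed
  ultimately show ?thesis by (simp add: LIMSEQ_const_iff)
qed

lemma test_function_D:
  assumes "test_function \<Omega> \<eta>"
  shows "C1 \<eta>" "compact (closure {x. \<eta> x \<noteq> 0})" "closure {x. \<eta> x \<noteq> 0} \<subseteq> \<Omega>"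
    "x \<notin> \<Omega> \<Longrightarrow> \<eta> x = 0" "x \<notin> \<Omega> \<Longrightarrow> frechet_derivative \<eta> (at x) e = 0"
proof -
  show *: "C1 \<eta>" "compact (closure {x. \<eta> x \<noteq> 0})" "closure {x. \<eta> x \<noteq> 0} \<subseteq> \<Omega>"
    using assms by (auto simp: test_function_def)
  show "x \<notin> \<Omega> \<Longrightarrow> \<eta> x = 0" using *(3) eq_0_outside_support[of x \<eta>] by auto
  show "x \<notin> \<Omega> \<Longrightarrow> frechet_derivative \<eta> (at x) e = 0"
    using *(3) frechet_derivative_0_outside_support[of x \<eta>] by (metis subsetD)
qed

lemma test_functionI:
  assumes "C1 \<eta>" "compact K" "K \<subseteq> \<Omega>" "\<And>x. x \<notin> K \<Longrightarrow> \<eta> x = 0"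
  shows "test_function \<Omega> \<eta>"
proof -
  have "closure {x. \<eta> x \<noteq> 0} \<subseteq> K"
    using assms by (intro closure_minimal) (auto simp: compact_imp_closed)
  moreover from this have "compact (closure {x. \<eta> x \<noteq> 0})"
    using assms(2) by (metis closed_closure compact_Int_closed inf.absorb2 inf.commute)
  ultimately show ?thesis using assms by (auto simp: test_function_def)
qed

lemma test_function_mult:
  assumes \<eta>: "test_function \<Omega> \<eta>" and f: "C1 f"
  shows "test_function \<Omega> (\<lambda>x. f x * \<eta> x)"
proof -
  have "f x * \<eta> x = 0" if "x \<notin> closure {x. \<eta> x \<noteq> 0}" for x
    using eq_0_outside_support[of x \<eta>] that by simp
  then show ?thesis
    by (rule test_functionI[OF C1_mult(1)[OF f test_function_D(1)[OF \<eta>]] test_function_D(2,3)[OF \<eta>]])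
qed

lemma test_function_mono: "test_function \<Omega> \<eta> \<Longrightarrow> \<Omega> \<subseteq> \<Omega>' \<Longrightarrow> test_function \<Omega>' \<eta>"
  by (auto simp: test_function_def)

lemma test_function_add_diff:
  assumes f: "test_function \<Omega> f" and g: "test_function \<Omega> g"
  shows "test_function \<Omega> (\<lambda>x. f x + g x)" "test_function \<Omega> (\<lambda>x. f x - g x)"
proof -
  define K where "K = closure {x. f x \<noteq> 0} \<union> closure {x. g x \<noteq> 0}"
  have K: "compact K" "K \<subseteq> \<Omega>"
    unfolding K_def using test_function_D(2,3)[OF f] test_function_D(2,3)[OF g] compact_Un by blast+
  have zero: "f x = 0" "g x = 0" if "x \<notin> K" for x
    using that eq_0_outside_support[of x f] eq_0_outside_support[of x g] by (auto simp: K_def)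
  show "test_function \<Omega> (\<lambda>x. f x + g x)" "test_function \<Omega> (\<lambda>x. f x - g x)"
    using C1_add(1)[OF test_function_D(1)[OF f] test_function_D(1)[OF g]]
      C1_diff(1)[OF test_function_D(1)[OF f] test_function_D(1)[OF g]] zero
    by (auto intro!: test_functionI[OF _ K])
qed

section \<open>The fundamental lemma of the calculus of variations\<close>

text \<open>A product of transition functions of the coordinates is supported in a slightly smaller closed box,
so the approximating functions are test functions on the open box itself.\<close>

lemma box_indicator_limit_of_test_functions:
  fixes a b :: "'a::euclidean_space"
  obtains \<eta> where "\<And>n. test_function (box a b) (\<eta> n)" "\<And>n x. 0 \<le> \<eta> n x" "\<And>n x. \<eta> n x \<le> 1"
    "\<And>x. (\<lambda>n. \<eta> n x) \<longlonglongrightarrow> indicator (box a b) x"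
proof -
  define p where "p n i x = transition (real n * (x \<bullet> i - a \<bullet> i) - 1) * transition (real n * (b \<bullet> i - x \<bullet> i) - 1)"
    for n and i x :: 'a
  define \<eta> where "\<eta> n x = (\<Prod>i\<in>Basis. p n i x)" for n x
  define K where "K n = cbox (a + (1 / real (Suc n)) *\<^sub>R One) (b - (1 / real (Suc n)) *\<^sub>R One)" for n
  have p01: "0 \<le> p n i x" "p n i x \<le> 1" for n i x
    unfolding p_def using transition_bounds by (auto intro!: mult_nonneg_nonneg mult_le_one)
  have C1p: "C1 (p n i)" for n i
    unfolding p_def[abs_def]
    by (intro C1_mult C1_transition C1_diff C1_cmult C1_inner C1_const)
  have zero: "\<eta> (Suc n) x = 0" if notK: "x \<notin> K n" for n x
  proof -
    obtain i where i: "i \<in> Basis" "x \<bullet> i < a \<bullet> i + 1 / real (Suc n) \<or> b \<bullet> i - 1 / real (Suc n) < x \<bullet> i"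
      using notK by (auto simp: K_def mem_box inner_simps not_le)
    have "real (Suc n) * (x \<bullet> i - a \<bullet> i) - 1 \<le> 0 \<or> real (Suc n) * (b \<bullet> i - x \<bullet> i) - 1 \<le> 0"
      using i(2) by (auto simp: field_simps)
    then have "p (Suc n) i x = 0"
      unfolding p_def using transition_0 by auto
    then show ?thesis using i(1) unfolding \<eta>_def by (simp add: prod_zero_iff) blast
  qed
  have K: "K n \<subseteq> box a b" for n
  proof
    fix x assume "x \<in> K n"
    then have "a \<bullet> i + 1 / real (Suc n) \<le> x \<bullet> i \<and> x \<bullet> i \<le> b \<bullet> i - 1 / real (Suc n)" if "i \<in> Basis" for i
      using that by (simp add: K_def mem_box inner_simps)
    moreover have "0 < 1 / real (Suc n)" by simp
    ultimately show "x \<in> box a b" unfolding mem_box by (smt (verit))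
  qed
  show thesis
  proof (rule that[of "\<lambda>n. \<eta> (Suc n)"])
    fix n x
    show "test_function (box a b) (\<eta> (Suc n))"
    proof (rule test_functionI[where K = "K n"])
      show "C1 (\<eta> (Suc n))" unfolding \<eta>_def[abs_def] by (intro C1_prod C1p)
    qed (use K zero in \<open>auto simp: K_def\<close>)
    show "0 \<le> \<eta> (Suc n) x" "\<eta> (Suc n) x \<le> 1"
      unfolding \<eta>_def using p01 by (auto intro: prod_nonneg prod_le_1)
  next
    fix x
    have "eventually (\<lambda>n. \<eta> (Suc n) x = indicator (box a b) x) sequentially"
    proof (cases "x \<in> box a b")
      case False
      then show ?thesis using K zero by (auto intro!: always_eventually)
    next
      case True
      have "eventually (\<lambda>n. p (Suc n) i x = 1) sequentially" if i: "i \<in> Basis" for i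
      proof -
        have big: "eventually (\<lambda>n. 2 \<le> real (Suc n) * c) sequentially" if "0 < c" for c
        proof -
          have "eventually (\<lambda>n. 2 / c \<le> real n) sequentially"
            using eventually_ge_at_top[of "nat \<lceil>2 / c\<rceil>"] by eventually_elim linarith
          then show ?thesis
            by eventually_elim (use that in \<open>auto simp: field_simps\<close>)
        qed
        have "0 < x \<bullet> i - a \<bullet> i" "0 < b \<bullet> i - x \<bullet> i" using True i by (auto simp: mem_box)
        from big[OF this(1)] big[OF this(2)] show ?thesis
          by eventually_elim (simp add: p_def transition_1)
      qed
      then have "eventually (\<lambda>n. \<forall>i\<in>Basis. p (Suc n) i x = 1) sequentially"
        by (simp add: eventually_ball_finite_distrib)
      then show ?thesis by eventually_elim (use True in \<open>simp add: \<eta>_def\<close>)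
    qed
    then show "(\<lambda>n. \<eta> (Suc n) x) \<longlonglongrightarrow> indicator (box a b) x"
      by (rule tendsto_eventually)
  qed
qed

text \<open>Boxes form an intersection-stable generator of the Borel sets. The total integral enters because
the induction over the generated sigma-algebra passes to complements.\<close>

lemma AE_zero_if_box_integrals_zero:
  fixes g :: "'a::euclidean_space \<Rightarrow> real"
  assumes g: "integrable lborel g" and tot: "(LINT x|lborel. g x) = 0"
    and box: "\<And>a b. (LINT x|lborel. indicator (box a b) x * g x) = 0"
  shows "AE x in lborel. g x = 0"
proof -
  have gi: "integrable lborel (\<lambda>x. indicator A x * g x)" if "A \<in> sets borel" for A
    using integrable_mult_indicator[OF _ g, of A] that by simp
  have *: "(LINT x|lborel. indicator A x * g x) = 0" if "A \<in> sets borel" for A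
  proof -
    let ?E = "range (\<lambda>(a, b). box a b::'a set)"
    have E: "Int_stable ?E" "?E \<subseteq> Pow UNIV" by (auto simp: Int_stable_def box_Int_box)
    have s: "sets borel = sigma_sets UNIV ?E" by (simp add: borel_eq_box)
    then have A: "A \<in> sigma_sets UNIV ?E" using that by simp
    show ?thesis using E A
    proof (induction rule: sigma_sets_induct_disjoint)
      case (compl A)
      have "(LINT x|lborel. indicator (UNIV - A) x * g x) = (LINT x|lborel. g x - indicator A x * g x)"
        by (intro Bochner_Integration.integral_cong) (auto simp: indicator_def)
      also have "\<dots> = 0" using compl g gi[of A] tot s by simp
      finally show ?case .
    next
      case (union A)
      have "(LINT x:(\<Union>i. A i)|lborel. g x) = (\<Sum>i. (LINT x:(A i)|lborel. g x))"
      proof (rule lebesgue_integral_countable_add)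
        show "A i \<in> sets lborel" for i using union s by auto
        show "i \<noteq> j \<Longrightarrow> A i \<inter> A j = {}" for i j using union by (auto simp: disjoint_family_on_def)
        have "(\<Union>i. A i) \<in> sets borel" using union s by (intro sets.countable_UN) auto
        then show "set_integrable lborel (\<Union>i. A i) g"
          unfolding set_integrable_def using gi[of "\<Union>i. A i"] by simp
      qed
      then show ?case using union by (simp add: set_lebesgue_integral_def)
    qed (use box in auto)
  qed
  show ?thesis
    using density_unique_real[of lborel g "\<lambda>_. 0"] g * by (auto simp: set_lebesgue_integral_def)
qed

text \<open>Testing with approximations of the indicator of a box shows that the integral of \<open>f\<close> over every box
inside \<open>\<Omega>\<close> vanishes. On one such box this determines a Borel representative of \<open>f\<close>, and countably
many boxes cover \<open>\<Omega>\<close>.\<close>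

lemma fundamental_lemma:
  fixes f :: "'a::euclidean_space \<Rightarrow> real"
  assumes \<Omega>: "open \<Omega>" and f: "square_integrable (lebesgue_on \<Omega>) f"
    and zero: "\<And>\<eta>. test_function \<Omega> \<eta> \<Longrightarrow> (LINT x|lebesgue_on \<Omega>. f x * \<eta> x) = 0"
  shows "AE x in lebesgue_on \<Omega>. f x = 0"
proof -
  have [simp, measurable]: "\<Omega> \<in> sets borel" using \<Omega> by auto
  have fm: "f \<in> borel_measurable (lebesgue_on \<Omega>)" using f by (simp add: square_integrable_def)
  have ind: "integrable (lebesgue_on \<Omega>) (\<lambda>x. indicator (box a b) x * f x)" for a b
  proof -
    have "emeasure (lebesgue_on \<Omega>) (box a b \<inter> \<Omega>) < \<infinity>"
    proof -
      have "emeasure (lebesgue_on \<Omega>) (box a b \<inter> \<Omega>) = emeasure lborel (box a b \<inter> \<Omega>)"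
        by (subst emeasure_restrict_space) auto
      also have "\<dots> \<le> emeasure lborel (box a b)" by (intro emeasure_mono) auto
      finally show ?thesis using emeasure_lborel_box_finite[of a b] by (simp add: top.not_eq_extremum order_le_less_trans)
    qed
    then have "integrable (lebesgue_on \<Omega>) (\<lambda>x. indicator (box a b \<inter> \<Omega>) x :: real)"
      by (intro integrable_real_indicator) (auto simp: sets_restrict_space_iff)
    then have "integrable (lebesgue_on \<Omega>) (\<lambda>x. indicator (box a b) x :: real)"
      by (rule Bochner_Integration.integrable_cong[THEN iffD1, rotated 2]) (auto simp: indicator_def)
    then have "square_integrable (lebesgue_on \<Omega>) (indicator (box a b))"
    proof -
      have "(\<lambda>x. (indicator (box a b) x :: real)\<^sup>2) = indicator (box a b)"
        by (auto simp: indicator_def fun_eq_iff)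
      then show ?thesis
        using \<open>integrable (lebesgue_on \<Omega>) (\<lambda>x. indicator (box a b) x :: real)\<close>
        by (simp add: square_integrable_def borel_measurable_integrable)
    qed
    from square_integrable_mult[OF this f] show ?thesis .
  qed
  have step1: "(LINT x|lebesgue_on \<Omega>. indicator (box a b) x * f x) = 0" if ab: "box a b \<subseteq> \<Omega>" for a b
  proof -
    obtain \<eta> where \<eta>: "\<And>n. test_function (box a b) (\<eta> n)" "\<And>n x. 0 \<le> \<eta> n x" "\<And>n x. \<eta> n x \<le> 1"
      "\<And>x. (\<lambda>n. \<eta> n x) \<longlonglongrightarrow> indicator (box a b) x"
      using box_indicator_limit_of_test_functions by blast
    have \<eta>m: "\<eta> n \<in> borel_measurable (lebesgue_on \<Omega>)" for n
      using C1_D(4)[OF test_function_D(1)[OF \<eta>(1)]] by (intro measurable_restrict_space1 measurable_completion) simp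
    have "(\<lambda>n. LINT x|lebesgue_on \<Omega>. f x * \<eta> n x) \<longlonglongrightarrow> (LINT x|lebesgue_on \<Omega>. indicator (box a b) x * f x)"
    proof (rule integral_dominated_convergence)
      show "integrable (lebesgue_on \<Omega>) (\<lambda>x. \<bar>indicator (box a b) x * f x\<bar>)"
        using ind by (rule integrable_abs)
      show "AE x in lebesgue_on \<Omega>. (\<lambda>n. f x * \<eta> n x) \<longlonglongrightarrow> indicator (box a b) x * f x"
        using tendsto_mult[OF tendsto_const \<eta>(4)] by (auto simp: mult.commute)
      show "AE x in lebesgue_on \<Omega>. norm (f x * \<eta> n x) \<le> \<bar>indicator (box a b) x * f x\<bar>" for n
      proof (rule AE_I2)
        fix x
        have "\<eta> n x = 0" if "x \<notin> box a b" using test_function_D(4)[OF \<eta>(1)] that by blast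
        then show "norm (f x * \<eta> n x) \<le> \<bar>indicator (box a b) x * f x\<bar>"
          using \<eta>(2,3)[of n x] mult_right_le_one_le[of "\<bar>f x\<bar>" "\<eta> n x"] by (auto simp: indicator_def abs_mult)
      qed
    qed (use fm \<eta>m ind in auto)
    moreover have "(LINT x|lebesgue_on \<Omega>. f x * \<eta> n x) = 0" for n
      using zero test_function_mono[OF \<eta>(1) ab] by blast
    ultimately show ?thesis by (simp add: LIMSEQ_const_iff)
  qed
  have conv: "(LINT x|lebesgue_on \<Omega>. indicator A x * f x) = (LINT x|lebesgue. indicator A x * f x)"
      "integrable (lebesgue_on \<Omega>) (\<lambda>x. indicator A x * f x) \<longleftrightarrow> integrable lebesgue (\<lambda>x. indicator A x * f x)"
    if "A \<subseteq> \<Omega>" for A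
  proof -
    have "(\<lambda>x. indicator \<Omega> x *\<^sub>R (indicator A x * f x)) = (\<lambda>x. indicator A x * f x)"
      using that by (auto simp: indicator_def fun_eq_iff)
    then show "(LINT x|lebesgue_on \<Omega>. indicator A x * f x) = (LINT x|lebesgue. indicator A x * f x)"
      "integrable (lebesgue_on \<Omega>) (\<lambda>x. indicator A x * f x) \<longleftrightarrow> integrable lebesgue (\<lambda>x. indicator A x * f x)"
      by (simp_all add: integral_restrict_space integrable_restrict_space)
  qed
  have step2: "AE x in lebesgue. x \<in> box c d \<longrightarrow> f x = 0" if cd: "box c d \<subseteq> \<Omega>" for c d
  proof -
    define G where "G x = indicator (box c d) x * f x" for x
    have Gi: "integrable lebesgue G"
      using ind[of c d] conv(2)[OF cd] by (simp add: G_def[abs_def])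
    obtain g where g: "g \<in> borel_measurable lborel" "AE x in lborel. G x = g x"
      using completion_ex_borel_measurable_real[of G lborel] Gi by auto
    have AEl: "AE x in lebesgue. G x = g x" using AE_completion[OF g(2)] .
    have gm: "g \<in> borel_measurable lebesgue" using g(1) by (intro measurable_completion)
    have gi: "integrable lborel g"
      using Gi integrable_cong_AE[OF _ gm AEl] integrable_completion[OF g(1)] by auto
    have trans: "(LINT x|lborel. indicator A x * g x) = (LINT x|lebesgue. indicator A x * G x)"
      if [measurable]: "A \<in> sets borel" for A
    proof -
      have "(LINT x|lborel. indicator A x * g x) = (LINT x|lebesgue. indicator A x * g x)"
        using g(1) that by (intro integral_completion[symmetric]) auto
      also have "\<dots> = (LINT x|lebesgue. indicator A x * G x)"
      proof (rule integral_cong_AE)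
        have "(indicator A :: 'a \<Rightarrow> real) \<in> borel_measurable lebesgue"
          using that by (intro borel_measurable_indicator) simp
        then show "(\<lambda>x. indicator A x * g x) \<in> borel_measurable lebesgue"
          "(\<lambda>x. indicator A x * G x) \<in> borel_measurable lebesgue"
          using gm borel_measurable_integrable[OF Gi] by (auto intro: borel_measurable_times)
        show "AE x in lebesgue. indicator A x * g x = indicator A x * G x" using AEl by auto
      qed
      finally show ?thesis .
    qed
    have "(LINT x|lborel. indicator (box a b) x * g x) = 0" for a b
    proof -
      obtain a' b' where ab: "box a b \<inter> box c d = box a' b'" by (auto simp: box_Int_box)
      have "(LINT x|lborel. indicator (box a b) x * g x) = (LINT x|lebesgue. indicator (box a' b') x * f x)"
        unfolding trans[OF borel_open[OF open_box]] ab[symmetric] G_def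
        by (intro Bochner_Integration.integral_cong) (auto simp: indicator_def)
      also have "\<dots> = 0" using step1[of a' b'] conv(1)[of "box a' b'"] ab cd by auto
      finally show ?thesis .
    qed
    moreover have "(LINT x|lborel. g x) = 0"
      using trans[of UNIV] step1[OF cd] conv(1)[OF cd] by (simp add: G_def)
    ultimately have "AE x in lborel. g x = 0"
      using AE_zero_if_box_integrals_zero[OF gi] by blast
    then have "AE x in lebesgue. g x = 0" by (rule AE_completion)
    then show ?thesis using AEl by eventually_elim (auto simp: G_def)
  qed
  obtain \<D> where D: "countable \<D>" "\<D> \<subseteq> Pow \<Omega>" "\<And>X. X \<in> \<D> \<Longrightarrow> \<exists>a b. X = box a b" "\<Union>\<D> = \<Omega>"
    using open_countable_Union_open_box[OF \<Omega>] by metis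
  have "AE x in lebesgue. \<forall>X\<in>\<D>. x \<in> X \<longrightarrow> f x = 0"
  proof (subst AE_ball_countable[OF D(1)], intro ballI)
    fix X assume X: "X \<in> \<D>"
    then obtain a b where "X = box a b" using D(3) by blast
    moreover have "X \<subseteq> \<Omega>" using X D(2) by auto
    ultimately show "AE x in lebesgue. x \<in> X \<longrightarrow> f x = 0" using step2[of a b] by simp
  qed
  then have "AE x in lebesgue. x \<in> \<Omega> \<longrightarrow> f x = 0"
    unfolding D(4)[symmetric] by eventually_elim blast
  then show ?thesis by (simp add: AE_restrict_space_iff)
qed

section \<open>Weak derivatives on bounded open sets\<close>

lemma borel_measurable_lebesgue_onI:
  "f \<in> borel_measurable borel \<Longrightarrow> f \<in> borel_measurable (lebesgue_on \<Omega>)"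
  by (intro measurable_restrict_space1 measurable_completion) simp

lemma continuous_square_integrable:
  fixes f :: "'a::euclidean_space \<Rightarrow> real"
  assumes f: "continuous_on UNIV f" and \<Omega>: "bounded \<Omega>" "open \<Omega>"
  shows "square_integrable (lebesgue_on \<Omega>) f"
proof -
  have [measurable]: "\<Omega> \<in> sets borel" using \<Omega>(2) by simp
  have fm [measurable]: "f \<in> borel_measurable borel" using f by (rule borel_measurable_continuous_onI)
  have "integrable lborel (\<lambda>x. indicator \<Omega> x *\<^sub>R (f x)\<^sup>2)"
    using integrable_indicator_continuous[of \<Omega> "\<lambda>x. (f x)\<^sup>2"] \<Omega> f by (simp add: continuous_on_power)
  then have "integrable lebesgue (\<lambda>x. indicator \<Omega> x *\<^sub>R (f x)\<^sup>2)"
    by (subst integrable_completion) measurable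
  then have "integrable (lebesgue_on \<Omega>) (\<lambda>x. (f x)\<^sup>2)"
    using \<Omega>(2) by (subst integrable_restrict_space) auto
  then show ?thesis using borel_measurable_lebesgue_onI[OF fm] by (simp add: square_integrable_def)
qed

lemma C1_square_integrable:
  assumes "C1 f" "bounded \<Omega>" "open \<Omega>"
  shows "square_integrable (lebesgue_on \<Omega>) f"
    "square_integrable (lebesgue_on \<Omega>) (\<lambda>x. frechet_derivative f (at x) e)"
  using assms by (auto intro!: continuous_square_integrable C1_D C1_continuous_partial)

lemma has_weak_partial_C1:
  fixes \<Omega> :: "'a::euclidean_space set"
  assumes f: "C1 f" and \<Omega>: "bounded \<Omega>" "open \<Omega>"
  shows "has_weak_partial \<Omega> e f (\<lambda>x. frechet_derivative f (at x) e)"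
  unfolding has_weak_partial_def
proof (intro conjI allI impI)
  show "square_integrable (lebesgue_on \<Omega>) (\<lambda>x. frechet_derivative f (at x) e)"
    by (rule C1_square_integrable[OF f \<Omega>])
  fix \<eta> assume \<eta>: "test_function \<Omega> \<eta>"
  note \<eta>C = test_function_D(1)[OF \<eta>]
  let ?p = "\<lambda>x. f x * \<eta> x"
  have p: "test_function \<Omega> ?p" by (rule test_function_mult[OF \<eta> f])
  have i1: "integrable (lebesgue_on \<Omega>) (\<lambda>x. f x * frechet_derivative \<eta> (at x) e)"
    and i2: "integrable (lebesgue_on \<Omega>) (\<lambda>x. frechet_derivative f (at x) e * \<eta> x)"
    by (intro square_integrable_mult C1_square_integrable f \<eta>C \<Omega>)+
  have "(LINT x|lebesgue_on \<Omega>. f x * frechet_derivative \<eta> (at x) e)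
      + (LINT x|lebesgue_on \<Omega>. frechet_derivative f (at x) e * \<eta> x)
      = (LINT x|lebesgue_on \<Omega>. frechet_derivative ?p (at x) e)"
    by (simp add: C1_mult(2)[OF f \<eta>C] i1 i2)
  also have "\<dots> = (LINT x|lborel. indicator \<Omega> x * frechet_derivative ?p (at x) e)"
    using \<Omega> by (intro integral_lebesgue_on_borel C1_partial_measurable C1_mult f \<eta>C) auto
  also have "\<dots> = (LINT x|lborel. frechet_derivative ?p (at x) e)"
    by (intro Bochner_Integration.integral_cong) (auto simp: indicator_def test_function_D(5)[OF p])
  also have "\<dots> = 0"
    by (rule integral_partial_eq_0[OF test_function_D(1,2)[OF p]])
  finally show "(LINT x|lebesgue_on \<Omega>. f x * frechet_derivative \<eta> (at x) e)
      = - (LINT x|lebesgue_on \<Omega>. frechet_derivative f (at x) e * \<eta> x)" by linarith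
qed

lemma has_weak_partial_diff:
  fixes \<Omega> :: "'a::euclidean_space set"
  assumes \<Omega>: "bounded \<Omega>" "open \<Omega>"
    and u: "square_integrable (lebesgue_on \<Omega>) u" "has_weak_partial \<Omega> e u p"
    and v: "square_integrable (lebesgue_on \<Omega>) v" "has_weak_partial \<Omega> e v q"
  shows "has_weak_partial \<Omega> e (\<lambda>x. u x - v x) (\<lambda>x. p x - q x)"
  unfolding has_weak_partial_def
proof (intro conjI allI impI)
  have pq: "square_integrable (lebesgue_on \<Omega>) p" "square_integrable (lebesgue_on \<Omega>) q"
    using u v by (auto simp: has_weak_partial_def)
  then show "square_integrable (lebesgue_on \<Omega>) (\<lambda>x. p x - q x)" by (rule square_integrable_diff)
  fix \<eta> assume \<eta>: "test_function \<Omega> \<eta>"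
  note \<eta>C = C1_square_integrable[OF test_function_D(1)[OF \<eta>] \<Omega>]
  note i = square_integrable_mult[OF u(1) \<eta>C(2)] square_integrable_mult[OF v(1) \<eta>C(2)]
    square_integrable_mult[OF pq(1) \<eta>C(1)] square_integrable_mult[OF pq(2) \<eta>C(1)]
  have "(LINT x|lebesgue_on \<Omega>. u x * frechet_derivative \<eta> (at x) e) = - (LINT x|lebesgue_on \<Omega>. p x * \<eta> x)"
    "(LINT x|lebesgue_on \<Omega>. v x * frechet_derivative \<eta> (at x) e) = - (LINT x|lebesgue_on \<Omega>. q x * \<eta> x)"
    using u(2) v(2) \<eta> unfolding has_weak_partial_def by blast+
  then show "(LINT x|lebesgue_on \<Omega>. (u x - v x) * frechet_derivative \<eta> (at x) e)
      = - (LINT x|lebesgue_on \<Omega>. (p x - q x) * \<eta> x)"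
    using i by (simp add: left_diff_distrib)
qed

text \<open>\<open>weak_partial\<close> chooses some weak derivative; uniqueness is what makes statements about the chosen
one independent of the choice.\<close>

lemma has_weak_partial_unique:
  fixes \<Omega> :: "'a::euclidean_space set"
  assumes \<Omega>: "bounded \<Omega>" "open \<Omega>"
    and p: "has_weak_partial \<Omega> e u p" and q: "has_weak_partial \<Omega> e u q"
  shows "AE x in lebesgue_on \<Omega>. p x = q x"
proof -
  have pq: "square_integrable (lebesgue_on \<Omega>) p" "square_integrable (lebesgue_on \<Omega>) q"
    using p q by (auto simp: has_weak_partial_def)
  have "AE x in lebesgue_on \<Omega>. p x - q x = 0"
  proof (rule fundamental_lemma[OF \<Omega>(2)])
    show "square_integrable (lebesgue_on \<Omega>) (\<lambda>x. p x - q x)" using pq by (rule square_integrable_diff)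
    fix \<eta> assume \<eta>: "test_function \<Omega> \<eta>"
    note \<eta>C = C1_square_integrable(1)[OF test_function_D(1)[OF \<eta>] \<Omega>]
    have "(LINT x|lebesgue_on \<Omega>. p x * \<eta> x) = (LINT x|lebesgue_on \<Omega>. q x * \<eta> x)"
      using p q \<eta> unfolding has_weak_partial_def by fastforce
    then show "(LINT x|lebesgue_on \<Omega>. (p x - q x) * \<eta> x) = 0"
      using square_integrable_mult[OF pq(1) \<eta>C] square_integrable_mult[OF pq(2) \<eta>C]
      by (simp add: left_diff_distrib)
  qed
  then show ?thesis by eventually_elim simp
qed

lemma has_weak_partial_weak_partial:
  "has_weak_partial \<Omega> e u p \<Longrightarrow> has_weak_partial \<Omega> e u (weak_partial \<Omega> e u)"
  unfolding weak_partial_def by (rule someI[of "has_weak_partial \<Omega> e u"])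

lemma weak_partial_unique:
  fixes \<Omega> :: "'a::euclidean_space set"
  assumes "bounded \<Omega>" "open \<Omega>" "has_weak_partial \<Omega> e u p"
  shows "AE x in lebesgue_on \<Omega>. weak_partial \<Omega> e u x = p x"
  by (rule has_weak_partial_unique[OF assms(1,2) has_weak_partial_weak_partial[OF assms(3)] assms(3)])

lemma H1_D:
  assumes "u \<in> H1 \<Omega>"
  shows "square_integrable (lebesgue_on \<Omega>) u"
    "e \<in> Basis \<Longrightarrow> has_weak_partial \<Omega> e u (weak_partial \<Omega> e u)"
    "e \<in> Basis \<Longrightarrow> square_integrable (lebesgue_on \<Omega>) (weak_partial \<Omega> e u)"
proof -
  show "square_integrable (lebesgue_on \<Omega>) u" using assms by (simp add: H1_def)
  show *: "e \<in> Basis \<Longrightarrow> has_weak_partial \<Omega> e u (weak_partial \<Omega> e u)"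
    using assms has_weak_partial_weak_partial[of \<Omega> e u] by (auto simp: H1_def)
  then show "e \<in> Basis \<Longrightarrow> square_integrable (lebesgue_on \<Omega>) (weak_partial \<Omega> e u)"
    by (simp add: has_weak_partial_def)
qed

lemma norm_weak_grad_power2:
  "(norm (weak_grad \<Omega> u x))\<^sup>2 = (\<Sum>e\<in>Basis. (weak_partial \<Omega> e u x)\<^sup>2)"
proof -
  have "weak_grad \<Omega> u x \<bullet> e = weak_partial \<Omega> e u x" if "e \<in> Basis" for e
    using that by (simp add: weak_grad_def inner_sum_left_Basis)
  then show ?thesis
    unfolding power2_norm_eq_inner by (subst euclidean_inner) (simp add: power2_eq_square)
qed

lemma integral_norm_weak_grad_power2:
  assumes "\<And>e. e \<in> Basis \<Longrightarrow> square_integrable (lebesgue_on \<Omega>) (weak_partial \<Omega> e u)"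
  shows "(LINT x|lebesgue_on \<Omega>. (norm (weak_grad \<Omega> u x))\<^sup>2)
      = (\<Sum>e\<in>Basis. LINT x|lebesgue_on \<Omega>. (weak_partial \<Omega> e u x)\<^sup>2)"
  unfolding norm_weak_grad_power2
  by (rule Bochner_Integration.integral_sum) (use assms in \<open>simp add: square_integrable_def\<close>)

lemma H1_norm_bounds:
  assumes u: "u \<in> H1 \<Omega>"
  shows "L2_norm (lebesgue_on \<Omega>) u \<le> H1_norm \<Omega> u"
    "e \<in> Basis \<Longrightarrow> L2_norm (lebesgue_on \<Omega>) (weak_partial \<Omega> e u) \<le> H1_norm \<Omega> u"
proof -
  let ?G = "LINT x|lebesgue_on \<Omega>. (norm (weak_grad \<Omega> u x))\<^sup>2"
  have "0 \<le> ?G" by simp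
  then show "L2_norm (lebesgue_on \<Omega>) u \<le> H1_norm \<Omega> u"
    unfolding L2_norm_def H1_norm_def by (intro real_sqrt_le_mono) linarith
  assume e: "e \<in> Basis"
  have "(LINT x|lebesgue_on \<Omega>. (weak_partial \<Omega> e u x)\<^sup>2)
      \<le> (\<Sum>e\<in>Basis. LINT x|lebesgue_on \<Omega>. (weak_partial \<Omega> e u x)\<^sup>2)"
    using e by (intro member_le_sum[of e Basis "\<lambda>e. LINT x|lebesgue_on \<Omega>. (weak_partial \<Omega> e u x)\<^sup>2"]) auto
  also have "\<dots> = ?G"
    using integral_norm_weak_grad_power2[of \<Omega> u] H1_D(3)[OF u] by simp
  finally have "(LINT x|lebesgue_on \<Omega>. (weak_partial \<Omega> e u x)\<^sup>2) \<le> ?G" .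
  moreover have "0 \<le> (LINT x|lebesgue_on \<Omega>. (u x)\<^sup>2)" by simp
  ultimately show "L2_norm (lebesgue_on \<Omega>) (weak_partial \<Omega> e u) \<le> H1_norm \<Omega> u"
    unfolding L2_norm_def H1_norm_def
    by (intro real_sqrt_le_mono) linarith
qed

text \<open>Approximation in \<open>H\<^sup>1\<close> by functions that are \<open>C\<^sup>1\<close> up to the boundary. The limit gradient is the
explicit argument \<open>D\<close> (not \<open>weak_partial\<close>), so that differences and products of approximations need no
comparison between the representatives chosen for different functions.\<close>

definition H1_approx ::
  "'a::euclidean_space set \<Rightarrow> (nat \<Rightarrow> 'a \<Rightarrow> real) \<Rightarrow> ('a \<Rightarrow> real) \<Rightarrow> ('a \<Rightarrow> 'a \<Rightarrow> real) \<Rightarrow> bool" where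
  "H1_approx \<Omega> w u D \<longleftrightarrow> (\<forall>n. C1 (w n)) \<and> L2_tendsto (lebesgue_on \<Omega>) w u \<and>
     (\<forall>e\<in>Basis. L2_tendsto (lebesgue_on \<Omega>) (\<lambda>n x. frechet_derivative (w n) (at x) e) (D e))"

lemma H1_approx_diff:
  assumes "H1_approx \<Omega> w u D" "H1_approx \<Omega> v z E"
  shows "H1_approx \<Omega> (\<lambda>n x. w n x - v n x) (\<lambda>x. u x - z x) (\<lambda>e x. D e x - E e x)"
proof -
  have "frechet_derivative (\<lambda>x. w n x - v n x) (at x) e
      = frechet_derivative (w n) (at x) e - frechet_derivative (v n) (at x) e" for n x e
    using assms by (intro C1_diff) (auto simp: H1_approx_def)
  then show ?thesis
    using assms by (auto simp: H1_approx_def intro: C1_diff L2_tendsto_diff)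
qed

text \<open>\<open>H1_norm\<close> refers to the representative chosen for \<open>w n - u\<close>. By uniqueness it agrees almost everywhere
with the classical derivative of \<open>w n\<close> minus the representative chosen for \<open>u\<close>.\<close>

lemma H1_approx_if_H1_norm_tendsto_0:
  fixes \<Omega> :: "'a::euclidean_space set"
  assumes \<Omega>: "bounded \<Omega>" "open \<Omega>" and u: "u \<in> H1 \<Omega>" and w: "\<And>n. C1 (w n)"
    and lim: "(\<lambda>n. H1_norm \<Omega> (\<lambda>x. w n x - u x)) \<longlonglongrightarrow> 0"
  shows "H1_approx \<Omega> w u (\<lambda>e. weak_partial \<Omega> e u)"
proof -
  have wp: "has_weak_partial \<Omega> e (\<lambda>x. w n x - u x)
      (\<lambda>x. frechet_derivative (w n) (at x) e - weak_partial \<Omega> e u x)" if "e \<in> Basis" for n e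
    by (intro has_weak_partial_diff \<Omega> has_weak_partial_C1 C1_square_integrable w H1_D[OF u] that)
  have H: "(\<lambda>x. w n x - u x) \<in> H1 \<Omega>" for n
    unfolding H1_def using wp[of _ n] by (auto intro!: square_integrable_diff C1_square_integrable w \<Omega> H1_D[OF u])
  have "L2_norm (lebesgue_on \<Omega>) (\<lambda>x. frechet_derivative (w n) (at x) e - weak_partial \<Omega> e u x)
      \<le> H1_norm \<Omega> (\<lambda>x. w n x - u x)" if e: "e \<in> Basis" for n e
  proof -
    have ae: "AE x in lebesgue_on \<Omega>. (weak_partial \<Omega> e (\<lambda>x. w n x - u x) x)\<^sup>2
        = (frechet_derivative (w n) (at x) e - weak_partial \<Omega> e u x)\<^sup>2"
      using weak_partial_unique[OF \<Omega> wp[OF e, of n]] by eventually_elim (simp only:)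
    have "L2_norm (lebesgue_on \<Omega>) (weak_partial \<Omega> e (\<lambda>x. w n x - u x))
        = L2_norm (lebesgue_on \<Omega>) (\<lambda>x. frechet_derivative (w n) (at x) e - weak_partial \<Omega> e u x)"
      unfolding L2_norm_def
      by (intro arg_cong[where f = sqrt] integral_cong_AE[OF _ _ ae])
         (use H1_D(3)[OF H e] wp[OF e] in \<open>auto simp: has_weak_partial_def square_integrable_def\<close>)
    then show ?thesis using H1_norm_bounds(2)[OF H e, of n] by simp
  qed
  then have "L2_tendsto (lebesgue_on \<Omega>) (\<lambda>n x. frechet_derivative (w n) (at x) e) (weak_partial \<Omega> e u)"
    if "e \<in> Basis" for e
    unfolding L2_tendsto_def
    using C1_square_integrable(2)[OF w \<Omega>] H1_D(3)[OF u that] that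
    by (auto intro!: Lim_null_comparison[OF _ lim])
  moreover have "L2_tendsto (lebesgue_on \<Omega>) w u"
    unfolding L2_tendsto_def
    using C1_square_integrable(1)[OF w \<Omega>] H1_D(1)[OF u] H1_norm_bounds(1)[OF H]
    by (auto intro!: Lim_null_comparison[OF _ lim])
  ultimately show ?thesis using w by (auto simp: H1_approx_def)
qed

lemma has_trace_approx:
  fixes \<Omega> :: "'a::euclidean_space set"
  assumes \<Omega>: "bounded \<Omega>" "open \<Omega>"
    and M: "\<And>f. continuous_on UNIV f \<Longrightarrow> square_integrable M f"
    and tr: "has_trace \<Omega> M u T"
  obtains w where "H1_approx \<Omega> w u (\<lambda>e. weak_partial \<Omega> e u)" "L2_tendsto M w T"
proof -
  obtain w where w: "\<And>n. C1 (w n)" "(\<lambda>n. H1_norm \<Omega> (\<lambda>x. w n x - u x)) \<longlonglongrightarrow> 0"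
      "(\<lambda>n. L2_norm M (\<lambda>x. w n x - T x)) \<longlonglongrightarrow> 0" and u: "u \<in> H1 \<Omega>" "square_integrable M T"
    using tr unfolding has_trace_def by blast
  have "L2_tendsto M w T"
    unfolding L2_tendsto_def using w u M[OF C1_D(3)[OF w(1)]] by auto
  then show thesis
    using that H1_approx_if_H1_norm_tendsto_0[OF \<Omega> u(1) w(1,2)] by blast
qed

section \<open>The half ball and even reflection\<close>

lemma open_half_ball: "open (half_ball :: 'n::finite space set)"
proof -
  have "open {x :: 'n space. 0 < snd x}" by (intro open_Collect_less continuous_intros)
  then have "open (ball 0 1 \<inter> {x :: 'n space. 0 < snd x})" by auto
  moreover have "half_ball = ball 0 1 \<inter> {x :: 'n space. 0 < snd x}" by (auto simp: half_ball_def)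
  ultimately show ?thesis by simp
qed

lemma bounded_half_ball: "bounded (half_ball :: 'n::finite space set)"
  by (rule bounded_subset[OF bounded_ball[of 0 1]]) (auto simp: half_ball_def)

lemma Basis_space_cases:
  assumes "(e :: 'n::finite space) \<in> Basis"
  obtains "snd e = 0" | "e = (0, 1)"
  using assms by (auto simp: Basis_prod_def)

lemma square_integrable_half_ball_integrable:
  fixes f :: "'n::finite space \<Rightarrow> real"
  assumes "square_integrable (lebesgue_on half_ball) f"
  shows "integrable (lebesgue_on half_ball) f"
  using square_integrable_mult[OF assms C1_square_integrable(1)[OF C1_const[of 1] bounded_half_ball open_half_ball]]
  by simp

lemma integrable_bounded_mult:
  fixes f c :: "'a \<Rightarrow> real"
  assumes f: "integrable M f" and c: "c \<in> borel_measurable M"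
    and B: "\<And>x. x \<in> space M \<Longrightarrow> \<bar>c x\<bar> \<le> B"
  shows "integrable M (\<lambda>x. c x * f x)"
proof (rule Bochner_Integration.integrable_bound)
  show "integrable M (\<lambda>x. B * \<bar>f x\<bar>)" using f by auto
  show "(\<lambda>x. c x * f x) \<in> borel_measurable M" using f c by auto
  have "\<bar>c x * f x\<bar> \<le> \<bar>B * \<bar>f x\<bar>\<bar>" if "x \<in> space M" for x
    using mult_right_mono[OF B[OF that], of "\<bar>f x\<bar>"] abs_ge_self[of "B * \<bar>f x\<bar>"]
    unfolding abs_mult[of "c x"] by linarith
  then show "AE x in M. norm (c x * f x) \<le> norm (B * \<bar>f x\<bar>)" by auto
qed

lemma integral_bounded_multiplier_tendsto:
  fixes f :: "'a \<Rightarrow> real" and c :: "nat \<Rightarrow> 'a \<Rightarrow> real"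
  assumes f: "integrable M f" and c: "\<And>n. c n \<in> borel_measurable M"
    and B: "\<And>n x. x \<in> space M \<Longrightarrow> \<bar>c n x\<bar> \<le> B"
    and lim: "\<And>x. x \<in> space M \<Longrightarrow> (\<lambda>n. c n x) \<longlonglongrightarrow> k"
  shows "(\<lambda>n. LINT x|M. c n x * f x) \<longlonglongrightarrow> k * (LINT x|M. f x)"
proof -
  have "(\<lambda>n. LINT x|M. c n x * f x) \<longlonglongrightarrow> (LINT x|M. k * f x)"
  proof (rule integral_dominated_convergence)
    show "integrable M (\<lambda>x. B * \<bar>f x\<bar>)" using f by auto
    show "AE x in M. (\<lambda>n. c n x * f x) \<longlonglongrightarrow> k * f x"
      using lim by (auto intro!: AE_I2 tendsto_mult)
    show "AE x in M. norm (c n x * f x) \<le> B * \<bar>f x\<bar>" for n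
      using B by (auto intro!: AE_I2 mult_right_mono simp: abs_mult)
  qed (use f c in auto)
  then show ?thesis by simp
qed

lemma test_function_bounds:
  fixes \<eta> :: "'a::euclidean_space \<Rightarrow> real"
  assumes "test_function \<Omega> \<eta>"
  obtains B where "0 \<le> B" "\<And>x. \<bar>frechet_derivative \<eta> (at x) e\<bar> \<le> B"
proof -
  let ?S = "closure {x. \<eta> x \<noteq> 0}"
  have "bounded ((\<lambda>x. frechet_derivative \<eta> (at x) e) ` ?S)"
    using test_function_D(1,2)[OF assms]
    by (intro compact_imp_bounded compact_continuous_image C1_continuous_partial)
  then obtain B0 where B0: "\<And>x. x \<in> ?S \<Longrightarrow> \<bar>frechet_derivative \<eta> (at x) e\<bar> \<le> B0"
    by (auto simp: bounded_iff)
  have "\<bar>frechet_derivative \<eta> (at x) e\<bar> \<le> max 0 B0" for x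
    using B0[of x] frechet_derivative_0_outside_support[of x \<eta>] by (cases "x \<in> ?S") auto
  then show thesis using that[of "max 0 B0"] by simp
qed

definition flat_cutoff :: "nat \<Rightarrow> 'n::finite space \<Rightarrow> real" where
  "flat_cutoff n x = transition (real (Suc n) * snd x - 1)"

lemma flat_cutoff_C1:
  fixes x :: "'n::finite space"
  shows "C1 (flat_cutoff n :: 'n space \<Rightarrow> real)"
    "frechet_derivative (flat_cutoff n) (at x) e = transition' (real (Suc n) * snd x - 1) * (real (Suc n) * snd e)"
proof -
  have "C1 (\<lambda>x::'n space. real (Suc n) * snd x - 1)"
    by (intro C1_diff C1_cmult C1_snd C1_const)
  note * = C1_transition[OF this]
  show "C1 (flat_cutoff n :: 'n space \<Rightarrow> real)"
    unfolding flat_cutoff_def[abs_def] by (rule *)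
  have "frechet_derivative (\<lambda>x::'n space. real (Suc n) * snd x - 1) (at x) e = real (Suc n) * snd e"
    by (simp only: C1_diff(2)[OF C1_cmult(1)[OF C1_snd(1)] C1_const] C1_cmult(2)[OF C1_snd(1)] C1_snd(2)
        frechet_derivative_const diff_zero)
  then show "frechet_derivative (flat_cutoff n) (at x) e = transition' (real (Suc n) * snd x - 1) * (real (Suc n) * snd e)"
    unfolding flat_cutoff_def[abs_def] *(2) by simp
qed

lemma eventually_flat_cutoff_arg:
  assumes "0 < t"
  shows "eventually (\<lambda>n. 1 \<le> real (Suc n) * t - 1) sequentially"
proof -
  have "eventually (\<lambda>n. 2 / t \<le> real n) sequentially"
    using eventually_ge_at_top[of "nat \<lceil>2 / t\<rceil>"] by eventually_elim linarith
  then show ?thesis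
    by eventually_elim (use assms in \<open>auto simp: field_simps\<close>)
qed

lemma test_function_flat_cutoff:
  assumes "test_function (ball 0 1) \<zeta>"
  shows "test_function half_ball (\<lambda>x. flat_cutoff n x * \<zeta> x)"
proof -
  note \<zeta> = test_function_D[OF assms]
  define K where "K = closure {x. \<zeta> x \<noteq> 0} \<inter> {x. 1 / real (Suc n) \<le> snd x}"
  have "closed {x :: 'a space. 1 / real (Suc n) \<le> snd x}"
    by (intro closed_Collect_le continuous_intros)
  then have K: "compact K" unfolding K_def using \<zeta>(2) by (intro compact_Int_closed)
  have "0 < snd x" if "x \<in> K" for x
  proof -
    have "0 < 1 / real (Suc n)" by simp
    also have "\<dots> \<le> snd x" using that by (simp add: K_def)
    finally show ?thesis .
  qed
  then have K': "K \<subseteq> half_ball"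
    using \<zeta>(3) unfolding K_def half_ball_def by blast
  have "flat_cutoff n x * \<zeta> x = 0" if "x \<notin> K" for x
  proof (cases "x \<in> closure {x. \<zeta> x \<noteq> 0}")
    case True
    then have "snd x < 1 / real (Suc n)" using that by (simp add: K_def)
    then have "real (Suc n) * snd x - 1 \<le> 0" by (simp add: field_simps)
    then show ?thesis by (simp add: flat_cutoff_def transition_0)
  qed (use eq_0_outside_support[of x \<zeta>] in simp)
  then show ?thesis
    by (rule test_functionI[OF C1_mult(1)[OF flat_cutoff_C1(1) \<zeta>(1)] K K'])
qed

text \<open>A test function on the ball does not vanish near the flat boundary; multiplied by \<open>flat_cutoff n\<close> it
becomes admissible. The cutoff contributes an error term only for derivatives in a direction with a
normal component. If \<open>\<zeta>\<close> vanishes on the flat boundary, then \<open>\<zeta>\<close> is of the order of the distance to it,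
which compensates the derivative of the cutoff. The error is then bounded and supported in a layer
that shrinks to a null set.\<close>

lemma weak_partial_test_up_to_flat:
  fixes p q \<zeta> :: "'n::finite space \<Rightarrow> real"
  assumes p: "square_integrable (lebesgue_on half_ball) p"
    and pq: "has_weak_partial half_ball e p q"
    and \<zeta>: "test_function (ball 0 1) \<zeta>"
    and flat: "snd e = 0 \<or> (\<forall>x. snd x = 0 \<longrightarrow> \<zeta> x = 0)"
  shows "(LINT x|lebesgue_on half_ball. p x * frechet_derivative \<zeta> (at x) e)
       = - (LINT x|lebesgue_on half_ball. q x * \<zeta> x)"
proof -
  let ?M = "lebesgue_on (half_ball :: 'n space set)"
  note C = test_function_D(1)[OF \<zeta>]
  have q: "square_integrable ?M q" using pq by (simp add: has_weak_partial_def)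
  note sq = C1_square_integrable[OF C bounded_half_ball open_half_ball]
  have space: "space ?M = half_ball" by simp
  \<comment> \<open>the error term: derivative of the cutoff, times \<open>\<zeta>\<close>\<close>
  define c where "c n x = transition' (real (Suc n) * snd x - 1) * (real (Suc n) * snd e) * \<zeta> x"
    for n and x :: "'n space"
  obtain B where B: "0 \<le> B" "\<And>x. \<bar>frechet_derivative \<zeta> (at x) (0, 1)\<bar> \<le> B"
    using test_function_bounds[OF \<zeta>] by blast
  have c_bound: "\<bar>c n x\<bar> \<le> 8 * \<bar>snd e\<bar> * B" if x: "x \<in> half_ball" for n x
  proof (cases "snd e = 0 \<or> 1 \<le> real (Suc n) * snd x - 1")
    case True
    then show ?thesis using B(1) by (auto simp: c_def transition'_outside)
  next
    case False
    have t: "0 < snd x" using x by (simp add: half_ball_def)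
    obtain s where s: "\<zeta> ((fst x, 0) + snd x *\<^sub>R (0, 1)) - \<zeta> (fst x, 0)
        = snd x * frechet_derivative \<zeta> (at ((fst x, 0) + s *\<^sub>R (0, 1))) (0, 1)"
      using C1_mean_value[OF C t, of "(fst x, 0)" "(0, 1)"] by blast
    have "\<zeta> (fst x, 0) = 0" using flat False by auto
    then have "\<zeta> x = snd x * frechet_derivative \<zeta> (at ((fst x, 0) + s *\<^sub>R (0, 1))) (0, 1)"
      using s by simp
    then have "\<bar>\<zeta> x\<bar> \<le> snd x * B" using B(2) t by (simp add: abs_mult mult_left_mono)
    then have "real (Suc n) * \<bar>\<zeta> x\<bar> \<le> real (Suc n) * (snd x * B)" by (intro mult_left_mono) auto
    also have "\<dots> \<le> 2 * B"
      using False B(1) mult_right_mono[of "real (Suc n) * snd x" 2 B] by (simp add: mult.assoc)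
    finally have b: "real (Suc n) * \<bar>\<zeta> x\<bar> \<le> 2 * B" .
    have "\<bar>c n x\<bar> = \<bar>transition' (real (Suc n) * snd x - 1)\<bar> * (\<bar>snd e\<bar> * (real (Suc n) * \<bar>\<zeta> x\<bar>))"
      by (simp add: c_def abs_mult)
    also have "\<dots> \<le> 4 * (\<bar>snd e\<bar> * (2 * B))"
      by (intro mult_mono transition'_bound b order_refl) auto
    finally show ?thesis by simp
  qed
  have c_meas: "c n \<in> borel_measurable ?M" for n
  proof -
    have "continuous_on UNIV (c n)"
      unfolding c_def[abs_def] by (intro continuous_intros C1_D(3)[OF C])
    then show ?thesis by (intro borel_measurable_lebesgue_onI borel_measurable_continuous_onI)
  qed
  have \<kappa>_meas: "flat_cutoff n \<in> borel_measurable ?M" for n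
    by (intro borel_measurable_lebesgue_onI C1_D(4) flat_cutoff_C1)
  have \<kappa>_bound: "\<bar>flat_cutoff n x\<bar> \<le> 1" for n x
    using transition_bounds by (simp add: flat_cutoff_def)
  have \<kappa>_lim: "(\<lambda>n. flat_cutoff n x) \<longlonglongrightarrow> 1" if "x \<in> half_ball" for x
  proof (rule tendsto_eventually)
    have "0 < snd x" using that by (simp add: half_ball_def)
    from eventually_flat_cutoff_arg[OF this] show "\<forall>\<^sub>F n in sequentially. flat_cutoff n x = 1"
      by eventually_elim (simp add: flat_cutoff_def transition_1)
  qed
  have c_lim: "(\<lambda>n. c n x) \<longlonglongrightarrow> 0" if "x \<in> half_ball" for x
  proof (rule tendsto_eventually)
    have "0 < snd x" using that by (simp add: half_ball_def)
    from eventually_flat_cutoff_arg[OF this] show "\<forall>\<^sub>F n in sequentially. c n x = 0"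
      by eventually_elim (simp add: c_def transition'_outside)
  qed
  have pi: "integrable ?M p"
    by (rule square_integrable_half_ball_integrable[OF p])
  have i1: "integrable ?M (\<lambda>x. p x * frechet_derivative \<zeta> (at x) e)" and i2: "integrable ?M (\<lambda>x. q x * \<zeta> x)"
    using square_integrable_mult[OF p sq(2)] square_integrable_mult[OF q sq(1)] by auto
  have "(LINT x|?M. flat_cutoff n x * (p x * frechet_derivative \<zeta> (at x) e)) + (LINT x|?M. c n x * p x)
      = - (LINT x|?M. flat_cutoff n x * (q x * \<zeta> x))" for n
  proof -
    have j1: "integrable ?M (\<lambda>x. flat_cutoff n x * (p x * frechet_derivative \<zeta> (at x) e))"
      by (rule integrable_bounded_mult[OF i1 \<kappa>_meas \<kappa>_bound])
    have j2: "integrable ?M (\<lambda>x. c n x * p x)"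
      by (rule integrable_bounded_mult[OF pi c_meas c_bound]) simp
    have "(LINT x|?M. flat_cutoff n x * (p x * frechet_derivative \<zeta> (at x) e)) + (LINT x|?M. c n x * p x)
        = (LINT x|?M. flat_cutoff n x * (p x * frechet_derivative \<zeta> (at x) e) + c n x * p x)"
      by (rule Bochner_Integration.integral_add[OF j1 j2, symmetric])
    also have "\<dots> = (LINT x|?M. p x * frechet_derivative (\<lambda>x. flat_cutoff n x * \<zeta> x) (at x) e)"
      unfolding C1_mult(2)[OF flat_cutoff_C1(1) C] flat_cutoff_C1(2) c_def
      by (intro Bochner_Integration.integral_cong) (simp_all add: algebra_simps)
    also have "\<dots> = - (LINT x|?M. q x * (flat_cutoff n x * \<zeta> x))"
      using pq test_function_flat_cutoff[OF \<zeta>, of n] unfolding has_weak_partial_def by blast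
    finally show ?thesis by (simp add: mult.left_commute)
  qed
  moreover have "(\<lambda>n. (LINT x|?M. flat_cutoff n x * (p x * frechet_derivative \<zeta> (at x) e)) + (LINT x|?M. c n x * p x))
      \<longlonglongrightarrow> 1 * (LINT x|?M. p x * frechet_derivative \<zeta> (at x) e) + 0 * (LINT x|?M. p x)"
    by (intro tendsto_add integral_bounded_multiplier_tendsto[OF i1] integral_bounded_multiplier_tendsto[OF pi])
       (use \<kappa>_meas \<kappa>_bound \<kappa>_lim c_meas c_bound c_lim space in auto)
  moreover have "(\<lambda>n. - (LINT x|?M. flat_cutoff n x * (q x * \<zeta> x))) \<longlonglongrightarrow> - (1 * (LINT x|?M. q x * \<zeta> x))"
    by (intro tendsto_minus integral_bounded_multiplier_tendsto[OF i2]) (use \<kappa>_meas \<kappa>_bound \<kappa>_lim space in auto)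
  ultimately show ?thesis using LIMSEQ_unique by fastforce
qed

definition reflect :: "'n::finite space \<Rightarrow> 'n space" where
  "reflect x = (fst x, - snd x)"

lemma reflect_simps [simp]:
  "fst (reflect x) = fst x" "snd (reflect x) = - snd x" "reflect (reflect x) = x" "norm (reflect x) = norm x"
  by (auto simp: reflect_def norm_prod_def)

lemma bounded_linear_reflect: "bounded_linear reflect"
  unfolding reflect_def[abs_def]
  by (intro bounded_linear_Pair bounded_linear_fst bounded_linear_minus bounded_linear_snd)

lemma reflect_lebesgue:
  "reflect \<in> lebesgue \<rightarrow>\<^sub>M lebesgue" "distr lebesgue lebesgue reflect = lebesgue"
proof -
  define c :: "'n::finite space \<Rightarrow> real" where "c j = (if j = (0, 1) then - 1 else 1)" for j
  have T: "(\<lambda>x. 0 + (\<Sum>j\<in>Basis. (c j * (x \<bullet> j)) *\<^sub>R j)) = (reflect :: 'n space \<Rightarrow> _)"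
  proof
    fix x :: "'n space"
    show "0 + (\<Sum>j\<in>Basis. (c j * (x \<bullet> j)) *\<^sub>R j) = reflect x"
    proof (rule euclidean_eqI)
      fix j :: "'n space" assume j: "j \<in> Basis"
      have "c j * (x \<bullet> j) = reflect x \<bullet> j"
        using j by (auto simp: c_def reflect_def Basis_prod_def inner_prod_def)
      then show "(0 + (\<Sum>j\<in>Basis. (c j * (x \<bullet> j)) *\<^sub>R j)) \<bullet> j = reflect x \<bullet> j"
        using j by (simp add: inner_sum_left_Basis)
    qed
  qed
  have c: "\<And>j. j \<in> Basis \<Longrightarrow> c j \<noteq> 0" by (simp add: c_def)
  have "(\<Prod>j\<in>Basis. \<bar>c j\<bar>) = 1" by (intro prod.neutral) (simp add: c_def)
  then show "distr lebesgue lebesgue reflect = (lebesgue :: 'n space measure)"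
    using lebesgue_affine_euclidean[of c 0, OF c] T by (simp add: density_1)
  show "(reflect :: 'n space \<Rightarrow> _) \<in> lebesgue \<rightarrow>\<^sub>M lebesgue"
    using lebesgue_affine_measurable[of c 0, OF c] T by simp
qed

text \<open>No condition is imposed on \<open>F\<close> where the last coordinate is \<open>0\<close>, because that hyperplane is a null
set and Lebesgue measure is complete.\<close>

lemma integral_ball_eq_half_balls:
  fixes f g F :: "'n::finite space \<Rightarrow> real"
  assumes f: "integrable (lebesgue_on half_ball) f" and g: "integrable (lebesgue_on half_ball) g"
    and F: "\<And>x. x \<in> half_ball \<Longrightarrow> F x = f x" "\<And>x. x \<in> half_ball \<Longrightarrow> F (reflect x) = g x"
  shows "integrable (lebesgue_on (ball 0 1)) F"
    "(LINT x|lebesgue_on (ball 0 1). F x) = (LINT x|lebesgue_on half_ball. f x) + (LINT x|lebesgue_on half_ball. g x)"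
proof -
  have [simp]: "(half_ball :: 'n space set) \<in> sets borel" by (rule borel_open[OF open_half_ball])
  let ?f = "\<lambda>x. indicator half_ball x *\<^sub>R f x" and ?g = "\<lambda>x. indicator half_ball x *\<^sub>R g x"
  have fi: "integrable lebesgue ?f" and gi: "integrable lebesgue ?g"
    using f g by (simp_all add: integrable_restrict_space)
  have gi': "integrable lebesgue (\<lambda>x. ?g (reflect x))"
    and ge: "(LINT x|lebesgue. ?g (reflect x)) = (LINT x|lebesgue. ?g x)"
    using gi integrable_distr_eq[OF reflect_lebesgue(1) borel_measurable_integrable[OF gi]]
      integral_distr[OF reflect_lebesgue(1) borel_measurable_integrable[OF gi]]
    by (simp_all only: reflect_lebesgue(2))
  have hi: "integrable lebesgue (\<lambda>x. ?f x + ?g (reflect x))" using fi gi' by (rule Bochner_Integration.integrable_add)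
  have "negligible {x :: 'n space. (0, 1) \<bullet> x = 0}" by (rule negligible_hyperplane) (simp add: prod_eq_iff)
  then have "AE x :: 'n space in lebesgue. snd x \<noteq> 0"
    by (auto simp: negligible_iff_null_sets completion.AE_iff_null_sets inner_prod_def intro!: AE_I')
  then have AE: "AE x in lebesgue. ?f x + ?g (reflect x) = indicator (ball 0 1) x *\<^sub>R F x"
  proof eventually_elim
    case (elim x)
    have "F x = g (reflect x)" if "reflect x \<in> half_ball" using F(2)[OF that] by simp
    moreover have "reflect x \<in> half_ball \<longleftrightarrow> x \<in> ball 0 1 \<and> snd x < 0" by (simp add: half_ball_def)
    moreover have "x \<in> half_ball \<longleftrightarrow> x \<in> ball 0 1 \<and> snd x > 0" by (simp add: half_ball_def)
    ultimately show ?case using elim F(1)[of x] by (cases "x \<in> ball 0 1"; cases "snd x > 0") simp_all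
  qed
  have m: "(\<lambda>x. indicator (ball 0 1) x *\<^sub>R F x) \<in> borel_measurable lebesgue"
    by (rule borel_measurable_AE[OF borel_measurable_integrable[OF hi] AE])
  have "integrable lebesgue (\<lambda>x. indicator (ball 0 1) x *\<^sub>R F x)"
    by (rule integrable_cong_AE_imp[OF hi m AE])
  then show "integrable (lebesgue_on (ball 0 1)) F" by (subst integrable_restrict_space) auto
  have "(LINT x|lebesgue_on (ball 0 1). F x) = (LINT x|lebesgue. indicator (ball 0 1) x *\<^sub>R F x)"
    by (rule integral_restrict_space) simp
  also have "\<dots> = (LINT x|lebesgue. ?f x + ?g (reflect x))"
    using AE by (intro integral_cong_AE m borel_measurable_integrable[OF hi]) auto
  also have "\<dots> = (LINT x|lebesgue. ?f x) + (LINT x|lebesgue. ?g x)"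
    using fi gi' ge by simp
  also have "\<dots> = (LINT x|lebesgue_on half_ball. f x) + (LINT x|lebesgue_on half_ball. g x)"
    by (simp add: integral_restrict_space)
  finally show "(LINT x|lebesgue_on (ball 0 1). F x)
      = (LINT x|lebesgue_on half_ball. f x) + (LINT x|lebesgue_on half_ball. g x)" .
qed

lemma even_ext_half: "x \<in> half_ball \<Longrightarrow> even_ext u x = u x" "x \<in> half_ball \<Longrightarrow> even_ext u (reflect x) = u x"
  by (auto simp: even_ext_def half_ball_def reflect_def split: prod.split)

text \<open>A test function \<open>\<eta>\<close> on the ball is folded onto the half ball, which produces \<open>\<eta> \<plusminus> \<eta> \<circ> reflect\<close>. The sign
is \<open>+\<close> for a tangential derivative. It is \<open>-\<close> for the normal one, and then the folded function
vanishes on the flat boundary; in both cases it may be used against the weak derivative of \<open>u\<close>.\<close>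

lemma has_weak_partial_even_ext:
  fixes u p :: "'n::finite space \<Rightarrow> real"
  assumes u: "square_integrable (lebesgue_on half_ball) u"
    and p: "has_weak_partial half_ball e u p" and e: "e \<in> Basis"
  defines "s \<equiv> if snd e = 0 then 1 else -1"
  shows "has_weak_partial (ball 0 1) e (even_ext u) (\<lambda>x. (if 0 < snd x then 1 else s) * even_ext p x)"
  unfolding has_weak_partial_def
proof (intro conjI allI impI)
  let ?M = "lebesgue_on (half_ball :: 'n space set)"
  let ?P = "\<lambda>x. (if 0 < snd x then 1 else s) * even_ext p x"
  have psq: "square_integrable ?M p" using p by (simp add: has_weak_partial_def)
  have s: "s\<^sup>2 = 1" "reflect e = s *\<^sub>R e"
    using e by (auto elim!: Basis_space_cases simp: s_def reflect_def prod_eq_iff)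
  have pos: "0 < snd x" if "x \<in> half_ball" for x :: "'n space" using that by (simp add: half_ball_def)
  have P: "?P x = p x" "?P (reflect x) = s * p x" if "x \<in> half_ball" for x
    using even_ext_half[OF that] pos[OF that] by auto
  show "square_integrable (lebesgue_on (ball 0 1)) ?P"
    unfolding square_integrable_def
  proof
    have "integrable (lebesgue_on (ball 0 1)) ?P"
      by (rule integral_ball_eq_half_balls(1)[of p "\<lambda>x. s * p x"])
         (use P square_integrable_half_ball_integrable[OF psq] in auto)
    then show "?P \<in> borel_measurable (lebesgue_on (ball 0 1))" by (rule borel_measurable_integrable)
    show "integrable (lebesgue_on (ball 0 1)) (\<lambda>x. (?P x)\<^sup>2)"
      by (rule integral_ball_eq_half_balls(1)[of "\<lambda>x. (p x)\<^sup>2" "\<lambda>x. (p x)\<^sup>2"])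
         (use P psq s in \<open>auto simp: square_integrable_def power_mult_distrib\<close>)
  qed
  fix \<eta> :: "'n space \<Rightarrow> real" assume \<eta>: "test_function (ball 0 1) \<eta>"
  note C = test_function_D(1)[OF \<eta>]
  let ?\<eta>r = "\<lambda>x. \<eta> (reflect x)"
  have Cr: "C1 ?\<eta>r" "\<And>x. frechet_derivative ?\<eta>r (at x) e = s * frechet_derivative \<eta> (at (reflect x)) e"
    using C1_linear_compose[OF bounded_linear_reflect C] s(2) linear_cmul[OF C1_D(5)[OF C]] by auto
  have \<eta>r: "test_function (ball 0 1) ?\<eta>r"
  proof (rule test_functionI[OF Cr(1)])
    show "compact (reflect ` closure {x. \<eta> x \<noteq> 0})"
      using test_function_D(2)[OF \<eta>] linear_continuous_on[OF bounded_linear_reflect]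
      by (intro compact_continuous_image)
    show "reflect ` closure {x. \<eta> x \<noteq> 0} \<subseteq> ball 0 1"
      using test_function_D(3)[OF \<eta>] by (auto simp: subset_iff)
    show "?\<eta>r x = 0" if "x \<notin> reflect ` closure {x. \<eta> x \<noteq> 0}" for x
    proof -
      have "reflect x \<notin> closure {x. \<eta> x \<noteq> 0}" using that by (metis image_eqI reflect_simps(3))
      then show ?thesis using eq_0_outside_support[of "reflect x" \<eta>] by simp
    qed
  qed
  have sr: "test_function (ball 0 1) (\<lambda>x. s * ?\<eta>r x)" by (rule test_function_mult[OF \<eta>r C1_const])
  define \<zeta> where "\<zeta> x = \<eta> x + s * ?\<eta>r x" for x
  have \<zeta>: "test_function (ball 0 1) \<zeta>"
    unfolding \<zeta>_def[abs_def] by (rule test_function_add_diff(1)[OF \<eta> sr])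
  have d\<zeta>: "frechet_derivative \<zeta> (at x) e = frechet_derivative \<eta> (at x) e + frechet_derivative \<eta> (at (reflect x)) e" for x
    unfolding \<zeta>_def[abs_def] C1_add(2)[OF C test_function_D(1)[OF sr]] C1_cmult(2)[OF Cr(1)] Cr(2)
    using s(1) by (simp add: power2_eq_square mult.assoc[symmetric])
  have flat: "snd e = 0 \<or> (\<forall>x. snd x = 0 \<longrightarrow> \<zeta> x = 0)"
    by (auto simp: \<zeta>_def s_def reflect_def prod_eq_iff)
  note sq = C1_square_integrable[OF C bounded_half_ball open_half_ball] C1_square_integrable(1)[OF Cr(1) bounded_half_ball open_half_ball]
  have "square_integrable ?M (\<lambda>x. s * (s * frechet_derivative \<eta> (at (reflect x)) e))"
    using square_integrable_cmult[OF C1_square_integrable(2)[OF Cr(1) bounded_half_ball open_half_ball, of e]]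
    unfolding Cr(2) .
  then have sq2: "square_integrable ?M (\<lambda>x. frechet_derivative \<eta> (at (reflect x)) e)"
    using s(1) by (simp add: power2_eq_square mult.assoc[symmetric])
  have j: "integrable ?M (\<lambda>x. u x * frechet_derivative \<eta> (at x) e)"
    "integrable ?M (\<lambda>x. u x * frechet_derivative \<eta> (at (reflect x)) e)"
    "integrable ?M (\<lambda>x. p x * \<eta> x)" "integrable ?M (\<lambda>x. s * (p x * \<eta> (reflect x)))"
    using square_integrable_mult[OF u sq(2)] square_integrable_mult[OF u sq2]
      square_integrable_mult[OF psq sq(1)] square_integrable_mult[OF psq sq(3)] by auto
  have "(LINT x|lebesgue_on (ball 0 1). even_ext u x * frechet_derivative \<eta> (at x) e)
      = (LINT x|?M. u x * frechet_derivative \<eta> (at x) e) + (LINT x|?M. u x * frechet_derivative \<eta> (at (reflect x)) e)"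
    by (rule integral_ball_eq_half_balls(2)[OF j(1,2)]) (simp_all add: even_ext_half)
  also have "\<dots> = (LINT x|?M. u x * frechet_derivative \<zeta> (at x) e)"
    unfolding d\<zeta> using j by (simp add: distrib_left)
  also have "\<dots> = - (LINT x|?M. p x * \<zeta> x)"
    by (rule weak_partial_test_up_to_flat[OF u p \<zeta> flat])
  also have "(LINT x|?M. p x * \<zeta> x) = (LINT x|?M. p x * \<eta> x) + (LINT x|?M. s * (p x * \<eta> (reflect x)))"
    unfolding \<zeta>_def Bochner_Integration.integral_add[OF j(3,4), symmetric] by (simp add: algebra_simps)
  also have "\<dots> = (LINT x|lebesgue_on (ball 0 1). ?P x * \<eta> x)"
    by (rule integral_ball_eq_half_balls(2)[OF j(3,4), symmetric]) (simp_all only: P mult.assoc)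
  finally show "(LINT x|lebesgue_on (ball 0 1). even_ext u x * frechet_derivative \<eta> (at x) e)
      = - (LINT x|lebesgue_on (ball 0 1). ?P x * \<eta> x)" .
qed

lemma F_th_eq_sum_half_ball:
  fixes u :: "'n::finite space \<Rightarrow> real"
  assumes u: "u \<in> H1 half_ball"
  shows "F_th u = (\<Sum>e\<in>Basis. LINT x|lebesgue_on half_ball. (weak_partial half_ball e u x)\<^sup>2)"
proof -
  let ?B = "lebesgue_on (ball (0 :: 'n space) 1)"
  let ?P = "\<lambda>e x. (if 0 < snd x then 1 else if snd e = 0 then 1 else -1) * even_ext (weak_partial half_ball e u) x"
  have wp: "has_weak_partial (ball 0 1) e (even_ext u) (?P e)" if "e \<in> Basis" for e
    by (rule has_weak_partial_even_ext[OF H1_D(1)[OF u] H1_D(2)[OF u that] that])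
  have sq: "square_integrable ?B (weak_partial (ball 0 1) e (even_ext u))" if "e \<in> Basis" for e
    using has_weak_partial_weak_partial[OF wp[OF that]] by (simp add: has_weak_partial_def)
  have "(LINT x|?B. (weak_partial (ball 0 1) e (even_ext u) x)\<^sup>2)
      = 2 * (LINT x|lebesgue_on half_ball. (weak_partial half_ball e u x)\<^sup>2)" if e: "e \<in> Basis" for e
  proof -
    have sqP: "square_integrable ?B (?P e)" using wp[OF e] by (simp add: has_weak_partial_def)
    have "AE x in ?B. (weak_partial (ball 0 1) e (even_ext u) x)\<^sup>2 = (?P e x)\<^sup>2"
      using weak_partial_unique[OF bounded_ball open_ball wp[OF e]] by eventually_elim (simp only:)
    then have "(LINT x|?B. (weak_partial (ball 0 1) e (even_ext u) x)\<^sup>2) = (LINT x|?B. (?P e x)\<^sup>2)"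
      by (rule integral_cong_AE[rotated 2]) (use sq[OF e] sqP in \<open>simp_all only: square_integrable_def borel_measurable_integrable\<close>)
    also have "\<dots> = (LINT x|lebesgue_on half_ball. (weak_partial half_ball e u x)\<^sup>2)
        + (LINT x|lebesgue_on half_ball. (weak_partial half_ball e u x)\<^sup>2)"
      by (rule integral_ball_eq_half_balls(2))
         (use H1_D(3)[OF u e] in \<open>auto simp: square_integrable_def even_ext_half power_mult_distrib\<close>)
    finally show ?thesis by simp
  qed
  then show ?thesis
    unfolding F_th_def using integral_norm_weak_grad_power2[of "ball 0 1" "even_ext u"] sq
    by (simp add: sum_distrib_left[symmetric])
qed

section \<open>Boundary measures of the half ball\<close>

lemma half_ball_borel [measurable]: "(half_ball :: 'n::finite space set) \<in> sets borel"
  by (rule borel_open[OF open_half_ball])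

lemma integral_flat_measure:
  fixes f :: "'n::finite space \<Rightarrow> real"
  assumes f: "f \<in> borel_measurable borel"
  shows "(LINT x|flat_measure. f x) = (LINT x'|lborel. indicator (ball 0 1) x' * f (x', 0))"
    "integrable flat_measure f \<longleftrightarrow> integrable lborel (\<lambda>x'. indicator (ball 0 1) x' * f (x', 0))"
proof -
  have m: "(\<lambda>x' :: real ^ 'n. (x', 0 :: real)) \<in> restrict_space lborel (ball 0 1) \<rightarrow>\<^sub>M borel"
    by (intro measurable_restrict_space1) (simp add: borel_prod[symmetric])
  show "(LINT x|flat_measure. f x) = (LINT x'|lborel. indicator (ball 0 1) x' * f (x', 0))"
    unfolding flat_measure_def by (subst integral_distr[OF m f]) (simp add: integral_restrict_space)
  show "integrable flat_measure f \<longleftrightarrow> integrable lborel (\<lambda>x'. indicator (ball 0 1) x' * f (x', 0))"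
    unfolding flat_measure_def by (subst integrable_distr_eq[OF m f]) (simp add: integrable_restrict_space)
qed

lemma sets_flat_measure [measurable_cong, simp]: "sets flat_measure = sets borel"
  by (simp add: flat_measure_def)

lemma square_integrable_flat_measure:
  fixes f :: "'n::finite space \<Rightarrow> real"
  assumes f: "continuous_on UNIV f"
  shows "square_integrable flat_measure f"
proof -
  have fm [measurable]: "f \<in> borel_measurable borel" using f by (rule borel_measurable_continuous_onI)
  let ?h = "\<lambda>x' :: real ^ 'n. (f (x', 0))\<^sup>2"
  have h: "continuous_on UNIV ?h"
    by (intro continuous_intros continuous_on_compose2[OF f]) auto
  have "integrable lborel (\<lambda>x'. indicator (ball 0 1) x' * ?h x')"
    by (rule integrable_indicator_continuous[OF _ bounded_ball h]) simp
  then have "integrable flat_measure (\<lambda>x. (f x)\<^sup>2)" by (subst integral_flat_measure) auto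
  then show ?thesis unfolding square_integrable_def by (simp add: fm measurable_cong_sets[OF sets_flat_measure refl])
qed

text \<open>The fundamental theorem of calculus on each vertical line; the upper end point contributes nothing
because \<open>\<zeta>\<close> vanishes near the sphere.\<close>

lemma integral_normal_partial_half_ball:
  fixes \<zeta> :: "'n::finite space \<Rightarrow> real"
  assumes \<zeta>: "test_function (ball 0 1) \<zeta>"
  shows "(LINT x|lebesgue_on half_ball. frechet_derivative \<zeta> (at x) (0, 1)) = - (LINT x|flat_measure. \<zeta> x)"
proof -
  note C = test_function_D(1)[OF \<zeta>]
  let ?d = "\<lambda>x. frechet_derivative \<zeta> (at x) (0, 1)"
  let ?g = "\<lambda>x :: 'n space. indicator {0<..} (snd x) * ?d x"
  have d_meas [measurable]: "?d \<in> borel_measurable borel" by (rule C1_partial_measurable[OF C])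
  have \<zeta>_meas [measurable]: "\<zeta> \<in> borel_measurable borel" by (rule C1_D(4)[OF C])
  have d_cont: "continuous_on UNIV ?d" by (rule C1_continuous_partial[OF C])
  have d0: "?d x = 0" "\<zeta> x = 0" if "1 \<le> norm x" for x
    using test_function_D(4,5)[OF \<zeta>, of x] that by auto
  have di: "integrable lborel ?d"
    by (rule integrable_continuous_compact_support[OF d_cont test_function_D(2)[OF \<zeta>]])
       (simp add: frechet_derivative_0_outside_support)
  have gi: "integrable (lborel \<Otimes>\<^sub>M lborel) ?g"
  proof -
    have "integrable lborel ?g"
    proof (rule Bochner_Integration.integrable_bound[OF di])
      have "{x :: 'n space. 0 < snd x} \<in> sets borel"
        by (intro borel_open open_Collect_less continuous_intros)
      then have "(\<lambda>x. indicator {x :: 'n space. 0 < snd x} x * ?d x) \<in> borel_measurable lborel" by simp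
      then show "?g \<in> borel_measurable lborel" by (simp add: indicator_def cong: if_cong)
    qed (auto simp: indicator_def)
    then show ?thesis by (simp add: lborel_prod)
  qed
  have "(LINT x|lebesgue_on half_ball. ?d x) = (LINT x|lborel. indicator half_ball x * ?d x)"
    by (intro integral_lebesgue_on_borel half_ball_borel d_meas)
  also have "\<dots> = (LINT x|lborel. ?g x)"
    by (intro Bochner_Integration.integral_cong refl)
       (use d0 in \<open>auto simp: indicator_def half_ball_def not_less\<close>)
  also have "\<dots> = (LINT x|(lborel \<Otimes>\<^sub>M lborel). ?g x)" by (simp add: lborel_prod)
  also have "\<dots> = (LINT x'|lborel. LINT t|lborel. ?g (x', t))"
    by (rule lborel_pair.integral_fst'[OF gi, symmetric])
  also have "\<dots> = (LINT x'|lborel. - \<zeta> (x', 0))"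
  proof (intro Bochner_Integration.integral_cong refl)
    fix x' :: "real ^ 'n"
    have n: "1 \<le> norm (x', t)" if "1 \<le> t" for t :: real
      using that norm_snd_le[of t x'] by simp
    have pair: "(x', 0) + t *\<^sub>R (0, 1) = (x', t)" for t :: real by simp
    have "(LINT t|lborel. ?g (x', t)) = (LINT t|lborel. ?d (x', t) * indicator {0..1} t)"
    proof (rule integral_cong_AE)
      show "AE t in lborel. ?g (x', t) = ?d (x', t) * indicator {0..1} t"
        using AE_lborel_singleton[of 0]
      proof eventually_elim
        case (elim t)
        then show ?case using d0(1)[OF n[of t]] by (auto simp: indicator_def)
      qed
      have "continuous_on UNIV (\<lambda>t. ?d (x', t))"
        by (intro continuous_on_compose2[OF d_cont] continuous_intros) auto
      then have [measurable]: "(\<lambda>t. ?d (x', t)) \<in> borel_measurable borel"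
        by (rule borel_measurable_continuous_onI)
      show "(\<lambda>t. ?g (x', t)) \<in> borel_measurable lborel"
        "(\<lambda>t. ?d (x', t) * indicator {0..1} t) \<in> borel_measurable lborel" by simp_all
    qed
    also have "\<dots> = \<zeta> (x', 1) - \<zeta> (x', 0)"
    proof (rule integral_FTC_Icc_real)
      show "DERIV (\<lambda>t. \<zeta> (x', t)) t :> ?d (x', t)" for t
        using C1_line_derivative[OF C, of "(x', 0)" "(0, 1)" t] by (simp add: pair)
      show "isCont (\<lambda>t. ?d (x', t)) t" for t
      proof -
        have "continuous_on UNIV (\<lambda>t. ?d (x', t))"
          by (intro continuous_on_compose2[OF d_cont] continuous_intros) auto
        then show ?thesis by (simp add: continuous_on_eq_continuous_at)
      qed
    qed simp
    also have "\<dots> = - \<zeta> (x', 0)" using d0(2)[OF n[of 1]] by simp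
    finally show "(LINT t|lborel. ?g (x', t)) = - \<zeta> (x', 0)" .
  qed
  also have "\<dots> = - (LINT x'|lborel. indicator (ball 0 1) x' * \<zeta> (x', 0))"
  proof -
    have e: "(\<lambda>x'. \<zeta> (x', 0)) = (\<lambda>x'. indicator (ball 0 1) x' * \<zeta> (x', 0))"
      using d0(2) by (auto simp: indicator_def norm_prod_def fun_eq_iff)
    show ?thesis unfolding Bochner_Integration.integral_minus by (subst e) (rule refl)
  qed
  also have "\<dots> = - (LINT x|flat_measure. \<zeta> x)" by (simp add: integral_flat_measure[OF \<zeta>_meas])
  finally show ?thesis .
qed

lemma measurable_sgn [measurable]: "(sgn :: 'a::euclidean_space \<Rightarrow> 'a) \<in> borel_measurable borel"
  unfolding sgn_div_norm[abs_def] by measurable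

lemma nn_integral_hemisphere_measure:
  fixes f :: "'n::finite space \<Rightarrow> ennreal"
  assumes f [measurable]: "f \<in> borel_measurable borel"
  shows "(\<integral>\<^sup>+x. f x \<partial>hemisphere_measure)
    = of_nat DIM('n space) * (\<integral>\<^sup>+x. f (sgn x) * indicator half_ball x \<partial>lborel)"
proof -
  define H where "H = {x :: 'n space. x \<in> sphere 0 1 \<and> 0 < snd x}"
  have "closed (sphere (0 :: 'n space) 1)" by simp
  moreover have "open {x :: 'n space. 0 < snd x}" by (intro open_Collect_less continuous_intros)
  ultimately have "sphere 0 1 \<inter> {x :: 'n space. 0 < snd x} \<in> sets borel" by auto
  moreover have "H = sphere 0 1 \<inter> {x :: 'n space. 0 < snd x}" by (auto simp: H_def)
  ultimately have H [measurable]: "H \<in> sets borel" by simp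
  have sgn: "sgn \<in> restrict_space lborel (ball (0 :: 'n space) 1) \<rightarrow>\<^sub>M borel"
    by (intro measurable_restrict_space1) simp
  have "(\<integral>\<^sup>+x. f x \<partial>hemisphere_measure) = (\<integral>\<^sup>+x. f x * indicator H x \<partial>sphere_measure)"
    unfolding hemisphere_measure_def H_def[symmetric]
    by (rule nn_integral_restrict_space) (use H in \<open>simp add: sphere_measure_def space_scale_measure\<close>)
  also have "\<dots> = of_nat DIM('n space) * (\<integral>\<^sup>+x. f (sgn x) * indicator H (sgn x) \<partial>restrict_space lborel (ball 0 1))"
  proof -
    have m: "(\<lambda>x. f x * indicator H x) \<in> borel_measurable borel" by measurable
    then show ?thesis
      unfolding sphere_measure_def
      by (subst nn_integral_scale_measure) (simp_all only: nn_integral_distr[OF sgn] measurable_distr_eq1)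
  qed
  also have "(\<integral>\<^sup>+x. f (sgn x) * indicator H (sgn x) \<partial>restrict_space lborel (ball 0 1))
      = (\<integral>\<^sup>+x. f (sgn x) * indicator H (sgn x) * indicator (ball 0 1) x \<partial>lborel)"
    by (rule nn_integral_restrict_space) simp
  also have "\<dots> = (\<integral>\<^sup>+x. f (sgn x) * indicator half_ball x \<partial>lborel)"
  proof (intro nn_integral_cong)
    fix x :: "'n space"
    have "sgn x \<in> H \<longleftrightarrow> 0 < snd x"
    proof (cases "x = 0")
      case False
      then have "snd (sgn x) = snd x / norm x" by (simp add: sgn_div_norm divide_inverse mult.commute)
      then show ?thesis using False by (simp add: H_def norm_sgn zero_less_divide_iff)
    qed (simp add: H_def)
    then show "f (sgn x) * indicator H (sgn x) * indicator (ball 0 1) x = f (sgn x) * indicator half_ball x"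
      by (auto simp: indicator_def half_ball_def)
  qed
  finally show ?thesis .
qed

lemma square_integrable_hemisphere_measure:
  fixes f :: "'n::finite space \<Rightarrow> real"
  assumes f: "continuous_on UNIV f"
  shows "square_integrable hemisphere_measure f"
proof -
  have fm [measurable]: "f \<in> borel_measurable borel" using f by (rule borel_measurable_continuous_onI)
  have hm: "f \<in> borel_measurable hemisphere_measure"
    unfolding hemisphere_measure_def sphere_measure_def by (intro measurable_restrict_space1) simp
  have "compact (cball (0 :: 'n space) 1)" by simp
  then have "bounded (f ` cball 0 1)"
    by (intro compact_imp_bounded compact_continuous_image continuous_on_subset[OF f]) auto
  then obtain B where B: "\<And>x. x \<in> cball 0 1 \<Longrightarrow> \<bar>f x\<bar> \<le> B"
    unfolding bounded_iff by (metis imageI real_norm_def)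
  have "(\<integral>\<^sup>+x. ennreal ((f x)\<^sup>2) \<partial>hemisphere_measure)
      = of_nat DIM('n space) * (\<integral>\<^sup>+x. ennreal ((f (sgn x))\<^sup>2) * indicator half_ball x \<partial>lborel)"
    by (rule nn_integral_hemisphere_measure) simp
  also have "\<dots> \<le> of_nat DIM('n space) * (\<integral>\<^sup>+x. ennreal (B\<^sup>2) * indicator (ball (0 :: 'n space) 1) x \<partial>lborel)"
  proof -
    have "(\<integral>\<^sup>+x. ennreal ((f (sgn x))\<^sup>2) * indicator half_ball x \<partial>lborel)
        \<le> (\<integral>\<^sup>+x. ennreal (B\<^sup>2) * indicator (ball (0 :: 'n space) 1) x \<partial>lborel)"
    proof (rule nn_integral_mono)
      fix x :: "'n space"
      have "sgn x \<in> cball 0 1" by (simp add: norm_sgn)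
      from power_mono[OF B[OF this], of 2]
      show "ennreal ((f (sgn x))\<^sup>2) * indicator half_ball x \<le> ennreal (B\<^sup>2) * indicator (ball 0 1) x"
        by (auto simp: indicator_def half_ball_def intro!: ennreal_leI)
    qed
    then show ?thesis by (rule mult_left_mono) simp
  qed
  also have "\<dots> < \<infinity>"
    using emeasure_lborel_ball_finite[of "0 :: 'n space" 1]
    by (simp add: nn_integral_cmult_indicator less_top[symmetric] ennreal_mult_eq_top_iff)
  finally have "integrable hemisphere_measure (\<lambda>x. (f x)\<^sup>2)"
    by (intro integrableI_bounded) (use hm in auto)
  then show ?thesis using hm by (simp add: square_integrable_def)
qed

text \<open>The surface measure is defined by radial projection, so the trace on the hemisphere, extended
constantly along rays, is controlled on the whole half ball. The factor \<open>d \<ge> 1\<close> from the definition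
of the surface measure is dropped.\<close>

lemma nn_integral_radial_trace_le:
  fixes f :: "'n::finite space \<Rightarrow> real"
  assumes f: "continuous_on UNIV f"
  shows "(\<integral>\<^sup>+x. ennreal ((f (sgn x))\<^sup>2) * indicator half_ball x \<partial>lborel) \<le> ennreal ((L2_norm hemisphere_measure f)\<^sup>2)"
proof -
  have fm [measurable]: "f \<in> borel_measurable borel" using f by (rule borel_measurable_continuous_onI)
  have "(\<integral>\<^sup>+x. ennreal ((f (sgn x))\<^sup>2) * indicator half_ball x \<partial>lborel)
      \<le> of_nat DIM('n space) * (\<integral>\<^sup>+x. ennreal ((f (sgn x))\<^sup>2) * indicator half_ball x \<partial>lborel)"
    using mult_right_mono[of "1::ennreal" "of_nat DIM('n space)"] DIM_positive[where 'a = "'n space"]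
    by (simp add: Suc_le_eq del: DIM_prod)
  also have "\<dots> = (\<integral>\<^sup>+x. ennreal ((f x)\<^sup>2) \<partial>hemisphere_measure)"
    by (rule nn_integral_hemisphere_measure[symmetric]) simp
  also have "\<dots> = ennreal ((L2_norm hemisphere_measure f)\<^sup>2)"
    unfolding L2_norm_power2
    using square_integrable_hemisphere_measure[OF f] by (intro nn_integral_eq_integral) (auto simp: square_integrable_def)
  finally show ?thesis .
qed

section \<open>The estimate near the spherical boundary\<close>

text \<open>The Cauchy--Schwarz inequality for \<open>f'\<close> and \<open>1\<close>, obtained from \<open>\<integral> (f' - D)\<^sup>2 \<ge> 0\<close>, where \<open>D\<close> is the mean
value of \<open>f'\<close>.\<close>

lemma interval_increment_power2_le:
  fixes f f' :: "real \<Rightarrow> real"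
  assumes "a < b" and f: "\<And>t. (f has_real_derivative f' t) (at t)" and c: "continuous_on UNIV f'"
  shows "(f b - f a)\<^sup>2 \<le> (b - a) * (LINT t|lborel. indicator {a..b} t * (f' t)\<^sup>2)"
proof -
  have int: "integrable lborel (\<lambda>t. indicator {a..b} t * h t)" if "continuous_on UNIV h" for h :: "real \<Rightarrow> real"
    using borel_integrable_compact[of "{a..b}" h] continuous_on_subset[OF that] by simp
  define D where "D = (f b - f a) / (b - a)"
  define J where "J = (LINT t|lborel. indicator {a..b} t * (f' t)\<^sup>2)"
  have "(LINT t|lborel. f' t * indicator {a..b} t) = f b - f a"
    by (rule integral_FTC_Icc_real) (use assms in \<open>auto simp: continuous_on_eq_continuous_at\<close>)
  then have FTC: "(LINT t|lborel. indicator {a..b} t * f' t) = f b - f a" by (simp add: mult.commute)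
  have one: "(LINT t|lborel. indicator {a..b} t * (1 :: real)) = b - a" using \<open>a < b\<close> by simp
  have i1: "integrable lborel (\<lambda>t. indicator {a..b} t * (f' t)\<^sup>2)"
    and i2: "integrable lborel (\<lambda>t. indicator {a..b} t * f' t)"
    and i3: "integrable lborel (\<lambda>t. indicator {a..b} t * (1 :: real))"
    by (intro int continuous_intros c)+
  have "0 \<le> (LINT t|lborel. indicator {a..b} t * (f' t - D)\<^sup>2)" by simp
  also have "\<dots> = (LINT t|lborel. indicator {a..b} t * (f' t)\<^sup>2 - (2 * D) * (indicator {a..b} t * f' t)
      + D\<^sup>2 * (indicator {a..b} t * 1))"
    by (intro Bochner_Integration.integral_cong refl) (simp add: power2_eq_square algebra_simps)
  also have "\<dots> = J - 2 * D * (f b - f a) + D\<^sup>2 * (b - a)"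
    using i1 i2 i3 by (simp only: Bochner_Integration.integral_add Bochner_Integration.integral_diff
      integral_mult_right_zero integrable_mult_right Bochner_Integration.integrable_diff FTC one J_def)
  also have "D\<^sup>2 * (b - a) = D * (f b - f a)"
    using \<open>a < b\<close> by (simp add: D_def power2_eq_square)
  also have "J - 2 * D * (f b - f a) + D * (f b - f a) = J - (f b - f a)\<^sup>2 / (b - a)"
    by (simp add: D_def power2_eq_square)
  finally show ?thesis using \<open>a < b\<close> by (simp add: J_def field_simps)
qed

definition grad_power2 :: "('a::euclidean_space \<Rightarrow> real) \<Rightarrow> 'a \<Rightarrow> real" where
  "grad_power2 y x = (\<Sum>e\<in>Basis. (frechet_derivative y (at x) e)\<^sup>2)"

lemma grad_power2_nonneg: "0 \<le> grad_power2 y x"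
  by (simp add: grad_power2_def sum_nonneg)

lemma continuous_grad_power2: "C1 y \<Longrightarrow> continuous_on A (grad_power2 y)"
  unfolding grad_power2_def[abs_def] by (intro continuous_intros C1_continuous_partial)

lemma directional_derivative_power2_le:
  fixes y :: "'a::euclidean_space \<Rightarrow> real"
  assumes "C1 y"
  shows "(frechet_derivative y (at p) x)\<^sup>2 \<le> grad_power2 y p * (norm x)\<^sup>2"
proof -
  note lin = C1_D(5)[OF assms, of p]
  have "frechet_derivative y (at p) x = frechet_derivative y (at p) (\<Sum>b\<in>Basis. (x \<bullet> b) *\<^sub>R b)"
    by (simp add: euclidean_representation)
  also have "\<dots> = (\<Sum>b\<in>Basis. (x \<bullet> b) * frechet_derivative y (at p) b)"
    by (simp add: linear_sum[OF lin] linear_cmul[OF lin])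
  finally have "(frechet_derivative y (at p) x)\<^sup>2 = (\<Sum>b\<in>Basis. (x \<bullet> b) * frechet_derivative y (at p) b)\<^sup>2"
    by simp
  also have "\<dots> \<le> (\<Sum>b\<in>Basis. (x \<bullet> b)\<^sup>2) * (\<Sum>b\<in>Basis. (frechet_derivative y (at p) b)\<^sup>2)"
    by (rule Cauchy_Schwarz_ineq_sum)
  also have "(\<Sum>b\<in>Basis. (x \<bullet> b)\<^sup>2) = (norm x)\<^sup>2"
    unfolding power2_norm_eq_inner by (subst (2) euclidean_inner) (simp add: power2_eq_square)
  finally show ?thesis by (simp add: grad_power2_def mult.commute)
qed

text \<open>The increment of \<open>y\<close> along the ray \<open>t \<mapsto> t x\<close> from \<open>x\<close> to the point \<open>sgn x\<close> of the sphere. The parameter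
is a dilation factor and not the arc length: the integration over \<open>x\<close> that follows is then a scaling
of Lebesgue measure, and no polar coordinates are needed.\<close>

lemma ray_estimate:
  fixes y :: "'a::euclidean_space \<Rightarrow> real"
  assumes y: "C1 y" and x: "0 < norm x" "norm x < 1"
  shows "ennreal ((y x)\<^sup>2) \<le> 2 * ennreal ((y (sgn x))\<^sup>2)
    + (\<integral>\<^sup>+t. ennreal (2 * (1 - norm x) * norm x * grad_power2 y (t *\<^sub>R x)) * indicator {t. 1 \<le> t \<and> t * norm x < 1} t \<partial>lborel)"
proof -
  define b where "b = 1 / norm x"
  have b: "1 < b" using x by (simp add: b_def)
  define c where "c = 2 * (1 - norm x) * norm x"
  have c: "0 \<le> c" using x by (simp add: c_def)
  let ?G = "\<lambda>t. grad_power2 y (t *\<^sub>R x)"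
  let ?f' = "\<lambda>t. frechet_derivative y (at (t *\<^sub>R x)) x"
  have contG: "continuous_on UNIV ?G"
    by (rule continuous_on_compose2[OF continuous_grad_power2[OF y, of UNIV]]) (auto intro!: continuous_intros)
  have contf': "continuous_on UNIV ?f'"
    by (rule continuous_on_compose2[OF C1_continuous_partial[OF y, of UNIV]]) (auto intro!: continuous_intros)
  have int: "integrable lborel (\<lambda>t. indicator {1..b} t * h t)" if "continuous_on UNIV h" for h :: "real \<Rightarrow> real"
    using borel_integrable_compact[of "{1..b}" h] continuous_on_subset[OF that] by simp
  have "(y (b *\<^sub>R x) - y (1 *\<^sub>R x))\<^sup>2 \<le> (b - 1) * (LINT t|lborel. indicator {1..b} t * (?f' t)\<^sup>2)"
    using C1_line_derivative[OF y, of 0 x] contf' b by (intro interval_increment_power2_le) auto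
  also have "\<dots> \<le> (b - 1) * (LINT t|lborel. (norm x)\<^sup>2 * (indicator {1..b} t * ?G t))"
  proof (intro mult_left_mono integral_mono)
    show "integrable lborel (\<lambda>t. indicator {1..b} t * (?f' t)\<^sup>2)"
      by (intro int continuous_intros contf')
    show "integrable lborel (\<lambda>t. (norm x)\<^sup>2 * (indicator {1..b} t * ?G t))"
      by (intro integrable_mult_right int contG)
    show "indicator {1..b} t * (?f' t)\<^sup>2 \<le> (norm x)\<^sup>2 * (indicator {1..b} t * ?G t)" for t
      using directional_derivative_power2_le[OF y, of "t *\<^sub>R x" x] by (simp add: indicator_def mult.commute)
  qed (use b in simp)
  also have "\<dots> = ((b - 1) * (norm x)\<^sup>2) * (LINT t|lborel. indicator {1..b} t * ?G t)" by simp
  also have "(b - 1) * (norm x)\<^sup>2 = c / 2"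
    using x by (simp add: b_def c_def power2_eq_square field_simps)
  finally have "2 * (y (b *\<^sub>R x) - y x)\<^sup>2 \<le> c * (LINT t|lborel. indicator {1..b} t * ?G t)" by simp
  moreover have "b *\<^sub>R x = sgn x" by (simp add: b_def sgn_div_norm divide_inverse)
  moreover have "(y x)\<^sup>2 \<le> 2 * (y (sgn x))\<^sup>2 + 2 * (y (sgn x) - y x)\<^sup>2"
  proof -
    have "0 \<le> (2 * y (sgn x) - y x)\<^sup>2" by simp
    then show ?thesis by (simp add: power2_eq_square algebra_simps)
  qed
  ultimately have "(y x)\<^sup>2 \<le> 2 * (y (sgn x))\<^sup>2 + (LINT t|lborel. c * (indicator {1..b} t * ?G t))" by simp
  then have "ennreal ((y x)\<^sup>2) \<le> ennreal (2 * (y (sgn x))\<^sup>2 + (LINT t|lborel. c * (indicator {1..b} t * ?G t)))"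
    by (rule ennreal_leI)
  also have "\<dots> = 2 * ennreal ((y (sgn x))\<^sup>2) + ennreal (LINT t|lborel. c * (indicator {1..b} t * ?G t))"
    using c by (subst ennreal_plus) (auto simp: ennreal_mult grad_power2_nonneg intro!: Bochner_Integration.integral_nonneg mult_nonneg_nonneg)
  also have "ennreal (LINT t|lborel. c * (indicator {1..b} t * ?G t)) = (\<integral>\<^sup>+t. ennreal (c * (indicator {1..b} t * ?G t)) \<partial>lborel)"
    using c by (intro nn_integral_eq_integral[symmetric] integrable_mult_right int contG)
      (auto simp: grad_power2_nonneg intro!: AE_I2 mult_nonneg_nonneg)
  also have "\<dots> = (\<integral>\<^sup>+t. ennreal (c * ?G t) * indicator {t. 1 \<le> t \<and> t * norm x < 1} t \<partial>lborel)"
  proof (intro nn_integral_cong_AE)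
    show "AE t in lborel. ennreal (c * (indicator {1..b} t * ?G t)) = ennreal (c * ?G t) * indicator {t. 1 \<le> t \<and> t * norm x < 1} t"
      using AE_lborel_singleton[of b]
    proof eventually_elim
      case (elim t)
      have "t * norm x < 1 \<longleftrightarrow> t < b" using x by (simp add: b_def field_simps)
      then show ?case using elim by (auto simp: indicator_def)
    qed
  qed
  finally show ?thesis unfolding c_def .
qed

text \<open>The exact factor is \<open>t\<^sup>-\<^sup>d\<close>; the bound \<open>1 / t\<close> suffices below and makes the constants independent of the
dimension.\<close>

lemma nn_integral_scaleR:
  fixes h :: "'a::euclidean_space \<Rightarrow> ennreal"
  assumes h [measurable]: "h \<in> borel_measurable borel" and t: "1 \<le> t"
  shows "(\<integral>\<^sup>+x. h (t *\<^sub>R x) \<partial>lborel) \<le> ennreal (1 / t) * (\<integral>\<^sup>+x. h x \<partial>lborel)"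
proof -
  have "(\<integral>\<^sup>+x. h x \<partial>lborel) = (\<integral>\<^sup>+x. h x \<partial>density (distr lborel borel (\<lambda>x. 0 + t *\<^sub>R x)) (\<lambda>_. ennreal (\<bar>t\<bar> ^ DIM('a))))"
    using t lborel_affine[of t "0 :: 'a"] by simp
  also have "\<dots> = ennreal (t ^ DIM('a)) * (\<integral>\<^sup>+x. h (t *\<^sub>R x) \<partial>lborel)"
    using t by (simp add: nn_integral_density nn_integral_distr nn_integral_cmult)
  finally have eq: "(\<integral>\<^sup>+x. h x \<partial>lborel) = ennreal (t ^ DIM('a)) * (\<integral>\<^sup>+x. h (t *\<^sub>R x) \<partial>lborel)" .
  have "t ^ 1 \<le> t ^ DIM('a)" using t DIM_positive[where 'a = 'a] by (intro power_increasing) auto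
  then have "1 \<le> 1 / t * t ^ DIM('a)" using t by (simp add: field_simps)
  then have "1 \<le> ennreal (1 / t * t ^ DIM('a))" by (simp only: ennreal_ge_1)
  then have "1 * (\<integral>\<^sup>+x. h (t *\<^sub>R x) \<partial>lborel) \<le> ennreal (1 / t * t ^ DIM('a)) * (\<integral>\<^sup>+x. h (t *\<^sub>R x) \<partial>lborel)"
    by (rule mult_right_mono) simp
  moreover have "ennreal (1 / t * t ^ DIM('a)) = ennreal (1 / t) * ennreal (t ^ DIM('a))"
    using t by (intro ennreal_mult) auto
  ultimately show ?thesis unfolding eq by (simp only: mult_1 mult.assoc)
qed

text \<open>The ray estimate is integrated over the shell. After exchanging the integrals, the substitution
\<open>w = t x\<close> turns the gradient at \<open>t x\<close> into the gradient at \<open>w\<close>, which again lies in the shell, and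
leaves the weight \<open>t\<^sup>-\<^sup>2\<close> on \<open>[1, 1 / \<rho>]\<close>, of total mass \<open>1 - \<rho>\<close>. The other factor \<open>1 - \<rho>\<close> bounds
\<open>1 - norm x\<close> in the ray estimate.\<close>

lemma nn_integral_shell_estimate:
  fixes y :: "'n::finite space \<Rightarrow> real"
  assumes y: "C1 y" and \<rho>: "0 < \<rho>" "\<rho> < 1"
  defines "S \<equiv> {x \<in> half_ball. \<rho> < norm x}"
  shows "(\<integral>\<^sup>+x. ennreal ((y x)\<^sup>2) * indicator S x \<partial>lborel)
    \<le> 2 * (\<integral>\<^sup>+x. ennreal ((y (sgn x))\<^sup>2) * indicator half_ball x \<partial>lborel)
      + (\<integral>\<^sup>+x. ennreal (2 * (1 - \<rho>)\<^sup>2 * grad_power2 y x) * indicator S x \<partial>lborel)"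
proof -
  let ?G = "grad_power2 y"
  have [measurable]: "y \<in> borel_measurable borel" "?G \<in> borel_measurable borel"
    using C1_D(4)[OF y] continuous_grad_power2[OF y, of UNIV] by (auto intro: borel_measurable_continuous_onI)
  have snd_m [measurable]: "(snd :: 'n space \<Rightarrow> real) \<in> borel_measurable borel"
    by (intro borel_measurable_continuous_onI continuous_intros)
  have S: "x \<in> S \<longleftrightarrow> 0 < snd x \<and> norm x < 1 \<and> \<rho> < norm x" for x
    by (auto simp: S_def half_ball_def)
  have S_eq: "S = {x. 0 < snd x \<and> norm x < 1 \<and> \<rho> < norm x}" using S by blast
  have S_meas [measurable]: "S \<in> sets borel" unfolding S_eq by measurable
  \<comment> \<open>the integrand on the ray through \<open>x\<close>, and the same integrand after substituting \<open>w = t x\<close>\<close>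
  define H where "H t x = (if 1 \<le> t \<and> 0 < snd x \<and> t * norm x < 1 \<and> \<rho> < norm x
      then ennreal (2 * (1 - \<rho>) * norm x * ?G (t *\<^sub>R x)) else 0)" for t :: real and x :: "'n space"
  define K where "K t w = (if 1 \<le> t \<and> 0 < snd w \<and> norm w < 1 \<and> t * \<rho> < norm w
      then ennreal (2 * (1 - \<rho>) * ?G w * (1 / t\<^sup>2)) else 0)" for t :: real and w :: "'n space"
  have H_meas [measurable]: "(\<lambda>(t, x). H t x) \<in> borel_measurable (lborel \<Otimes>\<^sub>M lborel)"
    unfolding H_def by measurable
  have K_meas [measurable]: "(\<lambda>(t, x). K t x) \<in> borel_measurable (lborel \<Otimes>\<^sub>M lborel)"
    unfolding K_def by measurable
  have "(\<integral>\<^sup>+x. ennreal ((y x)\<^sup>2) * indicator S x \<partial>lborel)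
      \<le> (\<integral>\<^sup>+x. 2 * (ennreal ((y (sgn x))\<^sup>2) * indicator half_ball x) + (\<integral>\<^sup>+t. H t x \<partial>lborel) \<partial>lborel)"
  proof (rule nn_integral_mono)
    fix x :: "'n space"
    show "ennreal ((y x)\<^sup>2) * indicator S x
        \<le> 2 * (ennreal ((y (sgn x))\<^sup>2) * indicator half_ball x) + (\<integral>\<^sup>+t. H t x \<partial>lborel)"
    proof (cases "x \<in> S")
      case True
      then have x: "0 < snd x" "norm x < 1" "\<rho> < norm x" using S by blast+
      have x': "0 < norm x" using x(3) \<rho>(1) by linarith
      have xh: "x \<in> half_ball" using True by (simp add: S_def)
      have "ennreal ((y x)\<^sup>2) \<le> 2 * ennreal ((y (sgn x))\<^sup>2)
          + (\<integral>\<^sup>+t. ennreal (2 * (1 - norm x) * norm x * ?G (t *\<^sub>R x)) * indicator {t. 1 \<le> t \<and> t * norm x < 1} t \<partial>lborel)"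
        by (rule ray_estimate[OF y x' x(2)])
      also have "\<dots> \<le> 2 * ennreal ((y (sgn x))\<^sup>2) + (\<integral>\<^sup>+t. H t x \<partial>lborel)"
      proof (intro add_left_mono nn_integral_mono)
        fix t :: real
        have "2 * (1 - norm x) * norm x * ?G (t *\<^sub>R x) \<le> 2 * (1 - \<rho>) * norm x * ?G (t *\<^sub>R x)"
          using x by (intro mult_right_mono grad_power2_nonneg) auto
        then show "ennreal (2 * (1 - norm x) * norm x * ?G (t *\<^sub>R x)) * indicator {t. 1 \<le> t \<and> t * norm x < 1} t \<le> H t x"
          using x by (auto simp: H_def indicator_def intro: ennreal_leI)
      qed
      finally show ?thesis using True xh by simp
    qed simp
  qed
  also have "\<dots> = 2 * (\<integral>\<^sup>+x. ennreal ((y (sgn x))\<^sup>2) * indicator half_ball x \<partial>lborel)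
      + (\<integral>\<^sup>+x. (\<integral>\<^sup>+t. H t x \<partial>lborel) \<partial>lborel)"
    by (subst nn_integral_add) (simp_all add: nn_integral_cmult)
  also have "(\<integral>\<^sup>+x. (\<integral>\<^sup>+t. H t x \<partial>lborel) \<partial>lborel) = (\<integral>\<^sup>+t. (\<integral>\<^sup>+x. H t x \<partial>lborel) \<partial>lborel)"
    by (rule lborel_pair.Fubini'[OF H_meas])
  also have "\<dots> \<le> (\<integral>\<^sup>+t. (\<integral>\<^sup>+w. K t w \<partial>lborel) \<partial>lborel)"
  proof (rule nn_integral_mono)
    fix t :: real
    show "(\<integral>\<^sup>+x. H t x \<partial>lborel) \<le> (\<integral>\<^sup>+w. K t w \<partial>lborel)"
    proof (cases "1 \<le> t")
      case True
      define k where "k w = (if 0 < snd w \<and> norm w < 1 \<and> t * \<rho> < norm w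
          then ennreal (2 * (1 - \<rho>) * (norm w / t) * ?G w) else 0)" for w :: "'n space"
      have [measurable]: "k \<in> borel_measurable borel" unfolding k_def[abs_def] by measurable
      have "H t x = k (t *\<^sub>R x)" for x
        using True by (simp add: H_def k_def zero_less_mult_iff)
      then have "(\<integral>\<^sup>+x. H t x \<partial>lborel) = (\<integral>\<^sup>+x. k (t *\<^sub>R x) \<partial>lborel)" by simp
      also have "\<dots> \<le> ennreal (1 / t) * (\<integral>\<^sup>+x. k x \<partial>lborel)"
        by (rule nn_integral_scaleR[OF _ True]) simp
      also have "\<dots> = (\<integral>\<^sup>+x. ennreal (1 / t) * k x \<partial>lborel)" by (simp add: nn_integral_cmult)
      also have "\<dots> \<le> (\<integral>\<^sup>+w. K t w \<partial>lborel)"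
      proof (rule nn_integral_mono)
        fix w :: "'n space"
        have "1 / t * (2 * (1 - \<rho>) * (norm w / t) * ?G w) \<le> 2 * (1 - \<rho>) * ?G w * (1 / t\<^sup>2)" if "norm w < 1"
        proof -
          have "norm w * (2 * (1 - \<rho>) * ?G w * (1 / t\<^sup>2)) \<le> 1 * (2 * (1 - \<rho>) * ?G w * (1 / t\<^sup>2))"
            using that \<rho> by (intro mult_right_mono mult_nonneg_nonneg grad_power2_nonneg) auto
          then show ?thesis by (simp add: power2_eq_square mult_ac)
        qed
        then show "ennreal (1 / t) * k w \<le> K t w"
          using True \<rho> by (auto simp: k_def K_def ennreal_mult[symmetric] grad_power2_nonneg intro: ennreal_leI)
      qed
      finally show ?thesis .
    qed (simp add: H_def)
  qed
  also have "\<dots> = (\<integral>\<^sup>+w. (\<integral>\<^sup>+t. K t w \<partial>lborel) \<partial>lborel)"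
    by (rule lborel_pair.Fubini'[OF K_meas, symmetric])
  also have "\<dots> \<le> (\<integral>\<^sup>+w. ennreal (2 * (1 - \<rho>)\<^sup>2 * ?G w) * indicator S w \<partial>lborel)"
  proof (rule nn_integral_mono)
    fix w :: "'n space"
    have "(\<integral>\<^sup>+t. ennreal (1 / t\<^sup>2) * indicator {1..1/\<rho>} t \<partial>lborel) = ennreal ((- 1 / (1 / \<rho>)) - (- 1 / 1))"
    proof (rule nn_integral_FTC_Icc)
      show "DERIV (\<lambda>t. - 1 / t) t :> 1 / t\<^sup>2" if "t \<in> {1..1/\<rho>}" for t
        using that by (auto intro!: derivative_eq_intros simp: power2_eq_square)
    qed (use \<rho> in auto)
    then have "(\<integral>\<^sup>+t. ennreal (1 / t\<^sup>2) * indicator {1..1/\<rho>} t \<partial>lborel) = ennreal (1 - \<rho>)" by simp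
    then have "(\<integral>\<^sup>+t. (ennreal (2 * (1 - \<rho>) * ?G w) * indicator S w) * (ennreal (1 / t\<^sup>2) * indicator {1..1/\<rho>} t) \<partial>lborel)
        = ennreal (2 * (1 - \<rho>) * ?G w) * indicator S w * ennreal (1 - \<rho>)"
      by (subst nn_integral_cmult) auto
    also have "\<dots> = ennreal (2 * (1 - \<rho>)\<^sup>2 * ?G w) * indicator S w"
      using \<rho> grad_power2_nonneg[of y w]
      by (auto simp: indicator_def ennreal_mult[symmetric] power2_eq_square mult_ac)
    finally have *: "(\<integral>\<^sup>+t. (ennreal (2 * (1 - \<rho>) * ?G w) * indicator S w) * (ennreal (1 / t\<^sup>2) * indicator {1..1/\<rho>} t) \<partial>lborel)
        = ennreal (2 * (1 - \<rho>)\<^sup>2 * ?G w) * indicator S w" .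
    have "K t w \<le> (ennreal (2 * (1 - \<rho>) * ?G w) * indicator S w) * (ennreal (1 / t\<^sup>2) * indicator {1..1/\<rho>} t)" for t
    proof (cases "1 \<le> t \<and> 0 < snd w \<and> norm w < 1 \<and> t * \<rho> < norm w")
      case True
      then have t: "\<rho> \<le> t * \<rho>" "t * \<rho> < 1" using \<rho> by auto
      then have "\<rho> < norm w" using True by linarith
      then have "w \<in> S" using True by (simp add: S)
      moreover have "t \<in> {1..1/\<rho>}" using t True \<rho> by (simp add: field_simps)
      ultimately show ?thesis using True \<rho> grad_power2_nonneg[of y w] by (simp add: K_def ennreal_mult[symmetric])
    qed (auto simp: K_def)
    then have "(\<integral>\<^sup>+t. K t w \<partial>lborel)
        \<le> (\<integral>\<^sup>+t. (ennreal (2 * (1 - \<rho>) * ?G w) * indicator S w) * (ennreal (1 / t\<^sup>2) * indicator {1..1/\<rho>} t) \<partial>lborel)"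
      by (intro nn_integral_mono)
    then show "(\<integral>\<^sup>+t. K t w \<partial>lborel) \<le> ennreal (2 * (1 - \<rho>)\<^sup>2 * ?G w) * indicator S w"
      unfolding * .
  qed
  finally show ?thesis by (simp add: add_left_mono)
qed

lemma shell_estimate_C1:
  fixes y :: "'n::finite space \<Rightarrow> real"
  assumes y: "C1 y" and \<rho>: "0 < \<rho>" "\<rho> < 1"
  defines "r \<equiv> indicator {x. \<rho> < norm x} :: 'n space \<Rightarrow> real"
  shows "(LINT x|lebesgue_on half_ball. r x * (y x)\<^sup>2) \<le> 2 * (L2_norm hemisphere_measure y)\<^sup>2
    + 2 * (1 - \<rho>)\<^sup>2 * (LINT x|lebesgue_on half_ball. r x * grad_power2 y x)"
proof -
  define S where "S = {x :: 'n space. x \<in> half_ball \<and> \<rho> < norm x}"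
  have "open {x :: 'n space. \<rho> < norm x}" by (intro open_Collect_less continuous_intros)
  then have r: "{x :: 'n space. \<rho> < norm x} \<in> sets borel" by simp
  moreover have "S = half_ball \<inter> {x. \<rho> < norm x}" by (auto simp: S_def)
  ultimately have S: "S \<in> sets borel" using half_ball_borel by simp
  have bS: "bounded S" by (rule bounded_subset[OF bounded_half_ball]) (auto simp: S_def)
  have conv: "(\<integral>\<^sup>+x. ennreal (h x) * indicator S x \<partial>lborel) = ennreal (LINT x|lebesgue_on half_ball. r x * h x)"
    if h: "continuous_on UNIV h" "\<And>x. 0 \<le> h x" for h
  proof -
    have hm: "h \<in> borel_measurable borel" using h(1) by (rule borel_measurable_continuous_onI)
    have "(\<integral>\<^sup>+x. ennreal (h x) * indicator S x \<partial>lborel) = (\<integral>\<^sup>+x. ennreal (indicator S x * h x) \<partial>lborel)"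
      by (intro nn_integral_cong) (auto simp: indicator_def)
    also have "\<dots> = ennreal (LINT x|lborel. indicator S x * h x)"
      by (intro nn_integral_eq_integral integrable_indicator_continuous S bS h(1)) (simp add: h(2))
    also have "(LINT x|lborel. indicator S x * h x) = (LINT x|lborel. indicator half_ball x * (r x * h x))"
      by (intro Bochner_Integration.integral_cong refl) (auto simp: S_def r_def indicator_def)
    also have "\<dots> = (LINT x|lebesgue_on half_ball. r x * h x)"
      unfolding r_def using r hm
      by (intro integral_lebesgue_on_borel[symmetric] half_ball_borel borel_measurable_times borel_measurable_indicator) simp_all
    finally show ?thesis .
  qed
  define A where "A = (LINT x|lebesgue_on half_ball. r x * (y x)\<^sup>2)"
  define B where "B = (LINT x|lebesgue_on half_ball. r x * (2 * (1 - \<rho>)\<^sup>2 * grad_power2 y x))"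
  define L where "L = (L2_norm hemisphere_measure y)\<^sup>2"
  have B: "B = 2 * (1 - \<rho>)\<^sup>2 * (LINT x|lebesgue_on half_ball. r x * grad_power2 y x)" "0 \<le> B"
  proof -
    have "B = (LINT x|lebesgue_on half_ball. (2 * (1 - \<rho>)\<^sup>2) * (r x * grad_power2 y x))"
      unfolding B_def by (intro Bochner_Integration.integral_cong refl) simp
    then show "B = 2 * (1 - \<rho>)\<^sup>2 * (LINT x|lebesgue_on half_ball. r x * grad_power2 y x)"
      by (simp only: integral_mult_right_zero)
    show "0 \<le> B"
      unfolding B_def r_def by (intro Bochner_Integration.integral_nonneg mult_nonneg_nonneg grad_power2_nonneg) auto
  qed
  have "ennreal A = (\<integral>\<^sup>+x. ennreal ((y x)\<^sup>2) * indicator S x \<partial>lborel)"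
    unfolding A_def by (rule conv[symmetric]) (intro continuous_intros C1_D(3)[OF y], simp)
  also have "\<dots> \<le> 2 * (\<integral>\<^sup>+x. ennreal ((y (sgn x))\<^sup>2) * indicator half_ball x \<partial>lborel)
      + (\<integral>\<^sup>+x. ennreal (2 * (1 - \<rho>)\<^sup>2 * grad_power2 y x) * indicator S x \<partial>lborel)"
    unfolding S_def by (rule nn_integral_shell_estimate[OF y \<rho>])
  also have "(\<integral>\<^sup>+x. ennreal (2 * (1 - \<rho>)\<^sup>2 * grad_power2 y x) * indicator S x \<partial>lborel) = ennreal B"
    unfolding B_def
    by (rule conv) (intro continuous_intros continuous_grad_power2[OF y], simp add: grad_power2_nonneg)
  also have "2 * (\<integral>\<^sup>+x. ennreal ((y (sgn x))\<^sup>2) * indicator half_ball x \<partial>lborel) + ennreal B \<le> 2 * ennreal L + ennreal B"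
    unfolding L_def by (intro add_right_mono mult_left_mono nn_integral_radial_trace_le C1_D(3)[OF y]) simp
  also have "\<dots> = ennreal (2 * L + B)"
    using B(2) by (simp add: L_def ennreal_mult)
  finally have "A \<le> 2 * L + B"
    using B(2) by (subst (asm) ennreal_le_iff) (auto simp: L_def)
  then show ?thesis unfolding A_def L_def B(1) .
qed

text \<open>A function with zero trace on the hemisphere is, in mean square, as small as the thickness
\<open>1 - \<rho>\<close> of the shell next to it. The trace term has no power of the thickness in front, which is
harmless as it disappears in the limit for each fixed \<open>\<rho>\<close>.\<close>

lemma shell_estimate:
  fixes z :: "'n::finite space \<Rightarrow> real"
  assumes y: "H1_approx half_ball y z D"
    and trace: "(\<lambda>n. L2_norm hemisphere_measure (y n)) \<longlonglongrightarrow> 0"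
    and \<rho>: "0 < \<rho>" "\<rho> < 1"
  defines "r \<equiv> indicator {x. \<rho> < norm x} :: 'n space \<Rightarrow> real"
  shows "(LINT x|lebesgue_on half_ball. r x * (z x)\<^sup>2)
    \<le> 2 * (1 - \<rho>)\<^sup>2 * (\<Sum>e\<in>Basis. LINT x|lebesgue_on half_ball. r x * (D e x)\<^sup>2)"
proof -
  let ?M = "lebesgue_on (half_ball :: 'n space set)"
  have "open {x :: 'n space. \<rho> < norm x}" by (intro open_Collect_less continuous_intros)
  then have rm: "r \<in> borel_measurable ?M"
    unfolding r_def by (intro borel_measurable_lebesgue_onI borel_measurable_indicator) simp
  have rb: "\<bar>r x\<bar> \<le> 1" for x by (simp add: r_def indicator_def)
  have C: "C1 (y n)" for n using y by (simp add: H1_approx_def)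
  have lim: "(\<lambda>n. LINT x|?M. r x * (f n x)\<^sup>2) \<longlonglongrightarrow> (LINT x|?M. r x * (F x)\<^sup>2)" if "L2_tendsto ?M f F" for f F
    using L2_tendsto_inner[OF that L2_tendsto_bounded_mult[OF that rm rb]] by (simp add: power2_eq_square mult_ac)
  have l1: "(\<lambda>n. LINT x|?M. r x * (y n x)\<^sup>2) \<longlonglongrightarrow> (LINT x|?M. r x * (z x)\<^sup>2)"
    using y by (intro lim) (simp add: H1_approx_def)
  have l2: "(\<lambda>n. \<Sum>e\<in>Basis. LINT x|?M. r x * (frechet_derivative (y n) (at x) e)\<^sup>2)
      \<longlonglongrightarrow> (\<Sum>e\<in>Basis. LINT x|?M. r x * (D e x)\<^sup>2)"
    using y by (intro tendsto_sum lim) (simp add: H1_approx_def)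
  have "(LINT x|?M. r x * (y n x)\<^sup>2) \<le> 2 * (L2_norm hemisphere_measure (y n))\<^sup>2
      + 2 * (1 - \<rho>)\<^sup>2 * (\<Sum>e\<in>Basis. LINT x|?M. r x * (frechet_derivative (y n) (at x) e)\<^sup>2)" for n
  proof -
    have "(LINT x|?M. r x * grad_power2 (y n) x) = (LINT x|?M. (\<Sum>e\<in>Basis. r x * (frechet_derivative (y n) (at x) e)\<^sup>2))"
      by (simp add: grad_power2_def sum_distrib_left)
    also have "\<dots> = (\<Sum>e\<in>Basis. LINT x|?M. r x * (frechet_derivative (y n) (at x) e)\<^sup>2)"
    proof (rule Bochner_Integration.integral_sum)
      fix e :: "'n space"
      show "integrable ?M (\<lambda>x. r x * (frechet_derivative (y n) (at x) e)\<^sup>2)"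
        using C1_square_integrable(2)[OF C bounded_half_ball open_half_ball, of n e]
        by (intro integrable_bounded_mult[OF _ rm rb]) (simp add: square_integrable_def)
    qed
    finally show ?thesis using shell_estimate_C1[OF C \<rho>, of n] unfolding r_def by simp
  qed
  moreover have "(\<lambda>n. 2 * (L2_norm hemisphere_measure (y n))\<^sup>2
      + 2 * (1 - \<rho>)\<^sup>2 * (\<Sum>e\<in>Basis. LINT x|?M. r x * (frechet_derivative (y n) (at x) e)\<^sup>2))
      \<longlonglongrightarrow> 2 * 0\<^sup>2 + 2 * (1 - \<rho>)\<^sup>2 * (\<Sum>e\<in>Basis. LINT x|?M. r x * (D e x)\<^sup>2)"
    by (intro tendsto_intros trace l2)
  ultimately show ?thesis using LIMSEQ_le[OF l1] by fastforce
qed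

text \<open>The shell estimate in the limit \<open>\<rho> \<rightarrow> 0\<close>, when the shell fills the half ball.\<close>

lemma Poincare_inequality:
  fixes z :: "'n::finite space \<Rightarrow> real"
  assumes y: "H1_approx half_ball y z D"
    and trace: "(\<lambda>n. L2_norm hemisphere_measure (y n)) \<longlonglongrightarrow> 0"
  shows "(LINT x|lebesgue_on half_ball. (z x)\<^sup>2) \<le> 2 * (\<Sum>e\<in>Basis. LINT x|lebesgue_on half_ball. (D e x)\<^sup>2)"
proof -
  let ?M = "lebesgue_on (half_ball :: 'n space set)"
  let ?r = "\<lambda>n. indicator {x :: 'n space. 1 / real (Suc (Suc n)) < norm x} :: 'n space \<Rightarrow> real"
  have rm: "?r n \<in> borel_measurable ?M" for n
  proof -
    have "open {x :: 'n space. 1 / real (Suc (Suc n)) < norm x}" by (intro open_Collect_less continuous_intros)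
    then show ?thesis by (intro borel_measurable_lebesgue_onI borel_measurable_indicator) simp
  qed
  have z2: "integrable ?M (\<lambda>x. (z x)\<^sup>2)" and D2: "\<And>e. e \<in> Basis \<Longrightarrow> integrable ?M (\<lambda>x. (D e x)\<^sup>2)"
    using y by (auto simp: H1_approx_def L2_tendsto_def square_integrable_def)
  have "(\<lambda>n. LINT x|?M. ?r n x * (z x)\<^sup>2) \<longlonglongrightarrow> 1 * (LINT x|?M. (z x)\<^sup>2)"
  proof (rule integral_bounded_multiplier_tendsto[OF z2 rm])
    show "\<bar>?r n x\<bar> \<le> 1" for n x by (simp add: indicator_def)
    fix x :: "'n space" assume "x \<in> space ?M"
    then have "snd x \<noteq> 0" by (simp add: half_ball_def)
    then have "0 < norm x" by auto
    then have "eventually (\<lambda>n. 1 / real (Suc n) < norm x) sequentially"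
      using order_tendstoD(2)[OF LIMSEQ_inverse_real_of_nat, of "norm x"] by (simp add: inverse_eq_divide)
    then have "eventually (\<lambda>n. 1 / real (Suc (Suc n)) < norm x) sequentially"
      by (subst eventually_sequentially_Suc)
    then show "(\<lambda>n. ?r n x) \<longlonglongrightarrow> 1"
      by (intro tendsto_eventually) (auto elim: eventually_mono)
  qed
  moreover have "(LINT x|?M. ?r n x * (z x)\<^sup>2) \<le> 2 * (\<Sum>e\<in>Basis. LINT x|?M. (D e x)\<^sup>2)" for n
  proof -
    let ?\<rho> = "1 / real (Suc (Suc n))"
    have "(LINT x|?M. ?r n x * (z x)\<^sup>2) \<le> 2 * (1 - ?\<rho>)\<^sup>2 * (\<Sum>e\<in>Basis. LINT x|?M. ?r n x * (D e x)\<^sup>2)"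
      by (rule shell_estimate[OF y trace]) auto
    also have "\<dots> \<le> 2 * 1 * (\<Sum>e\<in>Basis. LINT x|?M. (D e x)\<^sup>2)"
    proof (intro mult_mono sum_mono)
      show "(1 - ?\<rho>)\<^sup>2 \<le> 1" by (intro power_le_one) auto
      fix e :: "'n space" assume e: "e \<in> Basis"
      show "(LINT x|?M. ?r n x * (D e x)\<^sup>2) \<le> (LINT x|?M. (D e x)\<^sup>2)"
      proof (rule integral_mono[OF _ D2[OF e]])
        show "integrable ?M (\<lambda>x. ?r n x * (D e x)\<^sup>2)"
          by (rule integrable_bounded_mult[OF D2[OF e] rm, of _ 1]) (simp add: indicator_def)
        show "?r n x * (D e x)\<^sup>2 \<le> (D e x)\<^sup>2" for x by (simp add: indicator_def)
      qed
    qed (auto intro!: sum_nonneg Bochner_Integration.integral_nonneg)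
    finally show ?thesis by simp
  qed
  ultimately show ?thesis using LIMSEQ_le_const2 by fastforce
qed

section \<open>Integration by parts against functions vanishing on the sphere\<close>

lemma L2_tendsto_add:
  assumes f: "L2_tendsto M f F" and g: "L2_tendsto M g G"
  shows "L2_tendsto M (\<lambda>n x. f n x + g n x) (\<lambda>x. F x + G x)"
  using L2_tendsto_diff[OF f L2_tendsto_bounded_mult[OF g, of "\<lambda>_. -1" 1]] by simp

lemma continuous_bounded_on_bounded:
  fixes f :: "'a::euclidean_space \<Rightarrow> real"
  assumes f: "continuous_on UNIV f" and \<Omega>: "bounded \<Omega>"
  obtains B where "\<And>x. x \<in> \<Omega> \<Longrightarrow> \<bar>f x\<bar> \<le> B"
proof -
  have "compact (closure \<Omega>)" using \<Omega> by (simp add: compact_closure)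
  then have "bounded (f ` closure \<Omega>)"
    by (intro compact_imp_bounded compact_continuous_image continuous_on_subset[OF f]) auto
  then show thesis
    using that closure_subset unfolding bounded_iff by (metis imageI real_norm_def subsetD)
qed

lemma L2_tendsto_continuous_mult:
  fixes \<Omega> :: "'a::euclidean_space set"
  assumes f: "L2_tendsto (lebesgue_on \<Omega>) f F" and c: "continuous_on UNIV c" and \<Omega>: "bounded \<Omega>"
  shows "L2_tendsto (lebesgue_on \<Omega>) (\<lambda>n x. c x * f n x) (\<lambda>x. c x * F x)"
proof -
  obtain B where "\<And>x. x \<in> \<Omega> \<Longrightarrow> \<bar>c x\<bar> \<le> B"
    using continuous_bounded_on_bounded[OF c \<Omega>] by blast
  then show ?thesis
    by (intro L2_tendsto_bounded_mult[OF f, where B = B] borel_measurable_lebesgue_onI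
        borel_measurable_continuous_onI[OF c]) simp
qed

lemma H1_approx_mult:
  fixes \<Omega> :: "'a::euclidean_space set"
  assumes t: "H1_approx \<Omega> t z D" and c: "C1 c" and \<Omega>: "bounded \<Omega>"
  shows "H1_approx \<Omega> (\<lambda>n x. c x * t n x) (\<lambda>x. c x * z x)
    (\<lambda>e x. c x * D e x + frechet_derivative c (at x) e * z x)"
proof -
  have C: "C1 (t n)" for n using t by (simp add: H1_approx_def)
  have l0: "L2_tendsto (lebesgue_on \<Omega>) t z" using t by (simp add: H1_approx_def)
  have "L2_tendsto (lebesgue_on \<Omega>) (\<lambda>n x. frechet_derivative (\<lambda>x. c x * t n x) (at x) e)
      (\<lambda>x. c x * D e x + frechet_derivative c (at x) e * z x)" if "e \<in> Basis" for e
  proof -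
    have "L2_tendsto (lebesgue_on \<Omega>) (\<lambda>n x. frechet_derivative (t n) (at x) e) (D e)"
      using t that by (simp add: H1_approx_def)
    then show ?thesis
      unfolding C1_mult(2)[OF c C]
      by (intro L2_tendsto_add L2_tendsto_continuous_mult \<Omega> C1_D(3)[OF c] C1_continuous_partial[OF c] l0)
  qed
  then show ?thesis
    using C1_mult(1)[OF c C] L2_tendsto_continuous_mult[OF l0 C1_D(3)[OF c] \<Omega>] by (simp add: H1_approx_def)
qed

text \<open>The summand \<open>3\<close> makes the inner radius \<open>1 - 2 / (n + 3)\<close> of the shell where the cutoff varies
positive for every \<open>n\<close>, as the shell estimate demands.\<close>

definition sphere_cutoff :: "nat \<Rightarrow> 'a::euclidean_space \<Rightarrow> real" where
  "sphere_cutoff n x = transition ((real n + 3) * (1 - (norm x)\<^sup>2) - 1)"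

lemma sphere_cutoff_bounds: "0 \<le> sphere_cutoff n x" "sphere_cutoff n x \<le> 1"
  by (simp_all add: sphere_cutoff_def transition_bounds)

lemma C1_sphere_cutoff:
  fixes x :: "'a::euclidean_space"
  shows "C1 (sphere_cutoff n :: 'a \<Rightarrow> real)"
    "frechet_derivative (sphere_cutoff n) (at x) e
      = - (transition' ((real n + 3) * (1 - (norm x)\<^sup>2) - 1) * ((real n + 3) * (2 * (x \<bullet> e))))"
proof -
  have C: "C1 (\<lambda>x :: 'a. 1 - (norm x)\<^sup>2)" by (intro C1_diff C1_const C1_norm_power2)
  have C': "C1 (\<lambda>x :: 'a. (real n + 3) * (1 - (norm x)\<^sup>2) - 1)"
    by (intro C1_diff C1_cmult C C1_const)
  show "C1 (sphere_cutoff n :: 'a \<Rightarrow> real)"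
    unfolding sphere_cutoff_def[abs_def] by (rule C1_transition(1)[OF C'])
  have "frechet_derivative (\<lambda>x :: 'a. (real n + 3) * (1 - (norm x)\<^sup>2) - 1) (at x) e = (real n + 3) * - (2 * (x \<bullet> e))"
    by (simp only: C1_diff(2)[OF C1_cmult(1)[OF C] C1_const] C1_cmult(2)[OF C]
        C1_diff(2)[OF C1_const C1_norm_power2(1)] C1_norm_power2(2) frechet_derivative_const) simp
  then show "frechet_derivative (sphere_cutoff n) (at x) e
      = - (transition' ((real n + 3) * (1 - (norm x)\<^sup>2) - 1) * ((real n + 3) * (2 * (x \<bullet> e))))"
    unfolding sphere_cutoff_def[abs_def] C1_transition(2)[OF C'] by simp
qed

lemma sphere_cutoff_derivative_bound:
  fixes x :: "'a::euclidean_space"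
  assumes e: "e \<in> Basis" and x: "norm x < 1"
  shows "\<bar>frechet_derivative (sphere_cutoff n) (at x) e\<bar>
    \<le> 8 * (real n + 3) * indicator {x. 1 - 2 / (real n + 3) < norm x} x"
proof (cases "1 - 2 / (real n + 3) < norm x")
  case True
  have "\<bar>x \<bullet> e\<bar> \<le> 1" using Basis_le_norm[OF e, of x] x by simp
  then have "\<bar>transition' ((real n + 3) * (1 - (norm x)\<^sup>2) - 1)\<bar> * ((real n + 3) * (2 * \<bar>x \<bullet> e\<bar>))
      \<le> 4 * ((real n + 3) * (2 * 1))"
    by (intro mult_mono transition'_bound) auto
  then show ?thesis using True by (simp add: C1_sphere_cutoff(2) abs_mult)
next
  case False
  have "(norm x)\<^sup>2 \<le> norm x" using x by (simp add: power2_eq_square mult_left_le)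
  then have "2 / (real n + 3) \<le> 1 - (norm x)\<^sup>2" using False by simp
  then have "1 \<le> (real n + 3) * (1 - (norm x)\<^sup>2) - 1" by (simp add: field_simps)
  then show ?thesis by (simp add: C1_sphere_cutoff(2) transition'_outside)
qed

lemma sphere_cutoff_tendsto_1:
  assumes "norm x < 1"
  shows "(\<lambda>n. sphere_cutoff n x) \<longlonglongrightarrow> 1"
proof (rule tendsto_eventually)
  have "(norm x)\<^sup>2 < 1" using assms by (simp add: power_less_one_iff)
  then have "0 < 1 - (norm x)\<^sup>2" by simp
  from eventually_flat_cutoff_arg[OF this] show "\<forall>\<^sub>F n in sequentially. sphere_cutoff n x = 1"
  proof eventually_elim
    case (elim n)
    have "real (Suc n) * (1 - (norm x)\<^sup>2) \<le> (real n + 3) * (1 - (norm x)\<^sup>2)"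
      using \<open>0 < 1 - (norm x)\<^sup>2\<close> by (intro mult_right_mono) auto
    then show ?case using elim by (simp add: sphere_cutoff_def transition_1)
  qed
qed

lemma test_function_sphere_cutoff:
  fixes f :: "'a::euclidean_space \<Rightarrow> real"
  assumes f: "C1 f"
  shows "test_function (ball 0 1) (\<lambda>x. sphere_cutoff n x * f x)"
proof (rule test_functionI)
  let ?K = "cball (0 :: 'a) (sqrt (1 - 1 / (real n + 3)))"
  show "C1 (\<lambda>x. sphere_cutoff n x * f x)" by (intro C1_mult C1_sphere_cutoff f)
  show "compact ?K" by simp
  have "sqrt (1 - 1 / (real n + 3)) < 1" by simp
  then show "?K \<subseteq> ball 0 1" by (auto simp: subset_iff intro: order_le_less_trans)
  show "sphere_cutoff n x * f x = 0" if "x \<notin> ?K" for x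
  proof -
    have "1 - 1 / (real n + 3) < (norm x)\<^sup>2"
    proof (rule ccontr)
      assume "\<not> ?thesis"
      then have "sqrt ((norm x)\<^sup>2) \<le> sqrt (1 - 1 / (real n + 3))" by (intro real_sqrt_le_mono) simp
      then show False using that by simp
    qed
    then have "(real n + 3) * (1 - (norm x)\<^sup>2) - 1 \<le> 0" by (simp add: field_simps)
    then show ?thesis by (simp add: sphere_cutoff_def transition_0)
  qed
qed

text \<open>The derivative of the cutoff is of order \<open>n\<close> on a shell of thickness of order \<open>1 / n\<close>. By the shell
estimate its product with \<open>z\<close> therefore stays bounded in \<open>L\<^sup>2\<close>, while the \<open>L\<^sup>2\<close> norm of \<open>p\<close> over the
shell tends to \<open>0\<close>.\<close>

lemma cutoff_error_tendsto_0:
  fixes z p :: "'n::finite space \<Rightarrow> real"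
  assumes y: "H1_approx half_ball y z D"
    and trace: "(\<lambda>n. L2_norm hemisphere_measure (y n)) \<longlonglongrightarrow> 0"
    and p: "square_integrable (lebesgue_on half_ball) p" and e: "e \<in> Basis"
  shows "(\<lambda>n. LINT x|lebesgue_on half_ball. p x * (frechet_derivative (sphere_cutoff n) (at x) e * z x)) \<longlonglongrightarrow> 0"
proof -
  let ?M = "lebesgue_on (half_ball :: 'n space set)"
  define r where "r n = (indicator {x. 1 - 2 / (real n + 3) < norm x} :: 'n space \<Rightarrow> real)" for n :: nat
  define d where "d n x = frechet_derivative (sphere_cutoff n) (at x) e" for n and x :: "'n space"
  define A where "A = (\<Sum>e\<in>Basis. LINT x|?M. (D e x)\<^sup>2)"
  have rm: "r n \<in> borel_measurable ?M" for n
  proof -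
    have "open {x :: 'n space. 1 - 2 / (real n + 3) < norm x}" by (intro open_Collect_less continuous_intros)
    then show ?thesis unfolding r_def by (intro borel_measurable_lebesgue_onI borel_measurable_indicator) simp
  qed
  have rb: "\<bar>r n x\<bar> \<le> 1" for n x by (simp add: r_def indicator_def)
  have z: "square_integrable ?M z" using y by (simp add: H1_approx_def L2_tendsto_def)
  have D2: "\<And>e. e \<in> Basis \<Longrightarrow> integrable ?M (\<lambda>x. (D e x)\<^sup>2)"
    using y by (auto simp: H1_approx_def L2_tendsto_def square_integrable_def)
  have dm: "d n \<in> borel_measurable ?M" for n
    unfolding d_def by (intro borel_measurable_lebesgue_onI C1_partial_measurable C1_sphere_cutoff)
  have db: "\<bar>d n x\<bar> \<le> 8 * (real n + 3) * r n x" if "x \<in> half_ball" for n x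
    unfolding d_def r_def using that by (intro sphere_cutoff_derivative_bound[OF e]) (simp add: half_ball_def)
  have db': "\<bar>d n x\<bar> \<le> 8 * (real n + 3)" if "x \<in> space ?M" for n x
  proof -
    have "\<bar>d n x\<bar> \<le> 8 * (real n + 3) * r n x" using db that by simp
    also have "\<dots> \<le> 8 * (real n + 3) * 1"
      by (rule mult_left_mono) (simp_all add: r_def indicator_def)
    finally show ?thesis by simp
  qed
  have dz: "square_integrable ?M (\<lambda>x. d n x * z x)" for n
    by (rule square_integrable_bounded_mult[OF z dm db'])
  have rp: "square_integrable ?M (\<lambda>x. r n x * p x)" for n
    by (rule square_integrable_bounded_mult[OF p rm rb])
  have A: "0 \<le> A" unfolding A_def by (intro sum_nonneg Bochner_Integration.integral_nonneg) simp
  have dz_bound: "L2_norm ?M (\<lambda>x. d n x * z x) \<le> sqrt (512 * A)" for n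
  proof -
    let ?m = "real n + 3"
    have rz: "integrable ?M (\<lambda>x. r n x * (z x)\<^sup>2)"
      using z by (intro integrable_bounded_mult[OF _ rm rb]) (simp add: square_integrable_def)
    have "(LINT x|?M. (d n x * z x)\<^sup>2) \<le> (LINT x|?M. (8 * ?m)\<^sup>2 * (r n x * (z x)\<^sup>2))"
    proof (rule integral_mono)
      show "integrable ?M (\<lambda>x. (d n x * z x)\<^sup>2)" using dz by (simp add: square_integrable_def)
      show "integrable ?M (\<lambda>x. (8 * ?m)\<^sup>2 * (r n x * (z x)\<^sup>2))" by (rule integrable_mult_right[OF rz])
      fix x assume "x \<in> space ?M"
      then have "\<bar>d n x\<bar>\<^sup>2 \<le> (8 * ?m * r n x)\<^sup>2" by (intro power_mono db) auto
      moreover have "(r n x)\<^sup>2 = r n x" by (simp add: r_def indicator_def)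
      ultimately have "(d n x)\<^sup>2 \<le> (8 * ?m)\<^sup>2 * r n x" by (simp add: power_mult_distrib)
      from mult_right_mono[OF this, of "(z x)\<^sup>2"]
      show "(d n x * z x)\<^sup>2 \<le> (8 * ?m)\<^sup>2 * (r n x * (z x)\<^sup>2)" by (simp add: power_mult_distrib mult.assoc)
    qed
    also have "\<dots> = (8 * ?m)\<^sup>2 * (LINT x|?M. r n x * (z x)\<^sup>2)" by simp
    also have "\<dots> \<le> (8 * ?m)\<^sup>2 * (2 * (1 - (1 - 2 / ?m))\<^sup>2 * A)"
    proof (rule mult_left_mono)
      have "(LINT x|?M. r n x * (z x)\<^sup>2) \<le> 2 * (1 - (1 - 2 / ?m))\<^sup>2 * (\<Sum>e\<in>Basis. LINT x|?M. r n x * (D e x)\<^sup>2)"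
        unfolding r_def by (rule shell_estimate[OF y trace]) (auto simp: field_simps)
      also have "\<dots> \<le> 2 * (1 - (1 - 2 / ?m))\<^sup>2 * A"
        unfolding A_def
      proof (intro mult_left_mono sum_mono)
        fix e :: "'n space" assume e: "e \<in> Basis"
        show "(LINT x|?M. r n x * (D e x)\<^sup>2) \<le> (LINT x|?M. (D e x)\<^sup>2)"
          by (rule integral_mono[OF integrable_bounded_mult[OF D2[OF e] rm rb] D2[OF e]])
             (simp add: r_def indicator_def)
      qed simp
      finally show "(LINT x|?M. r n x * (z x)\<^sup>2) \<le> 2 * (1 - (1 - 2 / ?m))\<^sup>2 * A" .
    qed simp
    also have "\<dots> = 512 * A"
    proof -
      have "(8 * m)\<^sup>2 * (2 * x\<^sup>2 * A) = 128 * (m * x)\<^sup>2 * A" for m x :: real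
        by (simp add: power2_eq_square)
      moreover have "?m * (1 - (1 - 2 / ?m)) = 2"
      proof -
        have cancel: "m * (1 - (1 - 2 / m)) = 2" if "0 < m" for m :: real using that by simp
        show ?thesis by (rule cancel) simp
      qed
      ultimately show ?thesis by (simp only:) simp
    qed
    finally show ?thesis unfolding L2_norm_def by (rule real_sqrt_le_mono)
  qed
  have bound: "\<bar>LINT x|?M. p x * (d n x * z x)\<bar> \<le> L2_norm ?M (\<lambda>x. r n x * p x) * sqrt (512 * A)" for n
  proof -
    have "(LINT x|?M. p x * (d n x * z x)) = (LINT x|?M. (r n x * p x) * (d n x * z x))"
    proof (rule Bochner_Integration.integral_cong)
      fix x assume "x \<in> space ?M"
      then have "\<bar>d n x\<bar> \<le> 8 * (real n + 3) * r n x" using db by simp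
      then have "r n x = 1 \<or> d n x = 0"
        by (cases "1 - 2 / (real n + 3) < norm x") (simp_all add: r_def)
      then show "p x * (d n x * z x) = (r n x * p x) * (d n x * z x)" by auto
    qed simp
    also have "\<bar>\<dots>\<bar> \<le> L2_norm ?M (\<lambda>x. r n x * p x) * L2_norm ?M (\<lambda>x. d n x * z x)"
      by (rule Cauchy_Schwarz_L2[OF rp dz])
    also have "\<dots> \<le> L2_norm ?M (\<lambda>x. r n x * p x) * sqrt (512 * A)"
      by (intro mult_left_mono dz_bound) simp
    finally show ?thesis .
  qed
  have "(\<lambda>n. LINT x|?M. r n x * (p x)\<^sup>2) \<longlonglongrightarrow> 0 * (LINT x|?M. (p x)\<^sup>2)"
  proof (rule integral_bounded_multiplier_tendsto[OF _ rm rb])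
    show "integrable ?M (\<lambda>x. (p x)\<^sup>2)" using p by (simp add: square_integrable_def)
    fix x assume "x \<in> space ?M"
    then have "0 < 1 - norm x" by (simp add: half_ball_def)
    from eventually_flat_cutoff_arg[OF this]
    have "\<forall>\<^sub>F n in sequentially. r n x = 0"
    proof eventually_elim
      case (elim n)
      have "real (Suc n) * (1 - norm x) \<le> (real n + 3) * (1 - norm x)"
        using \<open>0 < 1 - norm x\<close> by (intro mult_right_mono) auto
      then have "2 \<le> (real n + 3) * (1 - norm x)" using elim by linarith
      then have "norm x \<le> 1 - 2 / (real n + 3)" by (simp add: field_simps)
      then show ?case by (simp add: r_def)
    qed
    then show "(\<lambda>n. r n x) \<longlonglongrightarrow> 0" by (rule tendsto_eventually)
  qed
  moreover have "(\<lambda>x. (r n x * p x)\<^sup>2) = (\<lambda>x. r n x * (p x)\<^sup>2)" for n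
    by (auto simp: r_def indicator_def fun_eq_iff)
  ultimately have "(\<lambda>n. sqrt (LINT x|?M. (r n x * p x)\<^sup>2)) \<longlonglongrightarrow> sqrt 0"
    by (intro tendsto_real_sqrt) simp
  then have "(\<lambda>n. L2_norm ?M (\<lambda>x. r n x * p x) * sqrt (512 * A)) \<longlonglongrightarrow> 0"
    unfolding L2_norm_def by (intro tendsto_mult_left_zero) simp
  then show ?thesis
    unfolding d_def[symmetric] by (rule Lim_null_comparison[rotated]) (use bound in auto)
qed

lemma remove_sphere_cutoff:
  fixes z p q :: "'n::finite space \<Rightarrow> real"
  assumes y: "H1_approx half_ball y z D"
    and trace: "(\<lambda>n. L2_norm hemisphere_measure (y n)) \<longlonglongrightarrow> 0"
    and p: "square_integrable (lebesgue_on half_ball) p" and q: "square_integrable (lebesgue_on half_ball) q"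
    and e: "e \<in> Basis"
    and cut: "\<And>n. (LINT x|lebesgue_on half_ball.
        p x * (sphere_cutoff n x * D e x + frechet_derivative (sphere_cutoff n) (at x) e * z x))
      + (LINT x|lebesgue_on half_ball. q x * (sphere_cutoff n x * z x)) \<le> 0"
  shows "(LINT x|lebesgue_on half_ball. p x * D e x) + (LINT x|lebesgue_on half_ball. q x * z x) \<le> 0"
proof -
  let ?M = "lebesgue_on (half_ball :: 'n space set)"
  have z: "square_integrable ?M z" and D: "square_integrable ?M (D e)"
    using y e by (auto simp: H1_approx_def L2_tendsto_def)
  have cm: "sphere_cutoff n \<in> borel_measurable ?M" for n
    by (intro borel_measurable_lebesgue_onI C1_D(4) C1_sphere_cutoff)
  have cb: "\<bar>sphere_cutoff n x\<bar> \<le> 1" for n and x :: "'n space"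
    using sphere_cutoff_bounds[of n x] by simp
  have cl: "(\<lambda>n. sphere_cutoff n x) \<longlonglongrightarrow> 1" if "x \<in> space ?M" for x
    using that by (intro sphere_cutoff_tendsto_1) (simp add: half_ball_def)
  have pD: "integrable ?M (\<lambda>x. p x * D e x)" and qz: "integrable ?M (\<lambda>x. q x * z x)"
    by (intro square_integrable_mult p q z D)+
  have l1: "(\<lambda>n. LINT x|?M. sphere_cutoff n x * (p x * D e x)) \<longlonglongrightarrow> 1 * (LINT x|?M. p x * D e x)"
    by (rule integral_bounded_multiplier_tendsto[OF pD cm cb cl])
  have l2: "(\<lambda>n. LINT x|?M. sphere_cutoff n x * (q x * z x)) \<longlonglongrightarrow> 1 * (LINT x|?M. q x * z x)"
    by (rule integral_bounded_multiplier_tendsto[OF qz cm cb cl])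
  note l3 = cutoff_error_tendsto_0[OF y trace p e]
  have "(LINT x|?M. sphere_cutoff n x * (p x * D e x))
      + (LINT x|?M. p x * (frechet_derivative (sphere_cutoff n) (at x) e * z x))
      + (LINT x|?M. sphere_cutoff n x * (q x * z x)) \<le> 0" for n
  proof -
    have i1: "integrable ?M (\<lambda>x. sphere_cutoff n x * (p x * D e x))"
      by (rule integrable_bounded_mult[OF pD cm cb])
    obtain B where B: "\<And>x :: 'n space. x \<in> half_ball \<Longrightarrow> \<bar>frechet_derivative (sphere_cutoff n) (at x) e\<bar> \<le> B"
      using continuous_bounded_on_bounded[OF C1_continuous_partial[OF C1_sphere_cutoff(1), of UNIV n e] bounded_half_ball]
      by blast
    have "square_integrable ?M (\<lambda>x. frechet_derivative (sphere_cutoff n) (at x) e * z x)"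
      by (rule square_integrable_bounded_mult[OF z
            borel_measurable_lebesgue_onI[OF C1_partial_measurable[OF C1_sphere_cutoff(1)]] B]) simp
    then have i2: "integrable ?M (\<lambda>x. p x * (frechet_derivative (sphere_cutoff n) (at x) e * z x))"
      by (rule square_integrable_mult[OF p])
    have "(LINT x|?M. sphere_cutoff n x * (p x * D e x))
        + (LINT x|?M. p x * (frechet_derivative (sphere_cutoff n) (at x) e * z x))
        = (LINT x|?M. p x * (sphere_cutoff n x * D e x + frechet_derivative (sphere_cutoff n) (at x) e * z x))"
      unfolding Bochner_Integration.integral_add[OF i1 i2, symmetric]
      by (intro Bochner_Integration.integral_cong refl) (simp add: algebra_simps)
    then show ?thesis using cut[of n] by (simp add: mult.left_commute)
  qed
  moreover have "(\<lambda>n. (LINT x|?M. sphere_cutoff n x * (p x * D e x))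
      + (LINT x|?M. p x * (frechet_derivative (sphere_cutoff n) (at x) e * z x))
      + (LINT x|?M. sphere_cutoff n x * (q x * z x)))
      \<longlonglongrightarrow> 1 * (LINT x|?M. p x * D e x) + 0 + 1 * (LINT x|?M. q x * z x)"
    by (intro tendsto_add l1 l2 l3)
  ultimately show ?thesis using LIMSEQ_le_const2 by fastforce
qed

text \<open>A tangential derivative produces no term on the flat boundary, so a weak derivative of \<open>p\<close> in the
open half ball suffices.\<close>

lemma tangential_integration_by_parts:
  fixes z p q :: "'n::finite space \<Rightarrow> real"
  assumes y: "H1_approx half_ball y z D"
    and trace: "(\<lambda>n. L2_norm hemisphere_measure (y n)) \<longlonglongrightarrow> 0"
    and p: "square_integrable (lebesgue_on half_ball) p" and pq: "has_weak_partial half_ball e p q"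
    and e: "e \<in> Basis" "snd e = 0"
  shows "(LINT x|lebesgue_on half_ball. p x * D e x) + (LINT x|lebesgue_on half_ball. q x * z x) \<le> 0"
proof (rule remove_sphere_cutoff[OF y trace p _ e(1)])
  let ?M = "lebesgue_on (half_ball :: 'n space set)"
  show q: "square_integrable ?M q" using pq by (simp add: has_weak_partial_def)
  fix n
  let ?z = "\<lambda>x. sphere_cutoff n x * z x"
  let ?D = "\<lambda>x. sphere_cutoff n x * D e x + frechet_derivative (sphere_cutoff n) (at x) e * z x"
  let ?t = "\<lambda>k x. sphere_cutoff n x * y k x"
  have "H1_approx half_ball ?t ?z (\<lambda>e x. sphere_cutoff n x * D e x + frechet_derivative (sphere_cutoff n) (at x) e * z x)"
    by (rule H1_approx_mult[OF y C1_sphere_cutoff(1) bounded_half_ball])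
  then have l: "L2_tendsto ?M ?t ?z" "L2_tendsto ?M (\<lambda>k x. frechet_derivative (?t k) (at x) e) ?D"
    using e(1) by (simp_all add: H1_approx_def)
  have "(LINT x|?M. p x * frechet_derivative (?t k) (at x) e) = - (LINT x|?M. q x * ?t k x)" for k
    using y e(2) by (intro weak_partial_test_up_to_flat[OF p pq] test_function_sphere_cutoff) (auto simp: H1_approx_def)
  moreover have "(\<lambda>k. LINT x|?M. p x * frechet_derivative (?t k) (at x) e) \<longlonglongrightarrow> (LINT x|?M. p x * ?D x)"
    by (rule L2_tendsto_inner[OF L2_tendsto_const[OF p] l(2)])
  moreover have "(\<lambda>k. - (LINT x|?M. q x * ?t k x)) \<longlonglongrightarrow> - (LINT x|?M. q x * ?z x)"
    by (intro tendsto_minus L2_tendsto_inner[OF L2_tendsto_const[OF q] l(1)])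
  ultimately have "(LINT x|?M. p x * ?D x) = - (LINT x|?M. q x * ?z x)"
    using LIMSEQ_unique by simp
  then show "(LINT x|?M. p x * ?D x) + (LINT x|?M. q x * ?z x) \<le> 0" by simp
qed

text \<open>Two approximations of \<open>z\<close> are used. The sequence \<open>t\<close> converges to the trace of \<open>z\<close> on the flat
boundary and yields the boundary term \<open>-\<integral> N T\<close>, weighted by the cutoff near the sphere. The sequence
\<open>y\<close> converges to the zero trace of \<open>z\<close> on the hemisphere and serves to remove that cutoff. The two
traces thus never have to be realised by one sequence.\<close>

lemma normal_integration_by_parts:
  fixes z p :: "'n::finite space \<Rightarrow> real"
  assumes y: "H1_approx half_ball y z D"
    and trace: "(\<lambda>n. L2_norm hemisphere_measure (y n)) \<longlonglongrightarrow> 0"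
    and t: "H1_approx half_ball t z D" and tT: "L2_tendsto flat_measure t T"
    and p: "has_trace half_ball flat_measure p N"
    and sign: "AE x in flat_measure. 0 \<le> N x * T x"
  shows "(LINT x|lebesgue_on half_ball. p x * D (0, 1) x)
    + (LINT x|lebesgue_on half_ball. weak_partial half_ball (0, 1) p x * z x) \<le> 0"
proof -
  let ?M = "lebesgue_on (half_ball :: 'n space set)"
  let ?e = "(0, 1) :: 'n space" and ?q = "weak_partial half_ball (0, 1) p"
  have e: "?e \<in> Basis" by (simp add: Basis_prod_def)
  have pH: "p \<in> H1 half_ball" using p by (simp add: has_trace_def)
  obtain w where w: "H1_approx half_ball w p (\<lambda>e. weak_partial half_ball e p)" "L2_tendsto flat_measure w N"
    using has_trace_approx[OF bounded_half_ball open_half_ball square_integrable_flat_measure p] by blast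
  have wC: "C1 (w k)" and tC: "C1 (t k)" for k using w(1) t by (auto simp: H1_approx_def)
  show ?thesis
  proof (rule remove_sphere_cutoff[OF y trace H1_D(1)[OF pH] H1_D(3)[OF pH e] e])
    fix n
    let ?z = "\<lambda>x. sphere_cutoff n x * z x"
    let ?D = "\<lambda>x. sphere_cutoff n x * D ?e x + frechet_derivative (sphere_cutoff n) (at x) ?e * z x"
    let ?t = "\<lambda>k x. sphere_cutoff n x * t k x"
    have "H1_approx half_ball ?t ?z (\<lambda>e x. sphere_cutoff n x * D e x + frechet_derivative (sphere_cutoff n) (at x) e * z x)"
      by (rule H1_approx_mult[OF t C1_sphere_cutoff(1) bounded_half_ball])
    then have l: "L2_tendsto ?M ?t ?z" "L2_tendsto ?M (\<lambda>k x. frechet_derivative (?t k) (at x) ?e) ?D"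
      using e by (simp_all add: H1_approx_def)
    have lw: "L2_tendsto ?M w p" "L2_tendsto ?M (\<lambda>k x. frechet_derivative (w k) (at x) ?e) ?q"
      using w(1) e by (simp_all add: H1_approx_def)
    have lT: "L2_tendsto flat_measure ?t (\<lambda>x. sphere_cutoff n x * T x)"
    proof (rule L2_tendsto_bounded_mult[OF tT])
      show "sphere_cutoff n \<in> borel_measurable flat_measure"
        using C1_D(4)[OF C1_sphere_cutoff(1)] by (simp add: measurable_cong_sets[OF sets_flat_measure refl])
      show "\<bar>sphere_cutoff n x\<bar> \<le> 1" for x :: "'n space" using sphere_cutoff_bounds[of n x] by simp
    qed
    have "(LINT x|?M. w k x * frechet_derivative (?t k) (at x) ?e)
        + (LINT x|?M. frechet_derivative (w k) (at x) ?e * ?t k x) = - (LINT x|flat_measure. w k x * ?t k x)" for k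
    proof -
      have tk: "test_function (ball 0 1) (?t k)" by (rule test_function_sphere_cutoff[OF tC])
      \<comment> \<open>classical integration by parts for the \<open>C\<^sup>1\<close> approximations of \<open>p\<close> and of the truncated \<open>z\<close>\<close>
      note sq = C1_square_integrable[OF wC bounded_half_ball open_half_ball]
        C1_square_integrable[OF test_function_D(1)[OF tk] bounded_half_ball open_half_ball]
      have "(LINT x|?M. w k x * frechet_derivative (?t k) (at x) ?e)
          + (LINT x|?M. frechet_derivative (w k) (at x) ?e * ?t k x)
          = (LINT x|?M. frechet_derivative (\<lambda>x. w k x * ?t k x) (at x) ?e)"
        unfolding C1_mult(2)[OF wC test_function_D(1)[OF tk]]
        by (rule Bochner_Integration.integral_add[symmetric]) (intro square_integrable_mult sq)+
      also have "\<dots> = - (LINT x|flat_measure. w k x * ?t k x)"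
        by (rule integral_normal_partial_half_ball[OF test_function_mult[OF tk wC]])
      finally show ?thesis .
    qed
    moreover have "(\<lambda>k. (LINT x|?M. w k x * frechet_derivative (?t k) (at x) ?e)
        + (LINT x|?M. frechet_derivative (w k) (at x) ?e * ?t k x))
        \<longlonglongrightarrow> (LINT x|?M. p x * ?D x) + (LINT x|?M. ?q x * ?z x)"
      by (intro tendsto_add L2_tendsto_inner[OF lw(1) l(2)] L2_tendsto_inner[OF lw(2) l(1)])
    moreover have "(\<lambda>k. - (LINT x|flat_measure. w k x * ?t k x))
        \<longlonglongrightarrow> - (LINT x|flat_measure. N x * (sphere_cutoff n x * T x))"
      by (intro tendsto_minus L2_tendsto_inner[OF w(2) lT])
    ultimately have "(LINT x|?M. p x * ?D x) + (LINT x|?M. ?q x * ?z x)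
        = - (LINT x|flat_measure. N x * (sphere_cutoff n x * T x))"
      using LIMSEQ_unique by simp
    moreover have "0 \<le> (LINT x|flat_measure. N x * (sphere_cutoff n x * T x))"
    proof (rule integral_nonneg_AE)
      show "AE x in flat_measure. 0 \<le> N x * (sphere_cutoff n x * T x)"
        using sign
      proof eventually_elim
        case (elim x)
        have "0 \<le> sphere_cutoff n x * (N x * T x)" using sphere_cutoff_bounds(1) elim by (rule mult_nonneg_nonneg)
        then show ?case by (simp add: mult.left_commute)
      qed
    qed
    ultimately show "(LINT x|?M. p x * ?D x) + (LINT x|?M. ?q x * ?z x) \<le> 0" by simp
  qed
qed

section \<open>The energy gap\<close>

lemma same_hemisphere_trace_approx:
  fixes u g :: "'n::finite space \<Rightarrow> real"
  assumes u: "has_trace half_ball hemisphere_measure u T" and g: "has_trace half_ball hemisphere_measure g T"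
  obtains w where "H1_approx half_ball w (\<lambda>x. u x - g x)
      (\<lambda>e x. weak_partial half_ball e u x - weak_partial half_ball e g x)"
    "L2_tendsto hemisphere_measure w (\<lambda>_. 0)"
proof -
  note M = bounded_half_ball open_half_ball square_integrable_hemisphere_measure
  obtain a where a: "H1_approx half_ball a u (\<lambda>e. weak_partial half_ball e u)" "L2_tendsto hemisphere_measure a T"
    using has_trace_approx[OF M u] by blast
  obtain b where b: "H1_approx half_ball b g (\<lambda>e. weak_partial half_ball e g)" "L2_tendsto hemisphere_measure b T"
    using has_trace_approx[OF M g] by blast
  show thesis
    using that[OF H1_approx_diff[OF a(1) b(1)]] L2_tendsto_diff[OF a(2) b(2)] by simp
qed

text \<open>Membership in \<open>K_th g\<close> provides a common trace of \<open>u\<close> and \<open>g\<close> and a common trace of \<open>v\<close> and \<open>g\<close>.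
Approximating \<open>u - g\<close> and \<open>v - g\<close> separately, each with zero trace, avoids having to know that the
two traces of \<open>g\<close> coincide.\<close>

lemma K_th_difference_approx:
  fixes u v :: "'n::finite space \<Rightarrow> real"
  assumes u: "u \<in> K_th g" and v: "v \<in> K_th g"
  obtains y where "H1_approx half_ball y (\<lambda>x. u x - v x)
      (\<lambda>e x. weak_partial half_ball e u x - weak_partial half_ball e v x)"
    "(\<lambda>n. L2_norm hemisphere_measure (y n)) \<longlonglongrightarrow> 0"
proof -
  obtain a where a: "H1_approx half_ball a (\<lambda>x. u x - g x)
      (\<lambda>e x. weak_partial half_ball e u x - weak_partial half_ball e g x)"
      "L2_tendsto hemisphere_measure a (\<lambda>_. 0)"
    using u same_hemisphere_trace_approx unfolding K_th_def by blast
  obtain b where b: "H1_approx half_ball b (\<lambda>x. v x - g x)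
      (\<lambda>e x. weak_partial half_ball e v x - weak_partial half_ball e g x)"
      "L2_tendsto hemisphere_measure b (\<lambda>_. 0)"
    using v same_hemisphere_trace_approx unfolding K_th_def by blast
  show thesis
    using that[of "\<lambda>n x. a n x - b n x"] H1_approx_diff[OF a(1) b(1)] L2_tendsto_diff[OF a(2) b(2)]
    by (simp add: L2_tendsto_def)
qed

text \<open>With \<open>z = u - \<phi>\<close>, the energy gap equals \<open>2 \<integral> \<nabla>u \<bullet> \<nabla>z - \<integral> |\<nabla>z|\<^sup>2\<close>. Integration by parts bounds the first
term by \<open>-2 \<integral> z \<Delta>u\<close>: on the flat boundary \<open>N (T - S) = - N S\<close>, where \<open>S\<close> is a trace of \<open>\<phi>\<close>, and this is
nonnegative. Here \<open>A\<close> is the Dirichlet integral of \<open>z\<close>, and the bound on the \<open>L\<^sup>2\<close> norm is the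
Poincare inequality.\<close>

lemma energy_gap_estimate:
  fixes g \<phi> u T N :: "'n::finite space \<Rightarrow> real"
  assumes \<phi>: "\<phi> \<in> K_th g" and u: "u \<in> H2 half_ball" "u \<in> K_th g"
    and T: "has_trace half_ball flat_measure u T"
    and N: "has_trace half_ball flat_measure (weak_partial half_ball (0, 1) u) N"
    and N_le: "AE x in flat_measure. N x \<le> 0" and TN: "AE x in flat_measure. T x * N x = 0"
  obtains A where "0 \<le> A" "(L2_norm (lebesgue_on half_ball) (\<lambda>x. \<phi> x - u x))\<^sup>2 \<le> 2 * A"
    "F_th u - F_th \<phi> \<le> 2 * (LINT x|lebesgue_on half_ball. (\<phi> x - u x) * weak_laplacian half_ball u x) - A"
proof -
  let ?M = "lebesgue_on (half_ball :: 'n space set)"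
  let ?z = "\<lambda>x. u x - \<phi> x"
  define p where "p e = weak_partial half_ball e u" for e
  define f where "f e = weak_partial half_ball e \<phi>" for e
  define q where "q e = weak_partial half_ball e (p e)" for e
  let ?D = "\<lambda>e x. p e x - f e x"
  have uH: "u \<in> H1 half_ball" and \<phi>H: "\<phi> \<in> H1 half_ball" using u \<phi> by (auto simp: K_th_def)
  have pH: "p e \<in> H1 half_ball" if "e \<in> Basis" for e
    using u(1) that by (simp add: H2_def p_def)
  have psq: "square_integrable ?M (p e)" and fsq: "square_integrable ?M (f e)"
    and qsq: "square_integrable ?M (q e)" and pq: "has_weak_partial half_ball e (p e) (q e)" if "e \<in> Basis" for e
    using H1_D[OF uH] H1_D[OF \<phi>H] H1_D[OF pH] that by (auto simp: p_def f_def q_def)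
  obtain y where y: "H1_approx half_ball y ?z ?D" "(\<lambda>n. L2_norm hemisphere_measure (y n)) \<longlonglongrightarrow> 0"
    using K_th_difference_approx[OF u(2) \<phi>] unfolding p_def f_def by blast
  have parts: "(LINT x|?M. p e x * ?D e x) + (LINT x|?M. q e x * ?z x) \<le> 0" if e: "e \<in> Basis" for e
    using e
  proof (cases rule: Basis_space_cases)
    case 1
    then show ?thesis by (rule tangential_integration_by_parts[OF y psq[OF e] pq[OF e] e])
  next
    case 2
    obtain S where S: "has_trace half_ball flat_measure \<phi> S" "AE x in flat_measure. 0 \<le> S x"
      using \<phi> by (auto simp: K_th_def nonneg_on_flat_def)
    note M = bounded_half_ball open_half_ball square_integrable_flat_measure
    obtain a where a: "H1_approx half_ball a u (\<lambda>e. weak_partial half_ball e u)" "L2_tendsto flat_measure a T"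
      using has_trace_approx[OF M T] by blast
    obtain b where b: "H1_approx half_ball b \<phi> (\<lambda>e. weak_partial half_ball e \<phi>)" "L2_tendsto flat_measure b S"
      using has_trace_approx[OF M S(1)] by blast
    have t: "H1_approx half_ball (\<lambda>n x. a n x - b n x) ?z ?D"
      using H1_approx_diff[OF a(1) b(1)] by (simp add: p_def f_def)
    have sign: "AE x in flat_measure. 0 \<le> N x * (T x - S x)"
      using N_le TN S(2)
    proof eventually_elim
      case (elim x)
      have "N x * S x \<le> 0" using elim by (intro mult_nonpos_nonneg)
      moreover have "N x * T x = 0" using elim by (simp add: mult.commute)
      ultimately show ?case unfolding right_diff_distrib by linarith
    qed
    show ?thesis
      using normal_integration_by_parts[OF y t L2_tendsto_diff[OF a(2) b(2)] N sign] 2 by (simp add: p_def q_def)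
  qed
  define A where "A = (\<Sum>e\<in>Basis. LINT x|?M. (?D e x)\<^sup>2)"
  define I where "I = (LINT x|?M. (\<phi> x - u x) * weak_laplacian half_ball u x)"
  have zsq: "square_integrable ?M ?z" using H1_D(1)[OF uH] H1_D(1)[OF \<phi>H] by (rule square_integrable_diff)
  have Dsq: "square_integrable ?M (?D e)" if "e \<in> Basis" for e
    using psq[OF that] fsq[OF that] by (rule square_integrable_diff)
  have "0 \<le> A" unfolding A_def by (intro sum_nonneg Bochner_Integration.integral_nonneg) simp
  moreover have "(L2_norm ?M (\<lambda>x. \<phi> x - u x))\<^sup>2 \<le> 2 * A"
    using Poincare_inequality[OF y] unfolding L2_norm_power2 A_def by (simp add: power2_commute)
  moreover have "F_th u - F_th \<phi> \<le> 2 * I - A"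
  proof -
    have I: "I = - (\<Sum>e\<in>Basis. LINT x|?M. q e x * ?z x)"
    proof -
      have "I = (LINT x|?M. - (\<Sum>e\<in>Basis. q e x * ?z x))"
        unfolding I_def
        by (intro Bochner_Integration.integral_cong refl)
           (simp add: weak_laplacian_def q_def p_def sum_distrib_left sum_negf[symmetric] algebra_simps)
      also have "\<dots> = - (\<Sum>e\<in>Basis. LINT x|?M. q e x * ?z x)"
        using square_integrable_mult[OF qsq zsq]
        by (simp only: Bochner_Integration.integral_minus) (subst Bochner_Integration.integral_sum, auto)
      finally show ?thesis .
    qed
    have "F_th u - F_th \<phi> = (\<Sum>e\<in>Basis. (LINT x|?M. (p e x)\<^sup>2) - (LINT x|?M. (f e x)\<^sup>2))"
      by (simp add: F_th_eq_sum_half_ball[OF uH] F_th_eq_sum_half_ball[OF \<phi>H] p_def f_def sum_subtractf)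
    also have "\<dots> = (\<Sum>e\<in>Basis. 2 * (LINT x|?M. p e x * ?D e x) - (LINT x|?M. (?D e x)\<^sup>2))"
    proof (rule sum.cong[OF refl])
      fix e :: "'n space" assume e: "e \<in> Basis"
      have i: "integrable ?M (\<lambda>x. (p e x)\<^sup>2)" "integrable ?M (\<lambda>x. (f e x)\<^sup>2)"
        "integrable ?M (\<lambda>x. p e x * ?D e x)" "integrable ?M (\<lambda>x. (?D e x)\<^sup>2)"
        using psq[OF e] fsq[OF e] Dsq[OF e] square_integrable_mult[OF psq[OF e] Dsq[OF e]]
        by (auto simp: square_integrable_def)
      have "(LINT x|?M. (p e x)\<^sup>2) - (LINT x|?M. (f e x)\<^sup>2) = (LINT x|?M. (p e x)\<^sup>2 - (f e x)\<^sup>2)"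
        using i by simp
      also have "\<dots> = (LINT x|?M. 2 * (p e x * ?D e x) - (?D e x)\<^sup>2)"
        by (intro Bochner_Integration.integral_cong refl) (simp add: power2_eq_square algebra_simps)
      also have "\<dots> = 2 * (LINT x|?M. p e x * ?D e x) - (LINT x|?M. (?D e x)\<^sup>2)"
        using i(3,4) by (subst Bochner_Integration.integral_diff) auto
      finally show "(LINT x|?M. (p e x)\<^sup>2) - (LINT x|?M. (f e x)\<^sup>2)
          = 2 * (LINT x|?M. p e x * ?D e x) - (LINT x|?M. (?D e x)\<^sup>2)" .
    qed
    also have "\<dots> = 2 * (\<Sum>e\<in>Basis. LINT x|?M. p e x * ?D e x) - A"
      by (simp add: A_def sum_subtractf sum_distrib_left)
    also have "(\<Sum>e\<in>Basis. LINT x|?M. p e x * ?D e x) \<le> I"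
    proof -
      have "(\<Sum>e\<in>Basis. (LINT x|?M. p e x * ?D e x) + (LINT x|?M. q e x * ?z x)) \<le> 0"
        by (intro sum_nonpos parts)
      then show ?thesis unfolding I by (simp add: sum.distrib)
    qed
    finally show ?thesis by simp
  qed
  ultimately show thesis using that unfolding I_def by blast
qed

text \<open>This is the definition of the supremum when \<open>v\<close> and \<open>u\<close> differ on a set of positive measure. If they
agree almost everywhere, the left-hand side is \<open>0\<close>.\<close>

lemma grad_F_norm_bound:
  fixes u v :: "'n::finite space \<Rightarrow> real"
  assumes u: "u \<in> H2 half_ball" and v: "v \<in> K_th g" and G: "grad_F_norm g u \<le> ereal G"
  shows "(LINT x|lebesgue_on half_ball. (v x - u x) * weak_laplacian half_ball u x)
    \<le> G * L2_norm (lebesgue_on half_ball) (\<lambda>x. v x - u x)"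
proof -
  let ?M = "lebesgue_on (half_ball :: 'n space set)"
  let ?I = "LINT x|?M. (v x - u x) * weak_laplacian half_ball u x"
  let ?n = "L2_norm ?M (\<lambda>x. v x - u x)"
  have uH: "u \<in> H1 half_ball" and vH: "v \<in> H1 half_ball" using u v by (auto simp: H2_def K_th_def)
  have sq: "square_integrable ?M (\<lambda>x. v x - u x)"
    using H1_D(1)[OF vH] H1_D(1)[OF uH] by (rule square_integrable_diff)
  show ?thesis
  proof (cases "?n = 0")
    case True
    have "weak_partial half_ball e u \<in> H1 half_ball" if "e \<in> Basis" for e using u that by (simp add: H2_def)
    then have "square_integrable ?M (weak_laplacian half_ball u)"
      unfolding weak_laplacian_def[abs_def] by (intro square_integrable_sum H1_D(3))
    from Cauchy_Schwarz_L2[OF sq this] show ?thesis using True by simp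
  next
    case False
    have "\<not> (AE x in ?M. v x = u x)"
    proof
      assume "AE x in ?M. v x = u x"
      then have "AE x in ?M. (v x - u x)\<^sup>2 = 0" by eventually_elim simp
      then have "(LINT x|?M. (v x - u x)\<^sup>2) = 0" by (rule integral_eq_zero_AE)
      then show False using False by (simp add: L2_norm_def)
    qed
    then have "ereal (?I / ?n) \<le> grad_F_norm g u"
      unfolding grad_F_norm_def using v by (intro max.coboundedI2 SUP_upper) simp
    also have "\<dots> \<le> ereal G" by (rule G)
    finally have "?I / ?n \<le> G" by simp
    moreover have "0 < ?n" using False L2_norm_nonneg[of ?M "\<lambda>x. v x - u x"] by linarith
    ultimately show ?thesis by (simp add: field_simps)
  qed
qed

theorem proposition4p2:
  "\<exists>C::real. 0 < C \<and>
     (\<forall>(g :: 'n::finite space \<Rightarrow> real) \<phi> u T N.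
        g \<in> H1 half_ball \<longrightarrow> nonneg_on_flat g \<longrightarrow>
        thin_obstacle_solution g \<phi> \<longrightarrow>
        u \<in> H2 half_ball \<inter> K_th g \<longrightarrow>
        has_trace half_ball flat_measure u T \<longrightarrow>
        has_trace half_ball flat_measure (weak_partial half_ball (0, 1) u) N \<longrightarrow>
        (AE x in flat_measure. N x \<le> 0) \<longrightarrow>
        (AE x in flat_measure. T x * N x = 0) \<longrightarrow>
        ereal (sqrt (F_th u - F_th \<phi>)) \<le> ereal C * grad_F_norm g u)"
proof (intro exI[of _ "sqrt 2"] conjI allI impI)
  fix g \<phi> u T N :: "'n space \<Rightarrow> real"
  assume \<phi>: "thin_obstacle_solution g \<phi>" and u: "u \<in> H2 half_ball \<inter> K_th g"
    and T: "has_trace half_ball flat_measure u T"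
    and N: "has_trace half_ball flat_measure (weak_partial half_ball (0, 1) u) N"
    and N_le: "AE x in flat_measure. N x \<le> 0" and TN: "AE x in flat_measure. T x * N x = 0"
  have \<phi>K: "\<phi> \<in> K_th g" using \<phi> by (simp add: thin_obstacle_solution_def)
  have uK: "u \<in> H2 half_ball" "u \<in> K_th g" using u by auto
  have nonneg: "0 \<le> grad_F_norm g u" by (simp add: grad_F_norm_def)
  show "ereal (sqrt (F_th u - F_th \<phi>)) \<le> ereal (sqrt 2) * grad_F_norm g u"
  proof (cases "grad_F_norm g u")
    case (real G)
    let ?n = "L2_norm (lebesgue_on half_ball) (\<lambda>x. \<phi> x - u x)"
    have G: "0 \<le> G" using nonneg real by simp
    obtain A where A: "0 \<le> A" "?n\<^sup>2 \<le> 2 * A"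
      "F_th u - F_th \<phi> \<le> 2 * (LINT x|lebesgue_on half_ball. (\<phi> x - u x) * weak_laplacian half_ball u x) - A"
      using energy_gap_estimate[OF \<phi>K uK T N N_le TN] by blast
    have "?n \<le> sqrt (2 * A)" using A(2) by (rule real_le_rsqrt)
    then have "G * ?n \<le> G * (sqrt 2 * sqrt A)" using G by (simp add: mult_left_mono real_sqrt_mult)
    then have "F_th u - F_th \<phi> \<le> 2 * (G * (sqrt 2 * sqrt A)) - A"
      using A(3) grad_F_norm_bound[OF uK(1) \<phi>K, of G] real by simp
    also have "\<dots> \<le> 2 * G\<^sup>2"
    proof -
      \<comment> \<open>the upper bound is largest at \<open>A = 2 G\<^sup>2\<close>, where this square vanishes\<close>
      have "0 \<le> (sqrt 2 * G - sqrt A)\<^sup>2" by simp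
      also have "\<dots> = 2 * G\<^sup>2 - 2 * (G * (sqrt 2 * sqrt A)) + A"
        using A(1) by (simp add: power2_diff power_mult_distrib)
      finally show ?thesis by simp
    qed
    finally have "sqrt (F_th u - F_th \<phi>) \<le> sqrt (2 * G\<^sup>2)" by (rule real_sqrt_le_mono)
    then show ?thesis using G real by (simp add: real_sqrt_mult)
  qed (use nonneg in auto)
qed simp

end
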